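(* Let $0<\theta<0.2345$ (rational or irrational). There exists a projection $e$ of trace $\theta$ in the rotation algebra $A_\theta$ such that $$e\,\sigma(e)=0,\qquad \sigma^2(e)=e.$$ In particular, $e+\sigma(e)$ is a Fourier invariant projection (i.e. $\sigma(e+\sigma(e))=e+\sigma(e)$) of trace $2\theta$.
   Context: For $0<\theta<1$, $A_\theta$ denotes the rotation C*-algebra, i.e. the universal C*-algebra generated by unitaries $U,V$ satisfying $VU=\lambda UV$, where $\lambda=e^{2\pi i\theta}$. The Fourier transform is the automorphism $\sigma$ of $A_\theta$ determined by $\sigma(U)=V$, $\sigma(V)=U^{-1}$; its square $\sigma^2$ is the flip automorphism ($U\mapsto U^{-1}$, $V\mapsto V^{-1}$). The trace is the canonical normalized trace, determined by $U^mV^n\mapsto 0$ for $(m,n)\neq(0,0)$ and $1\mapsto 1$. A projection is an element $e$ with $e=e^*=e^2$. *)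

theory Defs
  imports "HOL-Analysis.Analysis" "HOL-Algebra.Algebra" "HOL-Algebra.Algebraic_Closure_Type"
begin

text \<open>
  A rotation algebra depends on a real parameter, so C*-algebras are set up as carrier-based records
  over \<^theory>\<open>HOL-Algebra.Module\<close> rather than as a type class. The operations are specified
  on the carrier only.
\<close>

record 'a cstar = "(complex, 'a) module" +
  invol :: "'a \<Rightarrow> 'a" (\<open>_\<^sup>\<star>\<index>\<close> [1000] 999)
  nrm :: "'a \<Rightarrow> real"

text \<open>The value off the carrier is fixed because \<^locale>\<open>Metric_space\<close> wants a distance that is
  nonnegative and symmetric on the whole type.\<close>

definition cstar_dist :: "('a, 'm) cstar_scheme \<Rightarrow> 'a \<Rightarrow> 'a \<Rightarrow> real" where
  "cstar_dist A x y =
     (if x \<in> carrier A \<and> y \<in> carrier A then nrm A (x \<ominus>\<^bsub>A\<^esub> y) else 0)"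

text \<open>Unital C*-algebras; the zero algebra is allowed.\<close>

locale cstar_algebra =
  ring A + scalars: Module.module "ring_of_type_algebra :: complex ring" A
  for A :: "('a, 'm) cstar_scheme" (structure) +
  assumes smult_mult_left:
      "\<lbrakk>x \<in> carrier A; y \<in> carrier A\<rbrakk> \<Longrightarrow> (c \<odot> x) \<otimes> y = c \<odot> (x \<otimes> y)"
    and smult_mult_right:
      "\<lbrakk>x \<in> carrier A; y \<in> carrier A\<rbrakk> \<Longrightarrow> x \<otimes> (c \<odot> y) = c \<odot> (x \<otimes> y)"
    and invol_closed: "x \<in> carrier A \<Longrightarrow> x\<^sup>\<star> \<in> carrier A"
    and invol_invol: "x \<in> carrier A \<Longrightarrow> (x\<^sup>\<star>)\<^sup>\<star> = x"
    and invol_add: "\<lbrakk>x \<in> carrier A; y \<in> carrier A\<rbrakk> \<Longrightarrow> (x \<oplus> y)\<^sup>\<star> = x\<^sup>\<star> \<oplus> y\<^sup>\<star>"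
    and invol_smult: "x \<in> carrier A \<Longrightarrow> (c \<odot> x)\<^sup>\<star> = cnj c \<odot> x\<^sup>\<star>"
    and invol_mult: "\<lbrakk>x \<in> carrier A; y \<in> carrier A\<rbrakk> \<Longrightarrow> (x \<otimes> y)\<^sup>\<star> = y\<^sup>\<star> \<otimes> x\<^sup>\<star>"
    and nrm_nonneg: "x \<in> carrier A \<Longrightarrow> nrm A x \<ge> 0"
    and nrm_eq_0: "x \<in> carrier A \<Longrightarrow> nrm A x = 0 \<longleftrightarrow> x = \<zero>"
    and nrm_smult: "x \<in> carrier A \<Longrightarrow> nrm A (c \<odot> x) = cmod c * nrm A x"
    and nrm_triangle:
      "\<lbrakk>x \<in> carrier A; y \<in> carrier A\<rbrakk> \<Longrightarrow> nrm A (x \<oplus> y) \<le> nrm A x + nrm A y"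
    and nrm_mult:
      "\<lbrakk>x \<in> carrier A; y \<in> carrier A\<rbrakk> \<Longrightarrow> nrm A (x \<otimes> y) \<le> nrm A x * nrm A y"
    and cstar_identity: "x \<in> carrier A \<Longrightarrow> nrm A (x\<^sup>\<star> \<otimes> x) = (nrm A x)\<^sup>2"
    and complete: "Metric_space.mcomplete (carrier A) (cstar_dist A)"

sublocale cstar_algebra \<subseteq> metric: Metric_space "carrier A" "cstar_dist A"
proof
  have uminus: "\<ominus> x = (- 1) \<odot> x" if x: "x \<in> carrier A" for x
  proof -
    have "(- 1) \<odot> x \<oplus> x = (- 1) \<odot> x \<oplus> 1 \<odot> x"
      using scalars.smult_one[OF x] by (simp add: ring_of_type_algebra_def)
    also have "\<dots> = (- 1 + 1) \<odot> x"
      using scalars.smult_l_distr[of "- 1" 1 x] x by (simp add: ring_of_type_algebra_def)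
    also have "\<dots> = \<zero>"
      using scalars.smult_l_null[OF x] by (simp add: ring_of_type_algebra_def)
    finally show ?thesis
      using x scalars.smult_closed[of "- 1" x]
      by (intro minus_equality) (auto simp: ring_of_type_algebra_def)
  qed
  have nrm_uminus: "nrm A (\<ominus> x) = nrm A x" if "x \<in> carrier A" for x
    using that by (simp add: uminus nrm_smult)
  show "0 \<le> cstar_dist A x y" for x y
    by (simp add: cstar_dist_def nrm_nonneg)
  show "cstar_dist A x y = cstar_dist A y x" for x y
  proof (cases "x \<in> carrier A \<and> y \<in> carrier A")
    case True
    then have "\<ominus> (x \<ominus> y) = y \<ominus> x"
      by (simp add: minus_eq minus_add a_comm)
    with True show ?thesis
      using nrm_uminus[of "x \<ominus> y"] by (simp add: cstar_dist_def)
  qed (auto simp: cstar_dist_def)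
  show "cstar_dist A x y = 0 \<longleftrightarrow> x = y" if "x \<in> carrier A" "y \<in> carrier A" for x y
    using that by (simp add: cstar_dist_def nrm_eq_0 r_right_minus_eq)
  show "cstar_dist A x z \<le> cstar_dist A x y + cstar_dist A y z"
    if xyz: "x \<in> carrier A" "y \<in> carrier A" "z \<in> carrier A" for x y z
  proof -
    have "x \<ominus> z = (x \<ominus> y) \<oplus> (y \<ominus> z)"
      using xyz by (simp add: minus_eq a_assoc r_neg1)
    with xyz show ?thesis
      using nrm_triangle[of "x \<ominus> y" "y \<ominus> z"] by (simp add: cstar_dist_def)
  qed
qed

definition unitary_in :: "('a, 'm) cstar_scheme \<Rightarrow> 'a \<Rightarrow> bool" where
  "unitary_in A u \<longleftrightarrow>
     u \<in> carrier A \<and> u\<^sup>\<star>\<^bsub>A\<^esub> \<otimes>\<^bsub>A\<^esub> u = \<one>\<^bsub>A\<^esub> \<and> u \<otimes>\<^bsub>A\<^esub> u\<^sup>\<star>\<^bsub>A\<^esub> = \<one>\<^bsub>A\<^esub>"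

definition projection_in :: "('a, 'm) cstar_scheme \<Rightarrow> 'a \<Rightarrow> bool" where
  "projection_in A e \<longleftrightarrow> e \<in> carrier A \<and> e\<^sup>\<star>\<^bsub>A\<^esub> = e \<and> e \<otimes>\<^bsub>A\<^esub> e = e"

definition closed_star_subalgebra :: "'a set \<Rightarrow> ('a, 'm) cstar_scheme \<Rightarrow> bool" where
  "closed_star_subalgebra S A \<longleftrightarrow>
     subring S A \<and>
     (\<forall>c. \<forall>x\<in>S. c \<odot>\<^bsub>A\<^esub> x \<in> S) \<and>
     (\<forall>x\<in>S. x\<^sup>\<star>\<^bsub>A\<^esub> \<in> S) \<and>
     closedin (Metric_space.mtopology (carrier A) (cstar_dist A)) S"

definition star_hom :: "('a, 'm) cstar_scheme \<Rightarrow> ('b, 'n) cstar_scheme \<Rightarrow> ('a \<Rightarrow> 'b) \<Rightarrow> bool" where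
  "star_hom A B f \<longleftrightarrow>
     f \<in> ring_hom A B \<and>
     (\<forall>c. \<forall>x\<in>carrier A. f (c \<odot>\<^bsub>A\<^esub> x) = c \<odot>\<^bsub>B\<^esub> f x) \<and>
     (\<forall>x\<in>carrier A. f (x\<^sup>\<star>\<^bsub>A\<^esub>) = (f x)\<^sup>\<star>\<^bsub>B\<^esub>)"

definition star_automorphism :: "('a, 'm) cstar_scheme \<Rightarrow> ('a \<Rightarrow> 'a) \<Rightarrow> bool" where
  "star_automorphism A f \<longleftrightarrow> star_hom A A f \<and> bij_betw f (carrier A) (carrier A)"

definition rotation_pair :: "real \<Rightarrow> ('a, 'm) cstar_scheme \<Rightarrow> 'a \<Rightarrow> 'a \<Rightarrow> bool" where
  "rotation_pair \<theta> A u v \<longleftrightarrow>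
     unitary_in A u \<and> unitary_in A v \<and>
     v \<otimes>\<^bsub>A\<^esub> u = exp (2 * of_real pi * \<i> * of_real \<theta>) \<odot>\<^bsub>A\<^esub> (u \<otimes>\<^bsub>A\<^esub> v)"

text \<open>
  In the universal property the test algebras have their carriers in the type of real numbers. This
  loses nothing: the homomorphism only has to reach the closed *-subalgebra generated by \<open>u\<close> and \<open>v\<close>,
  which is separable, hence of cardinality at most that of the continuum, and so is isomorphic to an
  algebra carried by a set of reals. The homomorphism is unique because \<open>U\<close> and \<open>V\<close> generate \<open>A\<close>.
\<close>

definition rotation_algebra :: "real \<Rightarrow> 'a cstar \<Rightarrow> 'a \<Rightarrow> 'a \<Rightarrow> bool" where
  "rotation_algebra \<theta> A U V \<longleftrightarrow>
     cstar_algebra A \<and> rotation_pair \<theta> A U V \<and>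
     (\<forall>S. closed_star_subalgebra S A \<and> U \<in> S \<and> V \<in> S \<longrightarrow> S = carrier A) \<and>
     (\<forall>(B :: real cstar) u v. cstar_algebra B \<and> rotation_pair \<theta> B u v \<longrightarrow>
        (\<exists>f. star_hom A B f \<and> f U = u \<and> f V = v))"

definition fourier_transform :: "'a cstar \<Rightarrow> 'a \<Rightarrow> 'a \<Rightarrow> ('a \<Rightarrow> 'a) \<Rightarrow> bool" where
  "fourier_transform A U V \<sigma> \<longleftrightarrow> star_automorphism A \<sigma> \<and> \<sigma> U = V \<and> \<sigma> V = inv\<^bsub>A\<^esub> U"

definition tracial_state :: "('a, 'm) cstar_scheme \<Rightarrow> ('a \<Rightarrow> complex) \<Rightarrow> bool" where
  "tracial_state A \<tau> \<longleftrightarrow>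
     (\<forall>x\<in>carrier A. \<forall>y\<in>carrier A. \<tau> (x \<oplus>\<^bsub>A\<^esub> y) = \<tau> x + \<tau> y) \<and>
     (\<forall>c. \<forall>x\<in>carrier A. \<tau> (c \<odot>\<^bsub>A\<^esub> x) = c * \<tau> x) \<and>
     (\<forall>x\<in>carrier A. cmod (\<tau> x) \<le> nrm A x) \<and>
     (\<forall>x\<in>carrier A. \<tau> (x\<^sup>\<star>\<^bsub>A\<^esub> \<otimes>\<^bsub>A\<^esub> x) \<in> \<real>\<^sub>\<ge>\<^sub>0) \<and>
     (\<forall>x\<in>carrier A. \<forall>y\<in>carrier A. \<tau> (x \<otimes>\<^bsub>A\<^esub> y) = \<tau> (y \<otimes>\<^bsub>A\<^esub> x)) \<and>
     \<tau> \<one>\<^bsub>A\<^esub> = 1"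

definition canonical_trace :: "'a cstar \<Rightarrow> 'a \<Rightarrow> 'a \<Rightarrow> ('a \<Rightarrow> complex) \<Rightarrow> bool" where
  "canonical_trace A U V \<tau> \<longleftrightarrow>
     tracial_state A \<tau> \<and>
     (\<forall>(m::int) (n::int). (m, n) \<noteq> (0, 0) \<longrightarrow> \<tau> (U [^]\<^bsub>A\<^esub> m \<otimes>\<^bsub>A\<^esub> V [^]\<^bsub>A\<^esub> n) = 0)"

end

theory Submission
  imports Defs "HOL-Probability.Characteristic_Functions"
begin

text \<open>
  The rotation algebra acts on the square-integrable functions of the line by Weyl translations
  \<open>W z\<close>, with \<open>z\<close> in a square lattice of covolume \<open>\<theta>\<close>. Its commutant is spanned by the Weyl
  translations over the adjoint lattice, a square lattice with spacing \<open>L = 1 / sqrt \<theta>\<close>. Take the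
  Gaussian centred at the phase-space point \<open>(L / 2, 0)\<close>. Its translates over the adjoint lattice
  span a subspace whose projection lies in the algebra and has trace \<open>\<theta>\<close>. The flip maps this set of
  centres to itself, and the Fourier transform moves it to the translates of \<open>(0, L / 2)\<close>. The two
  subspaces are not orthogonal, but almost: together the two families of centres form one square
  lattice of covolume \<open>1 / (2 * \<theta>)\<close>, and for \<open>\<theta> < 0.2345\<close> its points are so far apart that the Gram
  matrix \<open>G\<close> of all these Gaussians is close to the identity. The symmetric orthonormalisation
  \<open>G\<^sup>-\<^sup>1\<^sup>/\<^sup>2\<close> commutes with the Fourier symmetry and makes the two subspaces orthogonal.

  The proof carries this out without the Hilbert space. Let \<open>d\<close> be the frame operator of the first
  family minus that of the second. It is an explicit series in the Weyl unitaries with Gaussian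
  coefficients, it is self-adjoint, and \<open>\<sigma> d = - d\<close>. If \<open>d\<close> had spectrum in \<open>{-1, 0, 1}\<close>, then
  \<open>e = (d\<^sup>2 + d) / 2\<close> would be the projection sought, since then \<open>\<sigma> e = (d\<^sup>2 - d) / 2\<close>. In general the
  spectrum is near that set, and \<open>d\<close> is replaced by \<open>s\<close>, its sign: \<open>s\<^sup>2 = P\<close> is the range
  projection of \<open>d\<close>, and \<open>s = d y\<close> where \<open>y\<close> is an inverse square root of \<open>1 - (P - d\<^sup>2)\<close>.

  Three facts carry the argument. Poisson summation for Gaussians (\<open>poisson_gauss\<close>) turns products of
  such Gaussian series in the algebra into products over the adjoint lattice (\<open>gabor_tconv\<close>,
  \<open>gabor_sum_tconv\<close>). There multiplication by \<open>1 - d\<^sup>2\<close> acts with \<open>\<ell>\<^sup>1\<close>-norm at most \<open>0.33\<close>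
  (\<open>dual_iter_norm\<close>, \<open>gram_norm_bound\<close>), so \<open>d (1 - d\<^sup>2)\<^sup>n\<close> decays geometrically, which is all that
  \<open>selfadjoint_tripotent_exists\<close> needs to build \<open>P\<close> and \<open>s\<close>. Finally, the trace of
  \<open>1 - (1 - d\<^sup>2)\<^sup>n\<close> telescopes on the adjoint side and tends to \<open>2 * \<theta>\<close>, while \<open>s\<close> has trace \<open>0\<close>
  because \<open>\<sigma> s = - s\<close> and \<open>\<sigma>\<close> preserves the trace.
\<close>

text \<open>
  The real numbers are an instance of Euclidean rings here, and for them these rules undo a step of
  \<open>field_simps\<close>, so that the two loop.
\<close>

declare div_mult_self1 [simp del] div_mult_self2 [simp del] div_mult_self3 [simp del] div_mult_self4 [simp del]

section \<open>Uniqueness of Fourier coefficients\<close>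

definition fourier_null :: "(real \<Rightarrow> complex) \<Rightarrow> bool" where
  "fourier_null H \<longleftrightarrow> continuous_on UNIV H \<and>
     (\<forall>k::int. integral {0..1} (\<lambda>x. H x * cis (2 * pi * of_int k * x)) = 0)"

lemma fourier_null_integrable:
  assumes "fourier_null H"
  shows "(\<lambda>x. H x * cis (2 * pi * of_int k * x)) integrable_on {0..1}"
  using assms unfolding fourier_null_def
  by (intro integrable_continuous_interval continuous_intros)
     (auto intro: continuous_on_subset)

text \<open>
  On the circle, a real-linear coordinate is a combination of \<open>cis (2 * pi * x)\<close> and its conjugate, so
  multiplication by it only mixes neighbouring Fourier coefficients. Vanishing of all coefficients
  therefore survives multiplication by any polynomial; the statement for all \<open>H\<close> makes the
  product case of the induction immediate.
\<close>

lemma fourier_null_mult_poly: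
  assumes "real_polynomial_function p" and "fourier_null H"
  shows "fourier_null (\<lambda>x. H x * of_real (p (cis (2 * pi * x))))"
  using assms
proof (induction p arbitrary: H rule: real_polynomial_function.induct)
  case (linear f)
  define c1 c2 where "c1 = (of_real (f 1) - \<i> * of_real (f \<i>)) / 2"
    and "c2 = (of_real (f 1) + \<i> * of_real (f \<i>)) / 2"
  have f: "f z = Re z * f 1 + Im z * f \<i>" for z
  proof -
    have "f z = f (Re z *\<^sub>R 1 + Im z *\<^sub>R \<i>)"
      by (rule arg_cong[of _ _ f]) (simp add: complex_eq_iff)
    also have "\<dots> = Re z * f 1 + Im z * f \<i>"
      using linear(1) by (simp add: linear_simps)
    finally show ?thesis .
  qed
  have eq: "H x * of_real (f (cis (2 * pi * x))) * cis (2 * pi * of_int k * x) =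
      c1 * (H x * cis (2 * pi * of_int (k + 1) * x)) + c2 * (H x * cis (2 * pi * of_int (k - 1) * x))" for k x
  proof -
    have s: "of_real (f (cis t)) = c1 * cis t + c2 * cis (- t)" for t
      unfolding f[of "cis t"] by (simp add: c1_def c2_def complex_eq_iff field_simps)
    have a: "cis (2 * pi * of_int (k + 1) * x) = cis (2 * pi * x) * cis (2 * pi * of_int k * x)"
      and b: "cis (2 * pi * of_int (k - 1) * x) = cis (- (2 * pi * x)) * cis (2 * pi * of_int k * x)"
      by (simp_all add: cis_mult algebra_simps)
    show ?thesis unfolding s a b by (simp add: algebra_simps)
  qed
  have "continuous_on UNIV (\<lambda>x. f (cis (2 * pi * x)))"
    using linear(1) by (intro bounded_linear.continuous_on[OF linear(1)] continuous_intros)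
  moreover have "integral {0..1} (\<lambda>x. c1 * (H x * cis (2 * pi * of_int (k + 1) * x))
      + c2 * (H x * cis (2 * pi * of_int (k - 1) * x))) = 0" for k
    using fourier_null_integrable[OF linear(2)] linear(2)
    by (subst integral_add) (auto simp: fourier_null_def simp del: of_int_add of_int_diff intro!: integrable_on_mult_right)
  ultimately show ?case
    using linear(2) unfolding fourier_null_def eq by (auto intro!: continuous_intros)
next
  case (const c)
  have "integral {0..1} (\<lambda>x. c * (H x * cis (2 * pi * of_int k * x))) = 0" for k
    using const by (simp add: fourier_null_def)
  with const show ?case unfolding fourier_null_def
    by (auto intro!: continuous_intros simp: mult_ac)
next
  case (add f g)
  from add.IH(1)[OF add.prems] add.IH(2)[OF add.prems]
  have f: "fourier_null (\<lambda>x. H x * of_real (f (cis (2 * pi * x))))"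
    and g: "fourier_null (\<lambda>x. H x * of_real (g (cis (2 * pi * x))))" by auto
  have "fourier_null (\<lambda>x. H x * of_real (f (cis (2 * pi * x))) + H x * of_real (g (cis (2 * pi * x))))"
    unfolding fourier_null_def
  proof (intro conjI allI)
    show "continuous_on UNIV (\<lambda>x. H x * of_real (f (cis (2 * pi * x))) + H x * of_real (g (cis (2 * pi * x))))"
      using f g by (auto simp: fourier_null_def intro!: continuous_on_add)
    fix k :: int
    show "integral {0..1} (\<lambda>x. (H x * of_real (f (cis (2 * pi * x))) + H x * of_real (g (cis (2 * pi * x))))
       * cis (2 * pi * of_int k * x)) = 0"
      using f g fourier_null_integrable[OF f, of k] fourier_null_integrable[OF g, of k]
      by (simp add: distrib_right integral_add fourier_null_def)
  qed
  then show ?case by (simp add: distrib_left)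
next
  case (mult f g)
  from mult.IH(2)[OF mult.IH(1)[OF mult.prems]] show ?case
    by (simp add: mult_ac)
qed

lemma periodic_int:
  fixes G :: "real \<Rightarrow> 'a"
  assumes "\<And>x. G (x + 1) = G x"
  shows "G (x + of_int n) = G x"
proof (induction n arbitrary: x rule: int_induct[where k = 0])
  case (step1 i)
  then show ?case using assms[of "x + of_int i"] by (simp add: add_ac)
next
  case (step2 i)
  then show ?case using assms[of "x + of_int (i - 1)"] by (simp add: add_ac)
qed simp

text \<open>
  A periodic function descends to the circle, where Stone--Weierstrass applies. Continuity of the
  descended function is local: \<open>Arg\<close> is continuous off the negative axis and \<open>Arg2pi\<close> off the
  positive axis, and by periodicity both give the same function.
\<close>

lemma periodic_real_approx:
  fixes G :: "real \<Rightarrow> real"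
  assumes cont: "continuous_on UNIV G" and per: "\<And>x. G (x + 1) = G x" and e: "e > 0"
  obtains p where "real_polynomial_function p" "\<And>x. \<bar>G x - p (cis (2 * pi * x))\<bar> < e"
proof -
  define F where "F z = G (Arg z / (2 * pi))" for z
  have F_cis: "F (cis (2 * pi * x)) = G x" for x
  proof -
    have "cis (Arg (cis (2 * pi * x))) = cis (2 * pi * x)"
      using cis_Arg[of "cis (2 * pi * x)"] by (simp add: sgn_div_norm)
    then obtain n :: int where "\<i> * of_real (Arg (cis (2 * pi * x))) =
        \<i> * of_real (2 * pi * x) + of_real (of_int (2 * n) * pi) * \<i>"
      unfolding cis_conv_exp exp_eq by auto
    then have "\<i> * of_real (Arg (cis (2 * pi * x))) = \<i> * of_real (2 * pi * x + 2 * of_int n * pi)"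
      by (simp add: algebra_simps)
    then have "Arg (cis (2 * pi * x)) = 2 * pi * x + 2 * of_int n * pi"
      by (simp only: mult_cancel_left of_real_eq_iff) simp
    then have "Arg (cis (2 * pi * x)) / (2 * pi) = x + of_int n"
      by (simp add: field_simps)
    then show ?thesis unfolding F_def by (simp add: periodic_int[of G, OF per])
  qed
  have F2: "F z = G (Arg2pi z / (2 * pi))" if "norm z = 1" for z
    using F_cis[of "Arg2pi z / (2 * pi)"] Arg2pi_eq[of z] that by (simp add: cis_conv_exp)
  have G: "isCont G x" for x
    using cont by (simp add: continuous_on_eq_continuous_at)
  have "continuous (at z within sphere 0 1) F" if z: "z \<in> sphere 0 1" for z
  proof (cases "z \<in> \<real>\<^sub>\<le>\<^sub>0")
    case False
    then have "isCont F z" unfolding F_def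
      by (intro isCont_o2[OF _ G] continuous_intros continuous_at_Arg) auto
    then show ?thesis by (simp add: continuous_at_imp_continuous_within)
  next
    case True
    then have "z \<notin> \<real>\<^sub>\<ge>\<^sub>0"
      using z by (auto simp: complex_nonpos_Reals_iff complex_nonneg_Reals_iff cmod_def)
    then have "isCont (\<lambda>z. G (Arg2pi z / (2 * pi))) z"
      by (intro isCont_o2[OF _ G] continuous_intros continuous_at_Arg2pi) auto
    then have "continuous (at z within sphere 0 1) (\<lambda>z. G (Arg2pi z / (2 * pi)))"
      by (simp add: continuous_at_imp_continuous_within)
    then show ?thesis
      by (rule continuous_transform_within[of _ _ _ 1]) (use z F2 in auto)
  qed
  then have "continuous_on (sphere 0 1) F" by (simp add: continuous_on_eq_continuous_within)
  from Stone_Weierstrass_real_polynomial_function[OF compact_sphere this e]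
  obtain p where "real_polynomial_function p" "\<And>x. x \<in> sphere 0 1 \<Longrightarrow> \<bar>F x - p x\<bar> < e" by auto
  then show ?thesis using that[of p] by (metis F_cis norm_cis mem_sphere_0)
qed

lemma fourier_null_mult_real_periodic:
  assumes H: "fourier_null H" and cont: "continuous_on UNIV f" and per: "\<And>x. f (x + 1) = f x"
  shows "integral {0..1} (\<lambda>x. H x * of_real (f x)) = 0"
proof -
  define I where "I = integral {0..1} (\<lambda>x. norm (H x))"
  have H_cont: "continuous_on {0..1} H"
    using H by (auto simp: fourier_null_def intro: continuous_on_subset)
  have f_cont: "continuous_on {0..1} f" using cont by (auto intro: continuous_on_subset)
  have I: "I \<ge> 0" unfolding I_def by (intro integral_nonneg integrable_continuous_interval continuous_intros H_cont) auto
  have "norm (integral {0..1} (\<lambda>x. H x * of_real (f x))) \<le> e * I" if e: "e > 0" for e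
  proof -
    obtain p where p: "real_polynomial_function p" and pe: "\<And>x. \<bar>f x - p (cis (2 * pi * x))\<bar> < e"
      using periodic_real_approx[OF cont per e] by blast
    have p_cont: "continuous_on {0..1} (\<lambda>x. p (cis (2 * pi * x)))"
    proof -
      have "continuous_on UNIV p" using p by (simp add: continuous_on_polymonial_function real_polynomial_function_eq)
      then show ?thesis
        by (rule continuous_on_compose2) (auto intro!: continuous_intros)
    qed
    have "integral {0..1} (\<lambda>x. H x * of_real (p (cis (2 * pi * x)))) = 0"
      using fourier_null_mult_poly[OF p H] unfolding fourier_null_def by (auto dest: spec[of _ 0])
    then have "integral {0..1} (\<lambda>x. H x * of_real (f x)) =
        integral {0..1} (\<lambda>x. H x * of_real (f x) - H x * of_real (p (cis (2 * pi * x))))"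
      by (subst integral_diff) (auto intro!: integrable_continuous_interval continuous_intros H_cont f_cont p_cont)
    also have "norm \<dots> \<le> integral {0..1} (\<lambda>x. e * norm (H x))"
    proof (rule integral_norm_bound_integral)
      show "norm (H x * of_real (f x) - H x * of_real (p (cis (2 * pi * x)))) \<le> e * norm (H x)" for x
      proof -
        have "norm (H x * of_real (f x) - H x * of_real (p (cis (2 * pi * x)))) = norm (H x) * \<bar>f x - p (cis (2 * pi * x))\<bar>"
          by (metis norm_mult norm_of_real of_real_diff right_diff_distrib)
        also have "\<dots> \<le> norm (H x) * e" using pe[of x] by (intro mult_left_mono) auto
        finally show ?thesis by (simp add: mult.commute)
      qed
    qed (auto intro!: integrable_continuous_interval continuous_intros H_cont f_cont p_cont)
    also have "\<dots> = e * I" by (simp add: I_def)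
    finally show ?thesis .
  qed
  note * = this
  have "norm (integral {0..1} (\<lambda>x. H x * of_real (f x))) \<le> 0"
  proof (rule field_le_epsilon)
    fix e :: real assume e: "e > 0"
    then have "e / (I + 1) * I \<le> e" using I by (simp add: field_simps)
    then show "norm (integral {0..1} (\<lambda>x. H x * of_real (f x))) \<le> 0 + e"
      using *[of "e / (I + 1)"] e I by simp
  qed
  then show ?thesis by simp
qed

text \<open>
  Orthogonality to the real and imaginary parts of \<open>H\<close> itself makes the integral of its squared
  modulus vanish.
\<close>

theorem fourier_uniqueness:
  assumes H: "fourier_null H" and per: "\<And>x. H (x + 1) = H x"
  shows "H x = 0"
proof -
  have cont: "continuous_on UNIV H" using H by (simp add: fourier_null_def)
  have c1: "continuous_on {0..1} H" using cont by (rule continuous_on_subset) auto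
  have "integral {0..1} (\<lambda>x. H x * of_real (Re (H x))) = 0" "integral {0..1} (\<lambda>x. H x * of_real (Im (H x))) = 0"
    by (intro fourier_null_mult_real_periodic[OF H] continuous_intros cont; simp add: per)+
  then have "integral {0..1} (\<lambda>x. H x * of_real (Re (H x)) - \<i> * (H x * of_real (Im (H x)))) = 0"
    by (subst integral_diff) (auto intro!: integrable_continuous_interval continuous_intros c1)
  also have "(\<lambda>x. H x * of_real (Re (H x)) - \<i> * (H x * of_real (Im (H x)))) = (\<lambda>x. of_real ((norm (H x))\<^sup>2))"
    unfolding cmod_power2 by (rule ext) (simp add: complex_eq_iff power2_eq_square)
  finally have "integral {0..1} (\<lambda>x. complex_of_real ((norm (H x))\<^sup>2)) = 0" .
  moreover have "integral {0..1} (\<lambda>x. complex_of_real ((norm (H x))\<^sup>2)) = of_real (integral {0..1} (\<lambda>x. (norm (H x))\<^sup>2))"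
    by (intro integral_linear[of _ _ complex_of_real, unfolded o_def] bounded_linear_of_real integrable_continuous_interval continuous_intros c1)
  ultimately have "integral {0..1} (\<lambda>x. (norm (H x))\<^sup>2) = 0" by simp
  moreover have "(\<lambda>x. (norm (H x))\<^sup>2) integrable_on {0..1}"
    by (intro integrable_continuous_interval continuous_intros c1)
  ultimately have int0: "((\<lambda>x. (norm (H x))\<^sup>2) has_integral 0) {0..1}"
    using integrable_integral by fastforce
  have c01: "continuous_on {0..1} (\<lambda>x. (norm (H x))\<^sup>2)" by (intro continuous_intros c1)
  have "(norm (H y))\<^sup>2 = 0" if "y \<in> {0..1}" for y
    by (rule has_integral_0_cbox_imp_0[of 0 "1::real" "\<lambda>x. (norm (H x))\<^sup>2"])
       (use c01 int0 that in auto)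
  then have "H (frac x) = 0" using frac_lt_1[of x] by (simp add: less_imp_le)
  moreover have "H (frac x) = H x"
    using periodic_int[of H "frac x" "\<lfloor>x\<rfloor>", OF per] by (simp add: frac_def)
  ultimately show ?thesis by simp
qed

section \<open>Poisson summation for Gaussians\<close>

lemma has_sum_geometric_abs:
  fixes q :: real
  assumes "0 \<le> q" "q < 1"
  shows "((\<lambda>n::int. q ^ nat \<bar>n\<bar>) has_sum (1 + 2 * (q / (1 - q)))) UNIV"
proof -
  have a: "((\<lambda>n. q ^ n) has_sum (1 / (1 - q))) UNIV"
    using assms by (intro sums_nonneg_imp_has_sum geometric_sums) auto
  have "((\<lambda>n. q * q ^ n) has_sum (q * (1 / (1 - q)))) UNIV"
    by (intro has_sum_cmult_right a)
  then have b: "((\<lambda>n. q ^ Suc n) has_sum (q / (1 - q))) UNIV" by simp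
  have 1: "((\<lambda>n::int. q ^ nat \<bar>n\<bar>) has_sum (1 / (1 - q))) (range int)"
    by (subst has_sum_reindex) (use a in \<open>auto simp: o_def\<close>)
  have 2: "((\<lambda>n::int. q ^ nat \<bar>n\<bar>) has_sum (q / (1 - q))) (range (\<lambda>n. - int (Suc n)))"
    by (subst has_sum_reindex) (use b in \<open>auto simp: o_def inj_on_def nat_add_distrib\<close>)
  have un: "range int \<union> range (\<lambda>n. - int (Suc n)) = UNIV"
  proof (intro equalityI subsetI)
    fix n :: int
    show "n \<in> range int \<union> range (\<lambda>n. - int (Suc n))" by (cases n) blast+
  qed simp
  have "((\<lambda>n::int. q ^ nat \<bar>n\<bar>) has_sum (1 / (1 - q) + q / (1 - q)))
      (range int \<union> range (\<lambda>n. - int (Suc n)))"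
    by (rule has_sum_Un_disjoint[OF 1 2]) auto
  then have "((\<lambda>n::int. q ^ nat \<bar>n\<bar>) has_sum (1 / (1 - q) + q / (1 - q))) UNIV"
    by (simp only: un)
  moreover have "1 / (1 - q) + q / (1 - q) = 1 + 2 * (q / (1 - q))"
    using assms by (simp add: field_simps)
  ultimately show ?thesis by simp
qed

text \<open>
  Expanding \<open>(\<bar>x + n\<bar> - 1)\<^sup>2 \<ge> 0\<close> bounds the square below by a linear term. The resulting majorant
  does not depend on \<open>x\<close>.
\<close>

lemma gauss_le_geometric:
  fixes c x :: real and n :: int
  assumes "c > 0" "\<bar>x\<bar> \<le> 1"
  shows "exp (- c * (x + of_int n)\<^sup>2) \<le> exp (3 * c) * exp (- 2 * c) ^ nat \<bar>n\<bar>"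
proof -
  have "(\<bar>x + of_int n\<bar> - 1)\<^sup>2 \<ge> 0" by simp
  then have "(x + of_int n)\<^sup>2 \<ge> 2 * \<bar>x + of_int n\<bar> - 1"
    by (simp add: power2_diff)
  moreover have "\<bar>x + of_int n\<bar> \<ge> \<bar>of_int n\<bar> - 1" using assms by linarith
  moreover have "2 * a - 3 \<le> s" if "2 * b - 1 \<le> s" "a - 1 \<le> b" for a b s :: real
    using that by linarith
  ultimately have "(x + of_int n)\<^sup>2 \<ge> 2 * \<bar>of_int n\<bar> - 3" by blast
  then have "- c * (x + of_int n)\<^sup>2 \<le> - c * (2 * \<bar>of_int n\<bar> - 3)"
    using assms by (intro mult_left_mono_neg) auto
  also have "\<dots> = 3 * c + of_nat (nat \<bar>n\<bar>) * (- 2 * c)" by (simp add: algebra_simps)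
  finally show ?thesis by (simp flip: exp_of_nat_mult exp_add)
qed

lemma summable_on_gauss_bound:
  "c > 0 \<Longrightarrow> (\<lambda>n::int. exp (3 * c) * exp (- 2 * c) ^ nat \<bar>n\<bar>) summable_on UNIV" for c :: real
  using has_sum_geometric_abs[of "exp (-2 * c)"]
  by (intro summable_on_cmult_right) (auto simp: has_sum_iff)

lemma bij_add_int: "bij_betw (\<lambda>n::int. n + m) UNIV UNIV"
  by (rule bij_betwI[where g = "\<lambda>n. n - m"]) auto

lemma infsum_int_shift:
  "(\<Sum>\<^sub>\<infinity>n. f (of_int n + (x + of_int m) :: real)) = (\<Sum>\<^sub>\<infinity>n::int. f (of_int n + x))"
  using infsum_reindex_bij_betw[OF bij_add_int[of m], of "\<lambda>n. f (of_int n + x)"] by (simp add: add_ac)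

lemma summable_on_int_shift:
  "(\<lambda>n. f (of_int n + (x + of_int m) :: real)) summable_on UNIV \<longleftrightarrow> (\<lambda>n::int. f (of_int n + x)) summable_on UNIV"
  using summable_on_reindex_bij_betw[OF bij_add_int[of m], of "\<lambda>n. f (of_int n + x)"] by (simp add: add_ac)

lemma summable_on_gauss:
  fixes c :: real
  assumes "c > 0"
  shows "(\<lambda>n::int. exp (- c * (x + of_int n)\<^sup>2)) summable_on UNIV"
proof -
  have "(\<lambda>n::int. exp (- c * (of_int n + frac x)\<^sup>2)) summable_on UNIV"
    using frac_lt_1[of x] assms gauss_le_geometric[of c "frac x"]
    by (intro summable_on_comparison_test[OF summable_on_gauss_bound[OF assms]])
       (auto simp: add.commute less_imp_le)
  then show ?thesis
    using summable_on_int_shift[of "\<lambda>s. exp (- c * s\<^sup>2)" "frac x" "\<lfloor>x\<rfloor>"]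
    by (simp add: frac_def add_ac)
qed

text \<open>
  The sum has period 1 in \<open>x\<close>, so the bound for \<open>\<bar>x\<bar> \<le> 1\<close> holds for all \<open>x\<close>.
\<close>

lemma infsum_gauss_le:
  fixes c :: real
  assumes "c > 0"
  shows "(\<Sum>\<^sub>\<infinity>n::int. exp (- c * (x + of_int n)\<^sup>2)) \<le> (\<Sum>\<^sub>\<infinity>n::int. exp (3 * c) * exp (- 2 * c) ^ nat \<bar>n\<bar>)"
proof -
  have "(\<Sum>\<^sub>\<infinity>n::int. exp (- c * (frac x + of_int n)\<^sup>2)) \<le> (\<Sum>\<^sub>\<infinity>n::int. exp (3 * c) * exp (- 2 * c) ^ nat \<bar>n\<bar>)"
    using frac_lt_1[of x] assms gauss_le_geometric[of c "frac x"]
    by (intro infsum_mono summable_on_gauss summable_on_gauss_bound) (auto simp: less_imp_le)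
  then show ?thesis
    using infsum_int_shift[of "\<lambda>s. exp (- c * s\<^sup>2)" "frac x" "\<lfloor>x\<rfloor>"]
    by (simp add: frac_def add_ac)
qed

text \<open>
  The characteristic function of the standard normal distribution, rescaled by \<open>sqrt (2 * pi * t)\<close>.
\<close>

lemma fourier_gauss:
  fixes t s :: real
  assumes t: "t > 0"
  shows "integrable lborel (\<lambda>x. of_real (exp (- pi * t * x\<^sup>2)) * cis (2 * pi * s * x))" (is ?int)
    and "(\<integral>x. of_real (exp (- pi * t * x\<^sup>2)) * cis (2 * pi * s * x) \<partial>lborel) = of_real (exp (- pi * s\<^sup>2 / t) / sqrt t)" (is ?val)
proof -
  define c where "c = sqrt (2 * pi * t)"
  have c: "c > 0" "c\<^sup>2 = 2 * pi * t" using t by (auto simp: c_def)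
  define f where "f x = complex_of_real (std_normal_density x) * cis (2 * pi * s / c * x)" for x
  have int: "integrable lborel f"
  proof (rule Bochner_Integration.integrable_bound)
    show "integrable lborel std_normal_density"
      using integrable_std_normal_moment[of 0] by simp
    have "f \<in> borel_measurable borel" unfolding f_def std_normal_density_def
      by (intro borel_measurable_continuous_onI continuous_intros) auto
    then show "f \<in> borel_measurable lborel" by simp
  qed (auto simp: f_def norm_mult)
  have "(\<integral>x. f x \<partial>lborel) = (CLINT x|lborel. std_normal_density x *\<^sub>R iexp (2 * pi * s / c * x))"
    by (simp add: f_def scaleR_conv_of_real cis_conv_exp)
  also have "\<dots> = char std_normal_distribution (2 * pi * s / c)"
    unfolding char_def by (subst integral_density) auto
  also have "\<dots> = of_real (exp (- (2 * pi * s / c)\<^sup>2 / 2))"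
    by (simp add: char_std_normal_distribution)
  also have "- (2 * pi * s / c)\<^sup>2 / 2 = - pi * s\<^sup>2 / t"
    using t unfolding power_divide c(2) by (simp add: field_simps power2_eq_square)
  finally have val: "(\<integral>x. f x \<partial>lborel) = of_real (exp (- pi * s\<^sup>2 / t))" .
  have eq: "f (0 + c * x) = of_real (1 / sqrt (2 * pi)) * (of_real (exp (- pi * t * x\<^sup>2)) * cis (2 * pi * s * x))" for x
  proof -
    have "- (c * x)\<^sup>2 / 2 = - pi * t * x\<^sup>2" unfolding power_mult_distrib c(2) by simp
    moreover have "2 * pi * s / c * (0 + c * x) = 2 * pi * s * x" using c(1) by simp
    ultimately show ?thesis unfolding f_def std_normal_density_def by simp
  qed
  have "integrable lborel (\<lambda>x. f (0 + c * x))"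
    by (rule lborel_integrable_real_affine[OF int]) (use c in auto)
  then have scaled: "integrable lborel (\<lambda>x. complex_of_real (sqrt (2 * pi)) * f (0 + c * x))"
    by (intro Bochner_Integration.integrable_mult_right)
  have "complex_of_real (sqrt (2 * pi)) * (complex_of_real (1 / sqrt (2 * pi)) * z) = z" for z
    by simp
  with scaled show ?int unfolding eq by (simp only:)
  have "of_real (exp (- pi * s\<^sup>2 / t)) = \<bar>c\<bar> *\<^sub>R (\<integral>x. f (0 + c * x) \<partial>lborel)"
    unfolding val[symmetric] by (rule lborel_integral_real_affine) (use c in auto)
  also have "\<dots> = of_real (c / sqrt (2 * pi)) * (\<integral>x. of_real (exp (- pi * t * x\<^sup>2)) * cis (2 * pi * s * x) \<partial>lborel)"
    unfolding eq using c by (subst integral_mult_right_zero) (simp add: scaleR_conv_of_real)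
  also have "c / sqrt (2 * pi) = sqrt t" by (simp add: c_def real_sqrt_mult)
  finally have "of_real (exp (- pi * s\<^sup>2 / t)) =
      complex_of_real (sqrt t) * (\<integral>x. of_real (exp (- pi * t * x\<^sup>2)) * cis (2 * pi * s * x) \<partial>lborel)" .
  moreover have "complex_of_real (sqrt t) \<noteq> 0" using t by simp
  ultimately show ?val unfolding of_real_divide by (metis nonzero_mult_div_cancel_left)
qed

lemma series_integral_unit_interval:
  fixes f :: "'i \<Rightarrow> real \<Rightarrow> complex"
  assumes bound: "\<And>n x. x \<in> {0..1} \<Longrightarrow> norm (f n x) \<le> M n" and M: "M summable_on UNIV"
    and cont: "\<And>n. continuous_on {0..1} (f n)"
  shows "((\<lambda>n. integral {0..1} (f n)) has_sum integral {0..1} (\<lambda>x. \<Sum>\<^sub>\<infinity>n. f n x)) UNIV"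
    and "continuous_on {0..1} (\<lambda>x. \<Sum>\<^sub>\<infinity>n. f n x)"
proof -
  have u: "uniform_limit {0..1} (\<lambda>X' y. \<Sum>x\<in>X'. f x y) (\<lambda>y. \<Sum>\<^sub>\<infinity>x. f x y) (finite_subsets_at_top UNIV)"
    by (rule Weierstrass_m_test_general[of UNIV "{0..1}" f M]) (use bound M in auto)
  have c: "continuous_on {0..1} (\<lambda>y. \<Sum>x\<in>X'. f x y)" for X'
    by (intro continuous_intros cont)
  obtain I J where I: "\<And>X'. ((\<lambda>y. \<Sum>x\<in>X'. f x y) has_integral I X') {0..1}"
    and J: "((\<lambda>y. \<Sum>\<^sub>\<infinity>x. f x y) has_integral J) {0..1}" and lim: "(I \<longlongrightarrow> J) (finite_subsets_at_top UNIV)"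
    using uniform_limit_integral[OF u c finite_subsets_at_top_neq_bot] by metis
  have "I X' = (\<Sum>x\<in>X'. integral {0..1} (f x))" if "finite X'" for X'
    using I[of X'] that by (subst integral_sum[symmetric]) (auto intro!: integrable_continuous_interval cont integral_unique[symmetric])
  then have "eventually (\<lambda>X'. I X' = (\<Sum>x\<in>X'. integral {0..1} (f x))) (finite_subsets_at_top UNIV)"
    by (auto intro: eventually_finite_subsets_at_top_weakI)
  then show "((\<lambda>n. integral {0..1} (f n)) has_sum integral {0..1} (\<lambda>x. \<Sum>\<^sub>\<infinity>n. f n x)) UNIV"
    using lim J unfolding has_sum_def by (auto simp: integral_unique intro: Lim_transform_eventually)
  show "continuous_on {0..1} (\<lambda>x. \<Sum>\<^sub>\<infinity>n. f n x)"
    by (rule uniform_limit_theorem[OF _ u]) (auto intro: c eventuallyI)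
qed

lemma sum_integral_unit_intervals:
  fixes f :: "real \<Rightarrow> complex"
  assumes cont: "continuous_on UNIV f"
  shows "(\<Sum>n\<in>{- int N..<int N}. integral {0..1} (\<lambda>x. f (x + of_int n))) = integral {- real N..real N} f"
proof (induction N)
  case (Suc N)
  have int: "f integrable_on {a..b}" for a b
    by (intro integrable_continuous_interval) (use cont in \<open>auto intro: continuous_on_subset\<close>)
  have shift: "integral {0..1} (\<lambda>x. f (x + of_int n)) = integral {of_int n..of_int n + 1} f" for n
    using integral_shift_Icc_real[of 0 1 f "of_int n"] by (simp add: o_def add_ac)
  have set: "{- int (Suc N)..<int (Suc N)} = insert (- int (Suc N)) (insert (int N) {- int N..<int N})" by auto
  have "(\<Sum>n\<in>{- int (Suc N)..<int (Suc N)}. integral {0..1} (\<lambda>x. f (x + of_int n))) =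
     integral {- 1 - real N..- real N} f + integral {real N..1 + real N} f + integral {- real N..real N} f"
    unfolding set by (simp add: shift Suc.IH[symmetric] add_ac)
  also have "\<dots> = integral {- 1 - real N..1 + real N} f"
    unfolding Henstock_Kurzweil_Integration.integral_combine[where a = "- 1 - real N" and c = "real N" and b = "1 + real N" and f = f, symmetric, OF _ _ int, simplified]
      Henstock_Kurzweil_Integration.integral_combine[where a = "- 1 - real N" and c = "- real N" and b = "real N" and f = f, symmetric, OF _ _ int, simplified]
    by (simp only: add_ac)
  finally show ?case by (simp add: add_ac)
qed simp

text \<open>
  Integrating the periodised function over the unit interval integrates the original function over
  the whole line, so its Fourier coefficients are values of a Fourier transform.
\<close>

lemma gauss_periodization_fourier_coeff:
  fixes t y :: real and k :: int
  assumes t: "t > 0"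
  defines "h \<equiv> \<lambda>x. \<Sum>\<^sub>\<infinity>n::int. of_real (exp (- pi * t * (x + of_int n)\<^sup>2)) * cis (2 * pi * y * (x + of_int n))"
  shows "integral {0..1} (\<lambda>x. h x * cis (2 * pi * of_int k * x)) = of_real (exp (- pi * (y + of_int k)\<^sup>2 / t) / sqrt t)"
    and "continuous_on {0..1} h"
proof -
  define f where "f x = of_real (exp (- pi * t * x\<^sup>2)) * cis (2 * pi * (y + of_int k) * x)" for x
  define M where "M n = exp (3 * (pi * t)) * exp (- 2 * (pi * t)) ^ nat \<bar>n\<bar>" for n :: int
  have M: "M summable_on UNIV" unfolding M_def by (rule summable_on_gauss_bound) (use t in auto)
  have bound: "exp (- pi * t * (x + of_int n)\<^sup>2) \<le> M n" if "x \<in> {0..1}" for x n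
    using gauss_le_geometric[of "pi * t" x n] that t by (simp add: M_def)
  have hf: "h x * cis (2 * pi * of_int k * x) = (\<Sum>\<^sub>\<infinity>n::int. f (x + of_int n))" for x
  proof -
    have "cis (2 * pi * of_int k * x) = cis (2 * pi * of_int k * (x + of_int n))" for n :: int
    proof -
      have "cis (2 * pi * of_int k * of_int n) = 1"
        using cis_multiple_2pi[of "of_int (k * n)"] by (simp add: mult_ac)
      then show ?thesis by (simp add: distrib_left flip: cis_mult)
    qed
    note c = this
    have "of_real (exp (- pi * t * (x + of_int n)\<^sup>2)) * cis (2 * pi * y * (x + of_int n)) * cis (2 * pi * of_int k * x) = f (x + of_int n)" for n :: int
      unfolding c[of n] f_def mult.assoc[of "complex_of_real _"] cis_mult by (simp add: algebra_simps)
    then show ?thesis unfolding h_def by (subst infsum_cmult_left'[symmetric]) simp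
  qed
  have cont: "continuous_on S f" for S unfolding f_def by (intro continuous_intros)
  have s: "((\<lambda>n. integral {0..1} (\<lambda>x. f (x + of_int n))) has_sum integral {0..1} (\<lambda>x. \<Sum>\<^sub>\<infinity>n::int. f (x + of_int n))) UNIV"
    by (rule series_integral_unit_interval[OF _ M])
       (auto simp: f_def norm_mult intro!: bound[simplified] continuous_intros)
  show "continuous_on {0..1} h" unfolding h_def
    by (rule series_integral_unit_interval(2)[OF _ M])
       (auto simp: norm_mult intro!: bound[simplified] continuous_intros)
  have "filterlim (\<lambda>N. {- int N..<int N}) (finite_subsets_at_top UNIV) sequentially"
    unfolding filterlim_finite_subsets_at_top
  proof (intro allI impI)
    fix X' :: "int set" assume X': "finite X' \<and> X' \<subseteq> UNIV"
    then obtain B where B: "\<And>x. x \<in> X' \<Longrightarrow> \<bar>x\<bar> \<le> B" using bdd_above_finite[of "abs ` X'"] by (auto simp: bdd_above_def)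
    show "eventually (\<lambda>N. finite {- int N..<int N} \<and> X' \<subseteq> {- int N..<int N} \<and> {- int N..<int N} \<subseteq> UNIV) sequentially"
      using eventually_gt_at_top[of "nat B"] by eventually_elim (use B in force)
  qed
  from filterlim_compose[OF s[unfolded has_sum_def] this]
  have l1: "(\<lambda>N. integral {- real N..real N} f) \<longlonglongrightarrow> integral {0..1} (\<lambda>x. \<Sum>\<^sub>\<infinity>n::int. f (x + of_int n))"
    by (simp add: sum_integral_unit_intervals[OF cont])
  have int: "integrable lborel f" and val: "integral\<^sup>L lborel f = of_real (exp (- pi * (y + of_int k)\<^sup>2 / t) / sqrt t)"
    unfolding f_def by (rule fourier_gauss[OF t])+
  have HI: "(f has_integral of_real (exp (- pi * (y + of_int k)\<^sup>2 / t) / sqrt t)) UNIV"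
    using has_integral_integral_lborel[OF int] val by simp
  have l2: "(\<lambda>N. integral {- real N..real N} f) \<longlonglongrightarrow> of_real (exp (- pi * (y + of_int k)\<^sup>2 / t) / sqrt t)"
  proof (rule LIMSEQ_I)
    fix e :: real assume "e > 0"
    then obtain B where B: "\<And>a b. ball 0 B \<subseteq> cbox a b \<Longrightarrow>
        norm (integral (cbox a b) f - of_real (exp (- pi * (y + of_int k)\<^sup>2 / t) / sqrt t)) < e"
      using HI unfolding has_integral_alt'[of f] by (simp only: UNIV_I if_True) blast
    show "\<exists>no. \<forall>n\<ge>no. norm (integral {- real n..real n} f - of_real (exp (- pi * (y + of_int k)\<^sup>2 / t) / sqrt t)) < e"
    proof (intro exI allI impI)
      fix n assume "nat \<lceil>B\<rceil> \<le> n"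
      then have "B \<le> real n" by linarith
      then have "ball 0 B \<subseteq> cbox (- real n) (real n)" by (auto simp: dist_norm)
      from B[OF this] show "norm (integral {- real n..real n} f - of_real (exp (- pi * (y + of_int k)\<^sup>2 / t) / sqrt t)) < e" by simp
    qed
  qed
  show "integral {0..1} (\<lambda>x. h x * cis (2 * pi * of_int k * x)) = of_real (exp (- pi * (y + of_int k)\<^sup>2 / t) / sqrt t)"
    unfolding hf by (rule LIMSEQ_unique[OF l1 l2])
qed

text \<open>
  Both sides are continuous and have period 1 in \<open>x\<close>, and their Fourier coefficients agree.
\<close>

theorem poisson_gauss:
  fixes t x y :: real
  assumes t: "t > 0"
  shows "(\<Sum>\<^sub>\<infinity>n::int. of_real (exp (- pi * t * (x + of_int n)\<^sup>2)) * cis (2 * pi * y * (x + of_int n)))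
    = (\<Sum>\<^sub>\<infinity>k::int. of_real (exp (- pi * (of_int k - y)\<^sup>2 / t)) * cis (2 * pi * of_int k * x)) / of_real (sqrt t)"
proof -
  define h where "h x = (\<Sum>\<^sub>\<infinity>n::int. of_real (exp (- pi * t * (x + of_int n)\<^sup>2)) * cis (2 * pi * y * (x + of_int n)))" for x
  define r where "r x = (\<Sum>\<^sub>\<infinity>k::int. of_real (exp (- pi * (of_int k - y)\<^sup>2 / t)) * cis (2 * pi * of_int k * x))" for x
  define M where "M n = exp (- pi * (of_int n - y)\<^sup>2 / t)" for n :: int
  have M: "M summable_on UNIV"
    using summable_on_gauss[of "pi / t" "- y"] t by (simp add: M_def[abs_def] add.commute)
  have per_h: "h (x + 1) = h x" for x
    using infsum_int_shift[of "\<lambda>s. of_real (exp (- pi * t * s\<^sup>2)) * cis (2 * pi * y * s)" x 1]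
    unfolding h_def by (simp add: add_ac)
  have cis1: "cis (2 * pi * of_int k) = 1" for k :: int
    using cis_multiple_2pi[of "of_int k"] by simp
  have per_r: "r (x + 1) = r x" for x
    unfolding r_def distrib_left cis_mult[symmetric] by (simp add: cis1)
  have contI: "continuous_on UNIV H" if c: "continuous_on {0..1} H" and p: "\<And>x. H (x + 1) = H x" for H :: "real \<Rightarrow> complex"
  proof -
    have "continuous_on {of_int n..of_int n + 1} H" for n :: int
    proof -
      have "continuous_on {of_int n..of_int n + 1} (\<lambda>x. H (x - of_int n))"
        by (rule continuous_on_compose2[OF c]) (auto intro!: continuous_intros)
      moreover have "H (x - of_int n) = H x" for x
        using periodic_int[of H x "- n", OF p] by simp
      ultimately show ?thesis by simp
    qed
    note a = this
    have c2: "continuous_on ({of_int (n - 1)..of_int (n - 1) + 1} \<union> {of_int n..of_int n + 1}) H" for n :: int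
      by (intro continuous_on_closed_Un a closed_real_atLeastAtMost)
    have "isCont H x" for x
    proof -
      define n where "n = \<lfloor>x + 1 / 2\<rfloor>"
      have "x \<in> interior ({of_int (n - 1)..of_int (n - 1) + 1} \<union> {of_int n..of_int n + 1})"
      proof (rule interiorI)
        show "x \<in> {of_int n - 1<..<of_int n + 1}" unfolding n_def by (simp; linarith)
        show "{real_of_int n - 1<..<of_int n + 1} \<subseteq> {of_int (n - 1)..of_int (n - 1) + 1} \<union> {of_int n..of_int n + 1}" by auto
      qed simp
      with c2[of n] show ?thesis by (rule continuous_on_interior)
    qed
    then show ?thesis by (simp add: continuous_on_eq_continuous_at)
  qed
  have r_coeff: "integral {0..1} (\<lambda>x. r x * cis (2 * pi * of_int k * x)) = of_real (exp (- pi * (y + of_int k)\<^sup>2 / t))" for k :: int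
  proof -
    define g where "g n x = of_real (M n) * cis (2 * pi * of_int (n + k) * x)" for n :: int and x
    have "r x * cis (2 * pi * of_int k * x) = (\<Sum>\<^sub>\<infinity>n. g n x)" for x
      unfolding r_def M_def[symmetric] g_def
      by (subst infsum_cmult_left'[symmetric]) (simp add: mult.assoc cis_mult algebra_simps)
    moreover have "((\<lambda>n. integral {0..1} (g n)) has_sum integral {0..1} (\<lambda>x. \<Sum>\<^sub>\<infinity>n. g n x)) UNIV"
      by (rule series_integral_unit_interval[OF _ M])
         (auto simp: g_def norm_mult M_def simp del: of_int_add intro!: continuous_intros)
    moreover have "integral {0..1} (g n) = (if n = - k then of_real (M (- k)) else 0)" for n
    proof (cases "n = - k")
      case True
      then have "g n = (\<lambda>x. of_real (M (- k)))" by (auto simp: g_def)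
      with True show ?thesis by simp
    next
      case False
      define a where "a = 2 * pi * of_int (n + k)"
      have a: "a \<noteq> 0" using False by (simp add: a_def flip: of_int_add)
      have "((\<lambda>x. cis (a * x)) has_integral (cis (a * 1) / (\<i> * of_real a) - cis (a * 0) / (\<i> * of_real a))) {0..1}"
      proof (rule fundamental_theorem_of_calculus)
        fix x :: real
        show "((\<lambda>x. cis (a * x) / (\<i> * of_real a)) has_vector_derivative cis (a * x)) (at x within {0..1})"
        proof -
          have "((\<lambda>z. exp (\<i> * of_real a * z) / (\<i> * of_real a)) has_field_derivative exp (\<i> * of_real a * of_real x)) (at (of_real x))"
            using a by (auto intro!: derivative_eq_intros)
          from has_vector_derivative_real_field[OF this, of "{0..1}"] show ?thesis
            by (simp add: cis_conv_exp mult_ac)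
        qed
      qed simp
      moreover have "cis (a * 1) = 1" using cis1[of "n + k"] by (simp add: a_def)
      ultimately have "integral {0..1} (\<lambda>x. cis (a * x)) = 0" by (simp add: integral_unique)
      then show ?thesis using False unfolding g_def a_def[symmetric] by simp
    qed
    moreover have "((\<lambda>n. if n = - k then of_real (M (- k)) else 0 :: complex) has_sum of_real (M (- k))) UNIV"
      by (rule has_sum_finite_neutralI[of "{- k}"]) auto
    moreover have "(- of_int k - y)\<^sup>2 = (y + of_int k)\<^sup>2" by (simp add: power2_eq_square algebra_simps)
    ultimately show ?thesis
      using has_sum_unique[of "\<lambda>n. integral {0..1} (g n)" UNIV] by (simp add: M_def)
  qed
  have r_cont: "continuous_on {0..1} r" unfolding r_def M_def[symmetric]
    by (rule series_integral_unit_interval(2)[OF _ M]) (auto simp: norm_mult M_def intro!: continuous_intros)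
  have cont_h: "continuous_on UNIV h"
    using gauss_periodization_fourier_coeff(2)[OF t, of y] unfolding h_def[symmetric, abs_def]
    by (intro contI per_h)
  have cont_r: "continuous_on UNIV r" by (intro contI r_cont per_r)
  have "fourier_null (\<lambda>x. h x - r x / of_real (sqrt t))"
    unfolding fourier_null_def
  proof (intro conjI allI)
    show "continuous_on UNIV (\<lambda>x. h x - r x / of_real (sqrt t))"
      using t by (intro continuous_intros cont_h cont_r) auto
    fix k :: int
    have i: "(\<lambda>x. h x * cis (2 * pi * of_int k * x)) integrable_on {0..1}"
      "(\<lambda>x. r x * cis (2 * pi * of_int k * x)) integrable_on {0..1}"
      by (intro integrable_continuous_interval continuous_intros continuous_on_subset[OF cont_h] continuous_on_subset[OF cont_r]; simp)+
    have "integral {0..1} (\<lambda>x. h x * cis (2 * pi * of_int k * x) - (1 / of_real (sqrt t)) * (r x * cis (2 * pi * of_int k * x))) = 0"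
      using gauss_periodization_fourier_coeff(1)[OF t, of y k] t unfolding h_def[symmetric, abs_def]
      by (subst integral_diff) (use i in \<open>auto simp: r_coeff intro!: integrable_on_mult_right\<close>)
    then show "integral {0..1} (\<lambda>x. (h x - r x / of_real (sqrt t)) * cis (2 * pi * of_int k * x)) = 0"
      by (simp add: algebra_simps)
  qed
  then have "h x - r x / of_real (sqrt t) = 0"
    by (rule fourier_uniqueness) (simp add: per_h per_r)
  then show ?thesis by (simp add: h_def r_def)
qed

section \<open>Twisted convolution of summable functions\<close>

definition l1norm :: "('g \<Rightarrow> complex) \<Rightarrow> real" where
  "l1norm a = (\<Sum>\<^sub>\<infinity>x. norm (a x))"

text \<open>
  If \<open>W x W y = c x y W (x + y)\<close>, this is the coefficient function of the product of the series
  with coefficients \<open>a\<close> and \<open>b\<close> in the \<open>W x\<close>.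
\<close>

definition tconv :: "('g \<Rightarrow> 'g \<Rightarrow> complex) \<Rightarrow> ('g::ab_group_add \<Rightarrow> complex) \<Rightarrow> ('g \<Rightarrow> complex) \<Rightarrow> 'g \<Rightarrow> complex" where
  "tconv c a b v = (\<Sum>\<^sub>\<infinity>w. a w * b (v - w) * c w (v - w))"

abbreviation l1 :: "('g \<Rightarrow> complex) \<Rightarrow> bool" where
  "l1 a \<equiv> (\<lambda>x. norm (a x)) summable_on UNIV"

lemma l1norm_nonneg: "l1norm a \<ge> 0"
  unfolding l1norm_def by (rule infsum_nonneg) auto

lemma bij_diff: "bij (\<lambda>v. v - w)" for w :: "'g::ab_group_add"
  by (rule bij_betwI[where g = "\<lambda>v. v + w"]) auto

lemma bij_diff_swap: "bij (\<lambda>v. w - v)" for w :: "'g::ab_group_add"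
  by (rule bij_betwI[where g = "\<lambda>v. w - v"]) auto

lemma tconv_kernel_summable:
  fixes a b :: "'g::ab_group_add \<Rightarrow> complex"
  assumes a: "l1 a" and b: "l1 b" and c: "\<And>x y. norm (c x y) = 1"
  shows "(\<lambda>(w, v). norm (a w * b (v - w) * c w (v - w))) summable_on UNIV \<times> UNIV"
    and "(\<Sum>\<^sub>\<infinity>w. \<Sum>\<^sub>\<infinity>v. norm (a w * b (v - w) * c w (v - w))) = l1norm a * l1norm b"
proof -
  have 1: "(\<lambda>v. norm (a w * b (v - w) * c w (v - w))) summable_on UNIV" for w
    using summable_on_reindex_bij_betw[OF bij_diff[of w], of "\<lambda>v. norm (b v)"] b
    by (auto simp: norm_mult c intro!: summable_on_cmult_right)
  have 2: "(\<Sum>\<^sub>\<infinity>v. norm (a w * b (v - w) * c w (v - w))) = norm (a w) * l1norm b" for w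
    using infsum_reindex_bij_betw[OF bij_diff[of w], of "\<lambda>v. norm (b v)"]
    by (simp add: norm_mult c infsum_cmult_right' l1norm_def)
  show "(\<lambda>(w, v). norm (a w * b (v - w) * c w (v - w))) summable_on UNIV \<times> UNIV"
  proof -
    have "(\<lambda>w. \<bar>\<Sum>\<^sub>\<infinity>v. norm (a w * b (v - w) * c w (v - w))\<bar>) summable_on UNIV"
      unfolding 2 using a by (auto simp: l1norm_nonneg intro!: summable_on_cmult_left)
    then show ?thesis
      using Infinite_Sum.abs_summable_on_Sigma_iff[of "\<lambda>(w, v). a w * b (v - w) * c w (v - w)" UNIV "\<lambda>_. UNIV"] 1
      by (simp add: case_prod_unfold)
  qed
  show "(\<Sum>\<^sub>\<infinity>w. \<Sum>\<^sub>\<infinity>v. norm (a w * b (v - w) * c w (v - w))) = l1norm a * l1norm b"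
    by (simp add: 2 infsum_cmult_left' l1norm_def)
qed

lemma tconv_abs_summable:
  fixes a b :: "'g::ab_group_add \<Rightarrow> complex"
  assumes a: "l1 a" and b: "l1 b" and c: "\<And>x y. norm (c x y) = 1"
  shows "(\<lambda>w. norm (a w * b (v - w) * c w (v - w))) summable_on UNIV"
proof -
  have "(\<lambda>(w, v). norm (a w * b (v - w) * c w (v - w))) summable_on UNIV \<times> UNIV"
    using tconv_kernel_summable(1)[of a b c, OF a b c] by (simp add: case_prod_unfold)
  then have "(\<lambda>(v, w). norm (a w * b (v - w) * c w (v - w))) summable_on UNIV \<times> UNIV"
    by (subst summable_on_swap) (simp add: case_prod_unfold)
  from summable_on_SigmaD1[OF this, of v] show ?thesis by simp
qed

lemma l1_tconv:
  fixes a b :: "'g::ab_group_add \<Rightarrow> complex"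
  assumes a: "l1 a" and b: "l1 b" and c: "\<And>x y. norm (c x y) = 1"
  shows "l1 (tconv c a b)" and "l1norm (tconv c a b) \<le> l1norm a * l1norm b"
proof -
  define f where "f w v = norm (a w * b (v - w) * c w (v - w))" for w v
  have s: "(\<lambda>(w, v). f w v) summable_on UNIV \<times> UNIV"
    using tconv_kernel_summable(1)[of a b c, OF a b c] by (simp add: f_def case_prod_unfold)
  have s': "(\<lambda>(v, w). f w v) summable_on UNIV \<times> UNIV"
    by (subst summable_on_swap) (use s in \<open>simp add: case_prod_unfold\<close>)
  have F: "(\<lambda>v. \<Sum>\<^sub>\<infinity>w. f w v) summable_on UNIV"
    using summable_on_Sigma_banach[OF s'] by simp
  have le: "norm (tconv c a b v) \<le> (\<Sum>\<^sub>\<infinity>w. f w v)" for v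
    unfolding tconv_def f_def by (intro norm_infsum_bound tconv_abs_summable a b c)
  show l: "l1 (tconv c a b)"
    by (rule summable_on_comparison_test[OF F]) (use le in auto)
  have "l1norm (tconv c a b) \<le> (\<Sum>\<^sub>\<infinity>v. \<Sum>\<^sub>\<infinity>w. f w v)"
    unfolding l1norm_def by (intro infsum_mono l F) (use le in auto)
  also have "\<dots> = (\<Sum>\<^sub>\<infinity>w. \<Sum>\<^sub>\<infinity>v. f w v)" by (rule infsum_swap_banach[OF s'])
  also have "\<dots> = l1norm a * l1norm b"
    unfolding f_def by (rule tconv_kernel_summable(2)[of a b c, OF a b c])
  finally show "l1norm (tconv c a b) \<le> l1norm a * l1norm b" .
qed

lemma l1_add: "l1 a \<Longrightarrow> l1 b \<Longrightarrow> l1 (\<lambda>x. a x + b x)"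
  by (rule Infinite_Sum.abs_summable_on_comparison_test'[where g = "\<lambda>x. norm (a x) + norm (b x)"])
     (auto intro: summable_on_add norm_triangle_ineq)

lemma l1_cmult: "l1 a \<Longrightarrow> l1 (\<lambda>x. r * a x)"
  by (simp add: norm_mult summable_on_cmult_right)

lemma l1_diff: "l1 a \<Longrightarrow> l1 b \<Longrightarrow> l1 (\<lambda>x. a x - b x)"
  using l1_add[of a "\<lambda>x. - 1 * b x"] l1_cmult[of b "-1"] by simp

lemma l1norm_triangle: "l1 a \<Longrightarrow> l1 b \<Longrightarrow> l1norm (\<lambda>x. a x + b x) \<le> l1norm a + l1norm b"
  unfolding l1norm_def
  by (subst infsum_add[symmetric])
     (auto intro!: infsum_mono l1_add summable_on_add norm_triangle_ineq)

lemma tconv_add_left: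
  assumes "l1 a" "l1 a'" "l1 b" and c: "\<And>x y. norm (c x y) = 1"
  shows "tconv c (\<lambda>x. a x + a' x) b v = tconv c a b v + tconv c a' b v"
  using tconv_abs_summable[of a b c v, OF assms(1,3) c] tconv_abs_summable[of a' b c v, OF assms(2,3) c]
  unfolding tconv_def
  by (subst infsum_add[symmetric]) (auto simp: algebra_simps abs_summable_summable)

lemma tconv_add_right:
  assumes "l1 a" "l1 b" "l1 b'" and c: "\<And>x y. norm (c x y) = 1"
  shows "tconv c a (\<lambda>x. b x + b' x) v = tconv c a b v + tconv c a b' v"
  using tconv_abs_summable[of a b c v, OF assms(1,2) c] tconv_abs_summable[of a b' c v, OF assms(1,3) c]
  unfolding tconv_def
  by (subst infsum_add[symmetric]) (auto simp: algebra_simps abs_summable_summable)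

section \<open>Gabor duality for the Gaussian\<close>

lemma l1_product:
  fixes f :: "'i \<Rightarrow> complex" and g :: "'j \<Rightarrow> complex"
  assumes f: "l1 f" and g: "l1 g"
  shows "l1 (\<lambda>(p, q). f p * g q)"
    and "l1norm (\<lambda>(p, q). f p * g q) = l1norm f * l1norm g"
    and "(\<Sum>\<^sub>\<infinity>(p, q). f p * g q) = (\<Sum>\<^sub>\<infinity>p. f p) * (\<Sum>\<^sub>\<infinity>q. g q)"
proof -
  have 2: "(\<Sum>\<^sub>\<infinity>q. norm (f p * g q)) = norm (f p) * l1norm g" for p
    by (simp add: norm_mult infsum_cmult_right' l1norm_def)
  have 1: "(\<lambda>q. norm (f p * g q)) summable_on UNIV" for p
    using g by (auto simp: norm_mult intro!: summable_on_cmult_right)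
  have "(\<lambda>p. \<bar>\<Sum>\<^sub>\<infinity>q. norm (f p * g q)\<bar>) summable_on UNIV"
    unfolding 2 using f by (auto simp: l1norm_nonneg intro!: summable_on_cmult_left)
  with 1 have s: "(\<lambda>(p, q). norm (f p * g q)) summable_on UNIV \<times> UNIV"
    using Infinite_Sum.abs_summable_on_Sigma_iff[of "\<lambda>(p, q). f p * g q" UNIV "\<lambda>_. UNIV"]
    by (simp add: case_prod_unfold)
  then show l: "l1 (\<lambda>(p, q). f p * g q)" by (simp add: case_prod_unfold)
  have "l1norm (\<lambda>(p, q). f p * g q) = (\<Sum>\<^sub>\<infinity>(p, q)\<in>UNIV \<times> UNIV. norm (f p * g q))"
    by (simp add: l1norm_def case_prod_unfold)
  also have "\<dots> = (\<Sum>\<^sub>\<infinity>p. \<Sum>\<^sub>\<infinity>q. norm (f p * g q))"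
    by (rule infsum_Sigma'_banach[OF s, symmetric])
  finally show "l1norm (\<lambda>(p, q). f p * g q) = l1norm f * l1norm g"
    by (simp add: 2 infsum_cmult_left' l1norm_def)
  have "(\<lambda>(p, q). f p * g q) summable_on UNIV \<times> UNIV"
    using abs_summable_summable[OF l] by simp
  from infsum_Sigma'_banach[OF this]
  have "(\<Sum>\<^sub>\<infinity>(p, q)\<in>UNIV \<times> UNIV. f p * g q) = (\<Sum>\<^sub>\<infinity>p. \<Sum>\<^sub>\<infinity>q. f p * g q)" by simp
  also have "\<dots> = (\<Sum>\<^sub>\<infinity>p. f p) * (\<Sum>\<^sub>\<infinity>q. g q)"
    by (simp add: infsum_cmult_right' infsum_cmult_left')
  finally show "(\<Sum>\<^sub>\<infinity>(p, q). f p * g q) = (\<Sum>\<^sub>\<infinity>p. f p) * (\<Sum>\<^sub>\<infinity>q. g q)" by simp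
qed

text \<open>
  The points of one parity form a square lattice turned by 45 degrees, with coordinates \<open>(p, q)\<close>.
\<close>

lemma parity_coset:
  "bij_betw (\<lambda>(p, q). (p + q + i, p - q)) UNIV {(m, n). even (m + n - i)}" for i :: int
proof (rule bij_betwI[where g = "\<lambda>(m, n). ((m + n - i) div 2, (m - n - i) div 2)"])
  show "(\<lambda>(p, q). (p + q + i, p - q)) \<in> UNIV \<rightarrow> {(m, n). even (m + n - i)}" by auto
next
  fix y :: "int \<times> int"
  assume "y \<in> {(m, n). even (m + n - i)}"
  moreover obtain m n where y: "y = (m, n)" by force
  ultimately have "even (m + n - i)" by auto
  then obtain k where "m + n - i = 2 * k" by (elim evenE)
  then have "m = 2 * k - n + i" by simp
  then show "(case case y of (m, n) \<Rightarrow> ((m + n - i) div 2, (m - n - i) div 2) of (p, q) \<Rightarrow> (p + q + i, p - q)) = y"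
    by (auto simp: y)
qed auto

lemma infsum_parity_coset:
  fixes f :: "int \<times> int \<Rightarrow> 'a::{comm_monoid_add, t2_space}"
  assumes "\<And>m n. odd (m + n - i) \<Longrightarrow> f (m, n) = 0"
  shows "infsum f UNIV = infsum (\<lambda>(p, q). f (p + q + i, p - q)) UNIV"
    and "f summable_on UNIV \<longleftrightarrow> (\<lambda>(p, q). f (p + q + i, p - q)) summable_on UNIV"
proof -
  have "infsum f UNIV = infsum f {(m, n). even (m + n - i)}"
    by (rule infsum_cong_neutral) (use assms in auto)
  also have "\<dots> = infsum (\<lambda>x. f (case x of (p, q) \<Rightarrow> (p + q + i, p - q))) UNIV"
    by (rule infsum_reindex_bij_betw[OF parity_coset, symmetric])
  finally show "infsum f UNIV = infsum (\<lambda>(p, q). f (p + q + i, p - q)) UNIV"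
    by (simp add: case_prod_unfold)
  have "f summable_on UNIV \<longleftrightarrow> f summable_on {(m, n). even (m + n - i)}"
    by (rule summable_on_cong_neutral) (use assms in auto)
  also have "\<dots> \<longleftrightarrow> (\<lambda>x. f (case x of (p, q) \<Rightarrow> (p + q + i, p - q))) summable_on UNIV"
    by (rule summable_on_reindex_bij_betw[OF parity_coset, symmetric])
  finally show "f summable_on UNIV \<longleftrightarrow> (\<lambda>(p, q). f (p + q + i, p - q)) summable_on UNIV"
    by (simp add: case_prod_unfold)
qed

lemma cis_pi_even: "even (x - y) \<Longrightarrow> cis (pi * of_int x) = cis (pi * of_int y)" for x y :: int
proof (elim evenE)
  fix k assume "x - y = 2 * k"
  then have "x = y + 2 * k" by simp
  then have "pi * of_int x = pi * of_int y + 2 * pi * of_int k" by (simp add: distrib_left)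
  then show ?thesis using cis_multiple_2pi[of "of_int k"] by (simp flip: cis_mult)
qed

text \<open>
  The cocycle of the symmetrically ordered Weyl unitaries of the rotation algebra.
\<close>

definition rotc :: "real \<Rightarrow> int \<times> int \<Rightarrow> int \<times> int \<Rightarrow> complex" where
  "rotc \<theta> = (\<lambda>(m, n) (m', n'). cis (pi * \<theta> * (of_int n * of_int m' - of_int m * of_int n')))"

text \<open>
  The (conjugate) Weyl cocycle of the adjoint lattice of the even sublattice. In rotated coordinates
  the even sublattice has covolume \<open>\<beta> = 2 * \<theta>\<close>, hence the factor \<open>1 / \<beta>\<close>.
\<close>

definition dualc :: "real \<Rightarrow> int \<times> int \<Rightarrow> int \<times> int \<Rightarrow> complex" where
  "dualc \<beta> = (\<lambda>(a, b) (a', b'). cis (- pi * (of_int a * of_int b' - of_int b * of_int a') / \<beta>))"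

lemma norm_rotc [simp]: "norm (rotc \<theta> z z') = 1"
  by (simp add: rotc_def case_prod_unfold)

lemma norm_dualc [simp]: "norm (dualc \<beta> z z') = 1"
  by (simp add: dualc_def case_prod_unfold)

text \<open>
  The inner products of the Gaussian with its translates over the adjoint lattice, a square lattice of
  spacing \<open>1 / sqrt \<beta>\<close>. For odd \<open>i\<close> they are multiplied by the character \<open>(-1)\<^sup>a\<^sup>+\<^sup>b\<close>, which
  tells the centres of the two families apart.
\<close>

definition gram :: "real \<Rightarrow> int \<Rightarrow> int \<times> int \<Rightarrow> complex" where
  "gram \<beta> i = (\<lambda>(a, b). cis (pi * of_int (i * (a + b))) * of_real (exp (- pi * (of_int a ^ 2 + of_int b ^ 2) / (2 * \<beta>))))"

text \<open>
  Up to the factor \<open>\<beta>\<close>, the inner product of the Gaussian translated by the adjoint lattice point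
  \<open>(a, b)\<close> with the Gaussian translated by the point \<open>(m, n)\<close>, whose rotated coordinates are
  \<open>((m + n) / 2, (m - n) / 2)\<close>, restricted to one parity of \<open>m + n\<close>. The even part belongs to the sum of the
  two frame operators and the odd part to their difference. The sign \<open>cis (pi * n)\<close> comes from
  moving the Gaussian to the centre \<open>(L / 2, 0)\<close>.
\<close>

definition gabor :: "real \<Rightarrow> int \<Rightarrow> int \<times> int \<Rightarrow> int \<times> int \<Rightarrow> complex" where
  "gabor \<beta> i = (\<lambda>(a, b) (m, n).
     if even (m + n - i) then
       of_real \<beta> * cis (pi * of_int n - pi * ((of_int m + of_int n) / 2 * of_int b - (of_int m - of_int n) / 2 * of_int a))
       * of_real (exp (- pi * \<beta> / 2 * (((of_int m + of_int n) / 2 - of_int a / \<beta>)\<^sup>2 + ((of_int m - of_int n) / 2 - of_int b / \<beta>)\<^sup>2)))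
     else 0)"

lemma l1_gauss_row:
  assumes "c > 0"
  shows "l1 (\<lambda>p::int. cis (u p) * of_real (exp (- c * (x + of_int p)\<^sup>2)))"
    and "l1norm (\<lambda>p::int. cis (u p) * of_real (exp (- c * (x + of_int p)\<^sup>2))) \<le> (\<Sum>\<^sub>\<infinity>n::int. exp (3 * c) * exp (- 2 * c) ^ nat \<bar>n\<bar>)"
  using summable_on_gauss[OF assms, of x] infsum_gauss_le[OF assms, of x]
  by (auto simp: norm_mult l1norm_def)

definition gabor_bound :: "real \<Rightarrow> real" where
  "gabor_bound \<beta> = \<beta> * (\<Sum>\<^sub>\<infinity>n::int. exp (3 * (pi * \<beta> / 2)) * exp (- 2 * (pi * \<beta> / 2)) ^ nat \<bar>n\<bar>)\<^sup>2"

lemma gabor_l1: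
  assumes \<beta>: "\<beta> > 0"
  shows "l1 (gabor \<beta> i w)" and "l1norm (gabor \<beta> i w) \<le> gabor_bound \<beta>"
proof -
  obtain a b where w: "w = (a, b)" by force
  define f where "f x p = cis 0 * of_real (exp (- (pi * \<beta> / 2) * (x + of_int p)\<^sup>2))" for x and p :: int
  let ?x = "of_int i / 2 - of_int a / \<beta>" and ?y = "of_int i / 2 - of_int b / \<beta>"
  have c: "pi * \<beta> / 2 > 0" using \<beta> by simp
  have eq: "norm (gabor \<beta> i w (p + q + i, p - q)) = \<beta> * norm (f ?x p * f ?y q)" for p q
  proof -
    have "(of_int (p + q + i) + of_int (p - q)) / 2 = (of_int i / 2 + of_int p :: real)"
      "(of_int (p + q + i) - of_int (p - q)) / 2 = (of_int i / 2 + of_int q :: real)" by (simp_all add: field_simps)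
    note PQ = this
    have ev: "even (p + q + i + (p - q) - i)" by simp
    have r: "of_int i / 2 + of_int p - of_int a / \<beta> = ?x + of_int p"
      "of_int i / 2 + of_int q - of_int b / \<beta> = ?y + of_int q" by simp_all
    have "exp (- pi * \<beta> / 2 * (s\<^sup>2 + t\<^sup>2)) = exp (- (pi * \<beta> / 2) * s\<^sup>2) * exp (- (pi * \<beta> / 2) * t\<^sup>2)" for s t
      by (simp add: algebra_simps add_divide_distrib flip: exp_add)
    then show ?thesis using \<beta>
      unfolding gabor_def w prod.case if_P[OF ev] PQ r f_def by (simp add: norm_mult)
  qed
  have l: "l1 (\<lambda>(p, q). f ?x p * f ?y q)"
    and n: "l1norm (\<lambda>(p, q). f ?x p * f ?y q) = l1norm (f ?x) * l1norm (f ?y)"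
    unfolding f_def by (intro l1_product l1_gauss_row c)+
  have z: "norm (gabor \<beta> i w (m, n)) = 0" if "odd (m + n - i)" for m n
    using that by (simp add: gabor_def w)
  note P = infsum_parity_coset[where f = "\<lambda>z. norm (gabor \<beta> i w z)" and i = i, OF z]
  show "l1 (gabor \<beta> i w)"
  proof -
    have "(\<lambda>(p, q). norm (gabor \<beta> i w (p + q + i, p - q))) summable_on UNIV"
      unfolding eq using summable_on_cmult_right[OF l, of \<beta>] by (simp add: case_prod_unfold)
    then show ?thesis by (subst P(2))
  qed
  have "l1norm (gabor \<beta> i w) = \<beta> * l1norm (\<lambda>(p, q). f ?x p * f ?y q)"
  proof -
    have "l1norm (gabor \<beta> i w) = (\<Sum>\<^sub>\<infinity>(p, q). norm (gabor \<beta> i w (p + q + i, p - q)))"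
      unfolding l1norm_def by (subst P(1)) auto
    then show ?thesis
      unfolding eq l1norm_def by (subst infsum_cmult_right'[symmetric]) (simp add: case_prod_unfold)
  qed
  also have "\<dots> \<le> gabor_bound \<beta>"
  proof -
    have "l1norm (f ?x) * l1norm (f ?y) \<le> (\<Sum>\<^sub>\<infinity>n::int. exp (3 * (pi * \<beta> / 2)) * exp (- 2 * (pi * \<beta> / 2)) ^ nat \<bar>n\<bar>)\<^sup>2"
      (is "_ \<le> ?B\<^sup>2")
    proof -
      have "l1norm (f x) \<le> ?B" for x unfolding f_def by (rule l1_gauss_row(2)[OF c])
      then show ?thesis
        unfolding power2_eq_square by (intro mult_mono l1norm_nonneg infsum_nonneg) auto
    qed
    then show ?thesis unfolding n gabor_bound_def using \<beta> by (intro mult_left_mono) auto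
  qed
  finally show "l1norm (gabor \<beta> i w) \<le> gabor_bound \<beta>" .
qed

lemma norm_gabor_le: "\<beta> > 0 \<Longrightarrow> norm (gabor \<beta> i w z) \<le> \<beta>"
proof -
  assume "\<beta> > 0"
  moreover have "exp (- pi * \<beta> / 2 * (x\<^sup>2 + y\<^sup>2)) \<le> 1" for x y :: real
    using \<open>\<beta> > 0\<close> by (simp add: mult_nonneg_nonneg)
  ultimately show ?thesis
    by (auto simp: gabor_def norm_mult case_prod_unfold mult_left_le)
qed

text \<open>
  Poisson summation with offset \<open>1 / 2\<close>: the odd sublattice has half-integral rotated coordinates.
\<close>

lemma gauss_row_poisson:
  fixes \<beta> V V' :: real
  assumes \<beta>: "\<beta> > 0"
  shows "(\<Sum>\<^sub>\<infinity>p::int. of_real (exp (- pi * \<beta> * (of_int p + 1 / 2 - V / 2)\<^sup>2)) * cis (pi * \<beta> * V' * (of_int p + 1 / 2)))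
    = cis (pi * \<beta> * V * V' / 2) / of_real (sqrt \<beta>) *
      (\<Sum>\<^sub>\<infinity>k::int. of_real (exp (- pi * (of_int k - \<beta> * V' / 2)\<^sup>2 / \<beta>)) * cis (pi * of_int k * (1 - V)))"
proof -
  define x where "x = 1 / 2 - V / 2"
  define y where "y = \<beta> * V' / 2"
  have "of_real (exp (- pi * \<beta> * (of_int p + 1 / 2 - V / 2)\<^sup>2)) * cis (pi * \<beta> * V' * (of_int p + 1 / 2)) =
    cis (pi * \<beta> * V * V' / 2) * (of_real (exp (- pi * \<beta> * (x + of_int p)\<^sup>2)) * cis (2 * pi * y * (x + of_int p)))" for p :: int
  proof -
    have "pi * \<beta> * V' * (of_int p + 1 / 2) = pi * \<beta> * V * V' / 2 + 2 * pi * y * (x + of_int p)"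
      by (simp add: x_def y_def algebra_simps)
    moreover have "of_int p + 1 / 2 - V / 2 = x + of_int p" by (simp add: x_def)
    ultimately show ?thesis by (simp only: cis_mult[symmetric] mult_ac)
  qed
  then have "(\<Sum>\<^sub>\<infinity>p::int. of_real (exp (- pi * \<beta> * (of_int p + 1 / 2 - V / 2)\<^sup>2)) * cis (pi * \<beta> * V' * (of_int p + 1 / 2)))
     = cis (pi * \<beta> * V * V' / 2) * (\<Sum>\<^sub>\<infinity>p::int. of_real (exp (- pi * \<beta> * (x + of_int p)\<^sup>2)) * cis (2 * pi * y * (x + of_int p)))"
    by (simp only: infsum_cmult_right')
  also have "\<dots> = cis (pi * \<beta> * V * V' / 2) / of_real (sqrt \<beta>) *
     (\<Sum>\<^sub>\<infinity>k::int. of_real (exp (- pi * (of_int k - y)\<^sup>2 / \<beta>)) * cis (2 * pi * of_int k * x))"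
    unfolding poisson_gauss[OF \<beta>] by simp
  also have "(\<lambda>k::int. 2 * pi * of_int k * x) = (\<lambda>k. pi * of_int k * (1 - V))"
    by (simp add: x_def algebra_simps)
  finally show ?thesis unfolding y_def .
qed

text \<open>
  A product of two one-dimensional Poisson summations. On the right the summation variables are renamed
  so that \<open>(a, b)\<close> is the point of the adjoint lattice: the first row yields \<open>- b\<close> and the second
  \<open>a\<close>.
\<close>

lemma gabor_tconv_core:
  fixes \<beta> V1 V2 :: real
  assumes \<beta>: "\<beta> > 0"
  shows "\<beta> * (\<Sum>\<^sub>\<infinity>(p::int, q::int). of_real (exp (- pi * \<beta> * ((of_int p + 1 / 2 - V1 / 2)\<^sup>2 + (of_int q + 1 / 2 - V2 / 2)\<^sup>2)))
      * cis (pi * \<beta> * (V1 * (of_int q + 1 / 2) - V2 * (of_int p + 1 / 2)))) =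
    (\<Sum>\<^sub>\<infinity>(a::int, b::int). of_real (exp (- pi / \<beta> * ((of_int a - \<beta> * V1 / 2)\<^sup>2 + (of_int b - \<beta> * V2 / 2)\<^sup>2)))
      * cis (pi * (of_int a - of_int b) + pi * (of_int b * V1 - of_int a * V2)))"
proof -
  define f where "f V V' p = of_real (exp (- pi * \<beta> * (of_int p + 1 / 2 - V / 2)\<^sup>2)) * cis (pi * \<beta> * V' * (of_int p + 1 / 2))" for V V' and p :: int
  define g where "g V V' k = of_real (exp (- pi * (of_int k - \<beta> * V' / 2)\<^sup>2 / \<beta>)) * cis (pi * of_int k * (1 - V))" for V V' and k :: int
  have fl: "l1 (f V V')" for V V'
    using summable_on_gauss[of "pi * \<beta>" "1/2 - V/2"] \<beta>
    by (simp add: f_def[abs_def] norm_mult algebra_simps)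
  have gl: "l1 (g V V')" for V V'
    using summable_on_gauss[of "pi / \<beta>" "- \<beta> * V' / 2"] \<beta>
    by (simp add: g_def[abs_def] norm_mult algebra_simps)
  have "(\<Sum>\<^sub>\<infinity>(p::int, q::int). of_real (exp (- pi * \<beta> * ((of_int p + 1 / 2 - V1 / 2)\<^sup>2 + (of_int q + 1 / 2 - V2 / 2)\<^sup>2)))
      * cis (pi * \<beta> * (V1 * (of_int q + 1 / 2) - V2 * (of_int p + 1 / 2)))) =
      (\<Sum>\<^sub>\<infinity>(p, q). f V1 (- V2) p * f V2 V1 q)"
  proof (intro infsum_cong, clarify)
    fix p q :: int
    have "pi * \<beta> * (V1 * (of_int q + 1 / 2) - V2 * (of_int p + 1 / 2)) =
       pi * \<beta> * (- V2) * (of_int p + 1 / 2) + pi * \<beta> * V1 * (of_int q + 1 / 2)" by (simp add: algebra_simps)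
    moreover have "- pi * \<beta> * (s + t) = - pi * \<beta> * s + (- pi * \<beta> * t)" for s t by (simp add: algebra_simps)
    ultimately show "of_real (exp (- pi * \<beta> * ((of_int p + 1 / 2 - V1 / 2)\<^sup>2 + (of_int q + 1 / 2 - V2 / 2)\<^sup>2)))
      * cis (pi * \<beta> * (V1 * (of_int q + 1 / 2) - V2 * (of_int p + 1 / 2))) = f V1 (- V2) p * f V2 V1 q"
      unfolding f_def by (simp only: exp_add cis_mult[symmetric] of_real_mult mult_ac)
  qed
  also have "\<dots> = (\<Sum>\<^sub>\<infinity>p. f V1 (- V2) p) * (\<Sum>\<^sub>\<infinity>q. f V2 V1 q)"
    by (rule l1_product(3)[OF fl fl])
  also have "\<dots> = (1 / \<beta>) * ((\<Sum>\<^sub>\<infinity>a. g V2 V1 a) * (\<Sum>\<^sub>\<infinity>k. g V1 (- V2) k))"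
  proof -
    have "cis (pi * \<beta> * V1 * (- V2) / 2) * cis (pi * \<beta> * V2 * V1 / 2) = 1"
      by (simp add: cis_mult algebra_simps)
    moreover have "complex_of_real (sqrt \<beta>) * of_real (sqrt \<beta>) = of_real \<beta>"
      using \<beta> by (simp flip: of_real_mult)
    moreover have "(A / s * X') * (B / s * Y') = (A * B) / (s * s) * (Y' * X')" for A B s X' Y' :: complex
      by (simp add: mult_ac)
    ultimately show ?thesis
      unfolding f_def gauss_row_poisson[OF \<beta>] g_def[symmetric] by (simp only:)  simp
  qed
  also have "(\<Sum>\<^sub>\<infinity>k. g V1 (- V2) k) = (\<Sum>\<^sub>\<infinity>b. g V1 (- V2) (- b))"
    by (rule infsum_reindex_bij_betw[symmetric]) (rule bij_betwI[where g = uminus], auto)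
  also have "(\<Sum>\<^sub>\<infinity>a. g V2 V1 a) * (\<Sum>\<^sub>\<infinity>b. g V1 (- V2) (- b)) = (\<Sum>\<^sub>\<infinity>(a, b). g V2 V1 a * g V1 (- V2) (- b))"
  proof (rule l1_product(3)[OF gl, symmetric])
    have "bij (uminus :: int \<Rightarrow> int)" by (rule bij_betwI[where g = uminus]) auto
    from summable_on_reindex_bij_betw[OF this, of "\<lambda>b. norm (g V1 (- V2) b)"] gl
    show "l1 (\<lambda>b. g V1 (- V2) (- b))" by simp
  qed
  also have "\<dots> = (\<Sum>\<^sub>\<infinity>(a::int, b::int). of_real (exp (- pi / \<beta> * ((of_int a - \<beta> * V1 / 2)\<^sup>2 + (of_int b - \<beta> * V2 / 2)\<^sup>2)))
      * cis (pi * (of_int a - of_int b) + pi * (of_int b * V1 - of_int a * V2)))"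
  proof (intro infsum_cong, clarify)
    fix a b :: int
    have C: "cis (pi * (of_int a - of_int b) + pi * (of_int b * V1 - of_int a * V2)) =
        cis (pi * of_int a * (1 - V2)) * cis (pi * of_int (- b) * (1 - V1))"
      unfolding cis_mult by (rule arg_cong[of _ _ cis]) (simp add: algebra_simps)
    have S: "(of_int (- b) - \<beta> * (- V2) / 2)\<^sup>2 = (of_int b - \<beta> * V2 / 2)\<^sup>2"
      by (simp add: power2_eq_square algebra_simps)
    have E: "exp (- pi / \<beta> * (s + t)) = exp (- pi * s / \<beta>) * exp (- pi * t / \<beta>)" for s t
      using \<beta> by (simp add: field_simps flip: exp_add)
    show "g V2 V1 a * g V1 (- V2) (- b) = of_real (exp (- pi / \<beta> * ((of_int a - \<beta> * V1 / 2)\<^sup>2 + (of_int b - \<beta> * V2 / 2)\<^sup>2)))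
      * cis (pi * (of_int a - of_int b) + pi * (of_int b * V1 - of_int a * V2))"
      unfolding g_def C S E by simp
  qed
  finally show ?thesis using \<beta> by simp
qed

text \<open>
  The Gabor duality between a lattice and its adjoint. By completing the square, the product of the two
  Gaussians under the sum is a Gaussian in the summation variable, centred at half of \<open>(V1, V2)\<close>,
  the offset of \<open>z\<close> from the adjoint lattice point \<open>w\<close>; Poisson summation then replaces the
  sum over the odd sublattice by one over the adjoint lattice. The character in \<open>gram \<beta> i\<close>
  appears for odd \<open>i\<close> because translations over the adjoint lattice commute with the Weyl unitaries of even
  parity, but only up to the sign \<open>(-1)\<^sup>a\<^sup>+\<^sup>b\<close> with those of odd parity.
\<close>

lemma gabor_tconv:
  fixes \<beta> :: real
  assumes \<beta>: "\<beta> > 0"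
  shows "tconv (rotc (\<beta> / 2)) (gabor \<beta> i w) (gabor \<beta> 1 (0, 0)) z =
    (\<Sum>\<^sub>\<infinity>w'. gram \<beta> i w' * dualc \<beta> w w' * gabor \<beta> (i + 1) (w + w') z)"
proof -
  obtain a b where w: "w = (a, b)" by force
  obtain m n where z: "z = (m, n)" by force
  show ?thesis
  proof (cases "even (m + n - (i + 1))")
    case False
    then have "gabor \<beta> (i + 1) (w + w') z = 0" for w' by (cases w') (simp add: gabor_def w z)
    moreover have "gabor \<beta> i w u * gabor \<beta> 1 (0, 0) (z - u) * rotc (\<beta> / 2) u (z - u) = 0" for u
      using False by (cases u) (auto simp: gabor_def w z)
    ultimately show ?thesis unfolding tconv_def by (simp only: infsum_0_simp mult_zero_right)
  next
    case True
    define P Q V1 V2 where "P = (of_int m + of_int n :: real) / 2" and "Q = (of_int m - of_int n :: real) / 2"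
      and "V1 = P - of_int a / \<beta>" and "V2 = Q - of_int b / \<beta>"
    (* the factor common to all terms on both sides, after completing the square *)
    define K where "K = of_real \<beta> * (cis (pi * of_int n - pi * (P * of_int b - Q * of_int a)) * of_real (exp (- pi * \<beta> / 4 * (V1\<^sup>2 + V2\<^sup>2))))"
    define F where "F u = gabor \<beta> i w (z - u) * gabor \<beta> 1 (0, 0) u * rotc (\<beta> / 2) (z - u) u" for u
    have F: "F (p + q + 1, p - q) = of_real \<beta> * K * (of_real (exp (- pi * \<beta> * ((of_int p + 1 / 2 - V1 / 2)\<^sup>2 + (of_int q + 1 / 2 - V2 / 2)\<^sup>2)))
      * cis (pi * \<beta> * (V1 * (of_int q + 1 / 2) - V2 * (of_int p + 1 / 2))))" for p q
    proof -
      have ev: "even (m - (p + q + 1) + (n - (p - q)) - i)" "even (p + q + 1 + (p - q) - 1)" using True by auto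
      define x y where "x = (of_int p + 1 / 2 :: real)" and "y = (of_int q + 1 / 2 :: real)"
      have xy: "(of_int (p + q + 1) + of_int (p - q)) / 2 = x" "(of_int (p + q + 1) - of_int (p - q)) / 2 = y"
        "(of_int (m - (p + q + 1)) + of_int (n - (p - q))) / 2 = P - x"
        "(of_int (m - (p + q + 1)) - of_int (n - (p - q))) / 2 = Q - y"
        by (simp_all add: x_def y_def P_def Q_def field_simps)
      have 1: "gabor \<beta> i w (z - (p + q + 1, p - q)) = of_real \<beta> * cis (pi * of_int (n - (p - q)) - pi * ((P - x) * of_int b - (Q - y) * of_int a))
         * of_real (exp (- pi * \<beta> / 2 * ((V1 - x)\<^sup>2 + (V2 - y)\<^sup>2)))"
        unfolding gabor_def w z minus_prod_def fst_conv snd_conv prod.case if_P[OF ev(1)] xy V1_def V2_def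
        by (simp only: diff_diff_eq add.commute)
      have 2: "gabor \<beta> 1 (0, 0) (p + q + 1, p - q) = of_real \<beta> * cis (pi * of_int (p - q)) * of_real (exp (- pi * \<beta> / 2 * (x\<^sup>2 + y\<^sup>2)))"
        using ev(2) xy by (simp add: gabor_def)
      have 3: "rotc (\<beta> / 2) (z - (p + q + 1, p - q)) (p + q + 1, p - q) = cis (pi * \<beta> * (P * y - Q * x))"
        unfolding rotc_def z minus_prod_def fst_conv snd_conv prod.case
        by (rule arg_cong[of _ _ cis]) (simp add: x_def y_def P_def Q_def field_simps)
      have c: "cis (pi * of_int (n - (p - q)) - pi * ((P - x) * of_int b - (Q - y) * of_int a)) * (cis (pi * of_int (p - q)) * cis (pi * \<beta> * (P * y - Q * x)))
         = cis (pi * of_int n - pi * (P * of_int b - Q * of_int a)) * cis (pi * \<beta> * (V1 * y - V2 * x))"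
        unfolding cis_mult by (rule arg_cong[of _ _ cis]) (use \<beta> in \<open>simp add: V1_def V2_def field_simps\<close>)
      have e: "exp (- pi * \<beta> / 2 * ((V1 - x)\<^sup>2 + (V2 - y)\<^sup>2)) * exp (- pi * \<beta> / 2 * (x\<^sup>2 + y\<^sup>2)) =
         exp (- pi * \<beta> / 4 * (V1\<^sup>2 + V2\<^sup>2)) * exp (- pi * \<beta> * ((x - V1 / 2)\<^sup>2 + (y - V2 / 2)\<^sup>2))"
        unfolding exp_add[symmetric] by (rule arg_cong[of _ _ exp]) (simp add: power2_eq_square field_simps)
      have rearr: "(B * A1 * of_real E1) * (B * A2 * of_real E2) * A3 = B * (B * ((A1 * (A2 * A3)) * of_real (E1 * E2)))" for B A1 A2 A3 :: complex and E1 E2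
        by simp
      show ?thesis unfolding F_def 1 2 3 rearr c e K_def x_def[symmetric] y_def[symmetric] by (simp add: mult_ac)
    qed
    have R: "gram \<beta> i (a', b') * dualc \<beta> w (a', b') * gabor \<beta> (i + 1) (w + (a', b')) z =
       K * (of_real (exp (- pi / \<beta> * ((of_int a' - \<beta> * V1 / 2)\<^sup>2 + (of_int b' - \<beta> * V2 / 2)\<^sup>2)))
      * cis (pi * (of_int a' - of_int b') + pi * (of_int b' * V1 - of_int a' * V2)))" for a' b'
    proof -
      have g: "gabor \<beta> (i + 1) (w + (a', b')) z = of_real \<beta> * cis (pi * of_int n - pi * (P * of_int (b + b') - Q * of_int (a + a')))
         * of_real (exp (- pi * \<beta> / 2 * ((V1 - of_int a' / \<beta>)\<^sup>2 + (V2 - of_int b' / \<beta>)\<^sup>2)))"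
        using True by (simp add: gabor_def w z P_def Q_def V1_def V2_def add_divide_distrib diff_diff_eq)
      (* the parity of \<open>m + n\<close> turns \<open>2 (P b' - Q a')\<close> into a multiple of \<open>a' + b'\<close> modulo 2 *)
      have ev: "even ((m + n) * b' - (m - n) * a' + (a' - b') - i * (a' + b'))"
      proof -
        have eq: "(m + n) * b' - (m - n) * a' + (a' - b') - i * (a' + b') = (m + n - (i + 1)) * (a' + b') + 2 * (a' - m * a')"
          by (simp add: algebra_simps)
        show ?thesis unfolding eq by (intro dvd_add dvd_mult2[OF True] dvd_triv_left)
      qed
      have c: "cis (pi * of_int (i * (a' + b'))) * (cis (- pi * (of_int a * of_int b' - of_int b * of_int a') / \<beta>) * cis (pi * of_int n - pi * (P * of_int (b + b') - Q * of_int (a + a'))))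
         = cis (pi * of_int n - pi * (P * of_int b - Q * of_int a)) * cis (pi * (of_int a' - of_int b') + pi * (of_int b' * V1 - of_int a' * V2))"
        unfolding cis_pi_even[OF ev, symmetric] cis_mult
        by (rule arg_cong[of _ _ cis]) (use \<beta> in \<open>simp add: V1_def V2_def P_def Q_def field_simps\<close>)
      have e: "exp (- pi * (of_int a' ^ 2 + of_int b' ^ 2) / (2 * \<beta>)) * exp (- pi * \<beta> / 2 * ((V1 - of_int a' / \<beta>)\<^sup>2 + (V2 - of_int b' / \<beta>)\<^sup>2)) =
         exp (- pi * \<beta> / 4 * (V1\<^sup>2 + V2\<^sup>2)) * exp (- pi / \<beta> * ((of_int a' - \<beta> * V1 / 2)\<^sup>2 + (of_int b' - \<beta> * V2 / 2)\<^sup>2))"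
        unfolding exp_add[symmetric] by (rule arg_cong[of _ _ exp]) (use \<beta> in \<open>simp add: power2_eq_square field_simps\<close>)
      have rearr: "(A1 * of_real E1) * A2 * (B * A3 * of_real E2) = B * ((A1 * (A2 * A3)) * of_real (E1 * E2))" for B A1 A2 A3 :: complex and E1 E2
        by simp
      have gd: "gram \<beta> i (a', b') = cis (pi * of_int (i * (a' + b'))) * of_real (exp (- pi * (of_int a' ^ 2 + of_int b' ^ 2) / (2 * \<beta>)))"
        "dualc \<beta> w (a', b') = cis (- pi * (of_int a * of_int b' - of_int b * of_int a') / \<beta>)"
        by (simp_all add: gram_def dualc_def w)
      show ?thesis unfolding gd g rearr c e K_def by (simp add: mult_ac)
    qed
    have "tconv (rotc (\<beta> / 2)) (gabor \<beta> i w) (gabor \<beta> 1 (0, 0)) z = (\<Sum>\<^sub>\<infinity>u. F u)"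
      unfolding tconv_def F_def
      using infsum_reindex_bij_betw[OF bij_diff_swap[of z], of "\<lambda>u. gabor \<beta> i w u * gabor \<beta> 1 (0, 0) (z - u) * rotc (\<beta> / 2) u (z - u)"]
      by simp
    also have "\<dots> = (\<Sum>\<^sub>\<infinity>(p, q). F (p + q + 1, p - q))"
      by (rule infsum_parity_coset) (auto simp: F_def gabor_def)
    also have "\<dots> = K * (of_real \<beta> * (\<Sum>\<^sub>\<infinity>(p::int, q::int). of_real (exp (- pi * \<beta> * ((of_int p + 1 / 2 - V1 / 2)\<^sup>2 + (of_int q + 1 / 2 - V2 / 2)\<^sup>2)))
      * cis (pi * \<beta> * (V1 * (of_int q + 1 / 2) - V2 * (of_int p + 1 / 2)))))"
      unfolding F by (subst mult.assoc[symmetric], subst infsum_cmult_right'[symmetric]) (simp add: case_prod_unfold mult_ac)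
    also have "\<dots> = (\<Sum>\<^sub>\<infinity>w'. gram \<beta> i w' * dualc \<beta> w w' * gabor \<beta> (i + 1) (w + w') z)"
      unfolding gabor_tconv_core[OF \<beta>] by (subst infsum_cmult_right'[symmetric]) (intro infsum_cong, clarify, simp only: R prod.case)
    finally show ?thesis .
  qed
qed

section \<open>Series of Gaussian translates and their products\<close>

text \<open>
  With \<open>F\<close> the synthesis map of the two families together and \<open>J\<close> the sign that distinguishes them,
  this is the coefficient function of \<open>F k F\<^sup>*\<close> for even \<open>i\<close> and of \<open>F k J F\<^sup>*\<close> for odd \<open>i\<close>.
\<close>

definition gabor_sum :: "real \<Rightarrow> int \<Rightarrow> (int \<times> int \<Rightarrow> complex) \<Rightarrow> int \<times> int \<Rightarrow> complex" where
  "gabor_sum \<beta> i k z = (\<Sum>\<^sub>\<infinity>w. k w * gabor \<beta> i w z)"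

lemma gabor_sum_kernel:
  assumes \<beta>: "\<beta> > 0" and k: "l1 k"
  shows "(\<lambda>(w, z). norm (k w * gabor \<beta> i w z)) summable_on UNIV \<times> UNIV"
    and "(\<Sum>\<^sub>\<infinity>w. \<Sum>\<^sub>\<infinity>z. norm (k w * gabor \<beta> i w z)) \<le> gabor_bound \<beta> * l1norm k"
    and "(\<lambda>w. norm (k w * gabor \<beta> i w z)) summable_on UNIV"
proof -
  have 2: "(\<Sum>\<^sub>\<infinity>z. norm (k w * gabor \<beta> i w z)) = norm (k w) * l1norm (gabor \<beta> i w)" for w
    by (simp add: norm_mult infsum_cmult_right' l1norm_def)
  have 1: "(\<lambda>z. norm (k w * gabor \<beta> i w z)) summable_on UNIV" for w
    unfolding norm_mult by (intro summable_on_cmult_right gabor_l1(1) \<beta>)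
  have le: "norm (k w) * l1norm (gabor \<beta> i w) \<le> norm (k w) * gabor_bound \<beta>" for w
    by (intro mult_left_mono gabor_l1(2)[OF \<beta>]) auto
  have kb: "(\<lambda>w. norm (k w) * gabor_bound \<beta>) summable_on UNIV"
    using k by (rule summable_on_cmult_left)
  have s: "(\<lambda>w. norm (k w) * l1norm (gabor \<beta> i w)) summable_on UNIV"
    by (rule summable_on_comparison_test[OF kb]) (auto simp: le l1norm_nonneg)
  then have "(\<lambda>w. \<bar>\<Sum>\<^sub>\<infinity>z. norm (k w * gabor \<beta> i w z)\<bar>) summable_on UNIV"
    unfolding 2 by (simp add: l1norm_nonneg)
  with 1 show k1: "(\<lambda>(w, z). norm (k w * gabor \<beta> i w z)) summable_on UNIV \<times> UNIV"
    using Infinite_Sum.abs_summable_on_Sigma_iff[of "\<lambda>(w, z). k w * gabor \<beta> i w z" UNIV "\<lambda>_. UNIV"]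
    by (simp add: case_prod_unfold)
  have "(\<Sum>\<^sub>\<infinity>w. \<Sum>\<^sub>\<infinity>z. norm (k w * gabor \<beta> i w z)) \<le> (\<Sum>\<^sub>\<infinity>w. norm (k w) * gabor_bound \<beta>)"
    unfolding 2 by (intro infsum_mono s kb le)
  then show "(\<Sum>\<^sub>\<infinity>w. \<Sum>\<^sub>\<infinity>z. norm (k w * gabor \<beta> i w z)) \<le> gabor_bound \<beta> * l1norm k"
    unfolding mult.commute[of "gabor_bound \<beta>"] by (simp add: infsum_cmult_left' l1norm_def)
  have "(\<lambda>w. norm (k w) * \<beta>) summable_on UNIV" using k by (rule summable_on_cmult_left)
  then show "(\<lambda>w. norm (k w * gabor \<beta> i w z)) summable_on UNIV"
    by (rule summable_on_comparison_test) (auto simp: norm_mult intro!: mult_left_mono norm_gabor_le[OF \<beta>])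
qed

lemma l1_gabor_sum:
  assumes \<beta>: "\<beta> > 0" and k: "l1 k"
  shows "l1 (gabor_sum \<beta> i k)" and "l1norm (gabor_sum \<beta> i k) \<le> gabor_bound \<beta> * l1norm k"
proof -
  define f where "f w z = norm (k w * gabor \<beta> i w z)" for w z
  note K = gabor_sum_kernel[OF \<beta> k, of i, folded f_def]
  have s': "(\<lambda>(z, w). f w z) summable_on UNIV \<times> UNIV"
    by (subst summable_on_swap) (use K(1) in \<open>simp add: case_prod_unfold\<close>)
  have F: "(\<lambda>z. \<Sum>\<^sub>\<infinity>w. f w z) summable_on UNIV"
    using summable_on_Sigma_banach[OF s'] by simp
  have le: "norm (gabor_sum \<beta> i k z) \<le> (\<Sum>\<^sub>\<infinity>w. f w z)" for z
    unfolding gabor_sum_def f_def by (intro norm_infsum_bound gabor_sum_kernel(3)[OF \<beta> k])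
  show l: "l1 (gabor_sum \<beta> i k)"
    by (rule summable_on_comparison_test[OF F]) (use le in auto)
  have "l1norm (gabor_sum \<beta> i k) \<le> (\<Sum>\<^sub>\<infinity>z. \<Sum>\<^sub>\<infinity>w. f w z)"
    unfolding l1norm_def by (intro infsum_mono l F) (use le in auto)
  also have "\<dots> = (\<Sum>\<^sub>\<infinity>w. \<Sum>\<^sub>\<infinity>z. f w z)" by (rule infsum_swap_banach[OF s'])
  finally show "l1norm (gabor_sum \<beta> i k) \<le> gabor_bound \<beta> * l1norm k" using K(2) by simp
qed

lemma gabor_sum_diff:
  assumes \<beta>: "\<beta> > 0" and k: "l1 k" "l1 l"
  shows "gabor_sum \<beta> i (\<lambda>w. k w - l w) z = gabor_sum \<beta> i k z - gabor_sum \<beta> i l z"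
proof -
  have "(\<lambda>w. k w * gabor \<beta> i w z) summable_on UNIV" "(\<lambda>w. l w * gabor \<beta> i w z) summable_on UNIV"
    using abs_summable_summable[OF gabor_sum_kernel(3)[OF \<beta> k(1)]]
      abs_summable_summable[OF gabor_sum_kernel(3)[OF \<beta> k(2)]] by blast+
  then show ?thesis unfolding gabor_sum_def left_diff_distrib
    using infsum_add[of "\<lambda>w. k w * gabor \<beta> i w z" UNIV "\<lambda>w. - (l w * gabor \<beta> i w z)"]
    by (simp add: infsum_uminus summable_on_uminus)
qed

lemma gram_l1:
  assumes \<beta>: "\<beta> > 0"
  shows "l1 (gram \<beta> i)" and "l1norm (gram \<beta> i) = (\<Sum>\<^sub>\<infinity>a::int. exp (- (pi / (2 * \<beta>)) * (of_int a)\<^sup>2))\<^sup>2"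
proof -
  define f where "f a = complex_of_real (exp (- (pi / (2 * \<beta>)) * (of_int a)\<^sup>2))" for a :: int
  have fl: "l1 f" using l1_gauss_row(1)[of "pi / (2 * \<beta>)" "\<lambda>_. 0" 0] \<beta> by (simp add: f_def[abs_def])
  have eq: "norm (gram \<beta> i x) = norm ((\<lambda>(p, q). f p * f q) x)" for x
  proof -
    have "exp (- pi * (s + t) / (2 * \<beta>)) = exp (- (pi / (2 * \<beta>)) * s) * exp (- (pi / (2 * \<beta>)) * t)" for s t
      unfolding exp_add[symmetric] by (rule arg_cong[of _ _ exp]) (use \<beta> in \<open>simp add: field_simps\<close>)
    then show ?thesis by (cases x) (simp add: gram_def f_def norm_mult)
  qed
  show "l1 (gram \<beta> i)" unfolding eq by (rule l1_product(1)[OF fl fl])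
  have "l1norm (gram \<beta> i) = l1norm (\<lambda>(p, q). f p * f q)" unfolding l1norm_def eq ..
  also have "\<dots> = l1norm f * l1norm f" by (rule l1_product(2)[OF fl fl])
  also have "l1norm f = (\<Sum>\<^sub>\<infinity>a::int. exp (- (pi / (2 * \<beta>)) * (of_int a)\<^sup>2))"
    unfolding l1norm_def f_def by simp
  finally show "l1norm (gram \<beta> i) = (\<Sum>\<^sub>\<infinity>a::int. exp (- (pi / (2 * \<beta>)) * (of_int a)\<^sup>2))\<^sup>2"
    by (simp add: power2_eq_square)
qed

lemma summable_on_mult_bounded:
  fixes f b :: "'i \<Rightarrow> complex"
  assumes "(\<lambda>x. norm (f x)) summable_on A" and "\<And>x. norm (b x) \<le> B"
  shows "(\<lambda>x. f x * b x) summable_on A"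
proof (rule abs_summable_summable)
  show "(\<lambda>x. norm (f x * b x)) summable_on A"
    by (rule summable_on_comparison_test[OF summable_on_cmult_left[OF assms(1), of B]])
       (auto simp: norm_mult intro!: mult_left_mono assms(2))
qed

text \<open>
  Multiplication by the difference \<open>F J F\<^sup>*\<close> of the frame operators inserts the Gram function, since
  \<open>F\<^sup>* F\<close> is the Gram matrix.
\<close>

lemma gabor_sum_tconv:
  assumes \<beta>: "\<beta> > 0" and k: "l1 k"
  shows "tconv (rotc (\<beta> / 2)) (gabor_sum \<beta> i k) (gabor \<beta> 1 (0, 0)) z =
    gabor_sum \<beta> (i + 1) (tconv (dualc \<beta>) k (gram \<beta> i)) z"
proof -
  let ?d = "gabor \<beta> 1 (0, 0)" and ?c = "rotc (\<beta> / 2)"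
  have s1: "(\<lambda>(u, w). k w * gabor \<beta> i w u * (?d (z - u) * ?c u (z - u))) summable_on UNIV \<times> UNIV"
  proof -
    have "(\<lambda>(u, w). norm (k w * gabor \<beta> i w u)) summable_on UNIV \<times> UNIV"
      by (subst summable_on_swap) (use gabor_sum_kernel(1)[OF \<beta> k, of i] in \<open>simp add: case_prod_unfold\<close>)
    then have "(\<lambda>x. norm (k (snd x) * gabor \<beta> i (snd x) (fst x))) summable_on UNIV \<times> UNIV"
      by (simp add: case_prod_unfold)
    from summable_on_mult_bounded[OF this, of "\<lambda>x. ?d (z - fst x) * ?c (fst x) (z - fst x)" \<beta>]
    show ?thesis by (simp add: case_prod_unfold norm_mult norm_gabor_le[OF \<beta>])
  qed
  have s2: "(\<lambda>(w, v). k w * gram \<beta> i (v - w) * dualc \<beta> w (v - w) * gabor \<beta> (i + 1) v z) summable_on UNIV \<times> UNIV"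
  proof -
    have "(\<lambda>x. norm (k (fst x) * gram \<beta> i (snd x - fst x) * dualc \<beta> (fst x) (snd x - fst x))) summable_on UNIV \<times> UNIV"
      using tconv_kernel_summable(1)[of k "gram \<beta> i" "dualc \<beta>", OF k gram_l1(1)[OF \<beta>]]
      by (simp add: case_prod_unfold)
    from summable_on_mult_bounded[OF this, of "\<lambda>x. gabor \<beta> (i + 1) (snd x) z" \<beta>]
    show ?thesis by (simp add: case_prod_unfold norm_gabor_le[OF \<beta>])
  qed
  have "tconv ?c (gabor_sum \<beta> i k) ?d z = (\<Sum>\<^sub>\<infinity>u. \<Sum>\<^sub>\<infinity>w. k w * gabor \<beta> i w u * (?d (z - u) * ?c u (z - u)))"
    unfolding tconv_def gabor_sum_def
    by (rule infsum_cong) (subst mult.assoc, rule infsum_cmult_left'[symmetric])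
  also have "\<dots> = (\<Sum>\<^sub>\<infinity>w. \<Sum>\<^sub>\<infinity>u. k w * gabor \<beta> i w u * (?d (z - u) * ?c u (z - u)))"
    by (rule infsum_swap_banach[OF s1])
  also have "\<dots> = (\<Sum>\<^sub>\<infinity>w. k w * tconv ?c (gabor \<beta> i w) ?d z)"
    unfolding tconv_def
    by (intro infsum_cong) (subst infsum_cmult_right'[symmetric], intro infsum_cong, simp only: mult.assoc)
  also have "\<dots> = (\<Sum>\<^sub>\<infinity>w. \<Sum>\<^sub>\<infinity>v. k w * gram \<beta> i (v - w) * dualc \<beta> w (v - w) * gabor \<beta> (i + 1) v z)"
  proof (rule infsum_cong)
    fix w
    have "k w * tconv ?c (gabor \<beta> i w) ?d z = (\<Sum>\<^sub>\<infinity>w'. k w * (gram \<beta> i w' * dualc \<beta> w w' * gabor \<beta> (i + 1) (w + w') z))"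
      unfolding gabor_tconv[OF \<beta>] by (rule infsum_cmult_right'[symmetric])
    also have "\<dots> = (\<Sum>\<^sub>\<infinity>v. k w * (gram \<beta> i (v - w) * dualc \<beta> w (v - w) * gabor \<beta> (i + 1) v z))"
      using infsum_reindex_bij_betw[OF bij_diff[of w], of "\<lambda>w'. k w * (gram \<beta> i w' * dualc \<beta> w w' * gabor \<beta> (i + 1) (w + w') z)"]
      by simp
    finally show "k w * tconv ?c (gabor \<beta> i w) ?d z =
      (\<Sum>\<^sub>\<infinity>v. k w * gram \<beta> i (v - w) * dualc \<beta> w (v - w) * gabor \<beta> (i + 1) v z)" by (simp only: mult.assoc)
  qed
  also have "\<dots> = (\<Sum>\<^sub>\<infinity>v. \<Sum>\<^sub>\<infinity>w. k w * gram \<beta> i (v - w) * dualc \<beta> w (v - w) * gabor \<beta> (i + 1) v z)"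
    by (rule infsum_swap_banach[OF s2])
  also have "\<dots> = gabor_sum \<beta> (i + 1) (tconv (dualc \<beta>) k (gram \<beta> i)) z"
    unfolding gabor_sum_def tconv_def by (rule infsum_cong) (rule infsum_cmult_left')
  finally show ?thesis .
qed

section \<open>Decay of the powers on the adjoint lattice\<close>

definition l1delta :: "'g::zero \<Rightarrow> complex" where
  "l1delta x = (if x = 0 then 1 else 0)"

lemma l1_l1delta: "l1 (l1delta :: 'g::zero \<Rightarrow> complex)"
  and l1norm_l1delta: "l1norm (l1delta :: 'g \<Rightarrow> complex) = 1"
proof -
  have "((\<lambda>x::'g. norm (l1delta x)) has_sum 1) UNIV"
    by (rule has_sum_finite_neutralI[of "{0}"]) (auto simp: l1delta_def)
  then show "l1 (l1delta :: 'g \<Rightarrow> _)" "l1norm (l1delta :: 'g \<Rightarrow> _) = 1"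
    by (auto simp: l1norm_def infsumI has_sum_imp_summable)
qed

lemma tconv_l1delta_right:
  fixes a :: "'g::ab_group_add \<Rightarrow> complex"
  assumes "c v 0 = 1"
  shows "tconv c a l1delta v = a v"
proof -
  have "((\<lambda>w. a w * l1delta (v - w) * c w (v - w)) has_sum a v) UNIV"
    by (rule has_sum_finite_neutralI[of "{v}"]) (auto simp: l1delta_def assms)
  then show ?thesis unfolding tconv_def by (rule infsumI)
qed

lemma l1norm_diff_l1delta:
  fixes g :: "'g::zero \<Rightarrow> complex"
  assumes g: "l1 g" and "g 0 = 1"
  shows "l1norm (\<lambda>x. g x - l1delta x) = l1norm g - 1"
proof -
  have "norm (g x - l1delta x) = norm (g x) - norm (l1delta x :: complex)" for x
    using assms by (auto simp: l1delta_def)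
  moreover have "((\<lambda>x. norm (g x)) has_sum l1norm g) UNIV"
    using g by (simp add: l1norm_def)
  moreover have "((\<lambda>x. - norm (l1delta x :: complex)) has_sum - 1) (UNIV :: 'g set)"
    using has_sum_infsum[OF l1_l1delta[where 'g = 'g]] l1norm_l1delta[where 'g = 'g]
    by (simp add: has_sum_uminus l1norm_def)
  ultimately have "((\<lambda>x. norm (g x - l1delta x)) has_sum (l1norm g - 1)) UNIV"
    using has_sum_add[of "\<lambda>x. norm (g x)" UNIV "l1norm g" "\<lambda>x. - norm (l1delta x :: complex)" "- 1"] by simp
  then show ?thesis unfolding l1norm_def[of "\<lambda>x. g x - l1delta x"] by (rule infsumI)
qed

lemma gabor_parity: "even (i - j) \<Longrightarrow> gabor \<beta> i = gabor \<beta> j"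
  by (auto simp: gabor_def fun_eq_iff)

text \<open>
  The function \<open>k\<close> on the adjoint lattice that represents \<open>d (1 - d\<^sup>2)\<^sup>n\<close> as \<open>F k J F\<^sup>*\<close>.
\<close>

primrec dual_iter :: "real \<Rightarrow> nat \<Rightarrow> int \<times> int \<Rightarrow> complex" where
  "dual_iter \<beta> 0 = l1delta"
| "dual_iter \<beta> (Suc n) = (\<lambda>w. dual_iter \<beta> n w
     - tconv (dualc \<beta>) (tconv (dualc \<beta>) (dual_iter \<beta> n) (gram \<beta> 1)) (gram \<beta> 0) w)"

lemma gram_0 [simp]: "gram \<beta> i 0 = 1"
  by (simp add: gram_def zero_prod_def)

lemma dualc_0 [simp]: "dualc \<beta> w 0 = 1"
  by (simp add: dualc_def zero_prod_def case_prod_unfold)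

lemma l1norm_gram_eq: "\<beta> > 0 \<Longrightarrow> l1norm (gram \<beta> i) = l1norm (gram \<beta> 0)"
  by (simp add: gram_l1(2))

lemma l1_dual_iter: "\<beta> > 0 \<Longrightarrow> l1 (dual_iter \<beta> n)"
proof (induction n)
  case (Suc n)
  then show ?case unfolding dual_iter.simps
    by (intro l1_diff l1_tconv gram_l1 norm_dualc) auto
qed (simp add: l1_l1delta)

lemma tconv_near_identity:
  assumes \<beta>: "\<beta> > 0" and k: "l1 k"
  shows "l1norm (\<lambda>w. tconv (dualc \<beta>) k (gram \<beta> i) w - k w) \<le> l1norm k * (l1norm (gram \<beta> 0) - 1)"
proof -
  let ?r = "\<lambda>x. gram \<beta> i x - l1delta x"
  have r: "l1 ?r" by (intro l1_diff gram_l1 \<beta> l1_l1delta)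
  have "tconv (dualc \<beta>) k ?r v + tconv (dualc \<beta>) k l1delta v = tconv (dualc \<beta>) k (gram \<beta> i) v" for v
    using tconv_add_right[OF k r l1_l1delta, of "dualc \<beta>" v] by simp
  then have "tconv (dualc \<beta>) k (gram \<beta> i) v - k v = tconv (dualc \<beta>) k ?r v" for v
    by (simp add: tconv_l1delta_right algebra_simps)
  then have "l1norm (\<lambda>w. tconv (dualc \<beta>) k (gram \<beta> i) w - k w) = l1norm (tconv (dualc \<beta>) k ?r)" by simp
  also have "\<dots> \<le> l1norm k * l1norm ?r" by (rule l1_tconv(2)[OF k r]) simp
  also have "l1norm ?r = l1norm (gram \<beta> 0) - 1"
    using l1norm_diff_l1delta[OF gram_l1(1)[OF \<beta>, of i]] l1norm_gram_eq[OF \<beta>, of i] by simp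
  finally show ?thesis .
qed

text \<open>
  Convolution with a Gram function differs from the identity by convolution with its values off the
  origin, of norm \<open>l1norm (gram \<beta> 0) - 1\<close>. Two such convolutions therefore differ from the identity by
  at most \<open>(l1norm (gram \<beta> 0))\<^sup>2 - 1\<close>.
\<close>

lemma dual_iter_norm:
  assumes \<beta>: "\<beta> > 0"
  shows "l1norm (dual_iter \<beta> n) \<le> ((l1norm (gram \<beta> 0))\<^sup>2 - 1) ^ n"
proof (induction n)
  case (Suc n)
  define k where "k = dual_iter \<beta> n"
  define G where "G = l1norm (gram \<beta> 0)"
  let ?c = "dualc \<beta>"
  define l where "l = tconv ?c k (gram \<beta> 1)"
  have k: "l1 k" unfolding k_def by (rule l1_dual_iter[OF \<beta>])
  have l: "l1 l" and ln: "l1norm l \<le> l1norm k * G"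
    using l1_tconv[OF k gram_l1(1)[OF \<beta>, of 1], of ?c] l1norm_gram_eq[OF \<beta>, of 1] by (auto simp: l_def G_def)
  have lk: "l1 (\<lambda>w. - 1 * (l w - k w))" "l1 (\<lambda>w. - 1 * (tconv ?c l (gram \<beta> 0) w - l w))"
    using l1_tconv(1)[OF l gram_l1(1)[OF \<beta>, of 0], of ?c] by (intro l1_cmult l1_diff k l; simp)+
  have G: "G \<ge> 1"
    using l1norm_diff_l1delta[OF gram_l1(1)[OF \<beta>, of 0]] l1norm_nonneg[of "\<lambda>x. gram \<beta> 0 x - l1delta x"]
    by (simp add: G_def)
  have neg: "l1norm (\<lambda>w. - 1 * f w) = l1norm f" for f :: "int \<times> int \<Rightarrow> complex"
    by (simp add: l1norm_def)
  have "dual_iter \<beta> (Suc n) = (\<lambda>w. - 1 * (l w - k w) + - 1 * (tconv ?c l (gram \<beta> 0) w - l w))"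
    by (simp add: l_def k_def fun_eq_iff)
  then have "l1norm (dual_iter \<beta> (Suc n)) \<le> l1norm (\<lambda>w. - 1 * (l w - k w)) + l1norm (\<lambda>w. - 1 * (tconv ?c l (gram \<beta> 0) w - l w))"
    using l1norm_triangle[OF lk] by (simp only:)
  also have "\<dots> \<le> l1norm k * (G - 1) + l1norm l * (G - 1)"
    unfolding neg G_def
    using tconv_near_identity[OF \<beta> k, of 1] tconv_near_identity[OF \<beta> l, of 0] by (simp add: l_def)
  also have "\<dots> \<le> l1norm k * (G - 1) + l1norm k * G * (G - 1)"
    using G by (intro add_left_mono mult_right_mono ln) auto
  also have "\<dots> = l1norm k * (G\<^sup>2 - 1)" by (simp add: power2_eq_square algebra_simps)
  also have "\<dots> \<le> (G\<^sup>2 - 1) ^ n * (G\<^sup>2 - 1)"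
    using Suc.IH G by (intro mult_right_mono) (auto simp: k_def G_def)
  finally show ?case by (simp add: G_def mult.commute)
qed (simp add: l1norm_l1delta)

text \<open>
  The norm of the Gram function is the square of the theta series in \<open>q = exp (- pi / (2 * \<beta>))\<close>, which
  is bounded by a geometric series. This is where the bound on \<open>\<theta>\<close> enters: \<open>0.469 = 2 * 0.2345\<close>.
\<close>

lemma gram_norm_bound:
  assumes \<beta>: "0 < \<beta>" "\<beta> \<le> 0.469"
  shows "(l1norm (gram \<beta> 0))\<^sup>2 - 1 \<le> 0.33"
proof -
  define q where "q = exp (- (pi / (2 * \<beta>)))"
  define T where "T = (\<Sum>\<^sub>\<infinity>a::int. exp (- (pi / (2 * \<beta>)) * (of_int a)\<^sup>2))"
  have "3.34754 \<le> pi / (2 * 0.469)" using pi_approx by simp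
  also have "\<dots> \<le> pi / (2 * \<beta>)" using \<beta> by (intro divide_left_mono) auto
  finally have "exp 3.34754 \<le> exp (pi / (2 * \<beta>))" by simp
  moreover have "28.25 \<le> exp (3.34754 :: real)"
  proof -
    (* the exponent is split into 64 parts, small enough for the quadratic Taylor polynomial *)
    have "(28.25 :: real) \<le> (1 + 0.0523 + 0.0523\<^sup>2 / 2) ^ 64" by (simp add: power2_eq_square power_divide)
    also have "\<dots> \<le> exp 0.0523 ^ 64"
      using exp_lower_Taylor_quadratic[of "0.0523 :: real"] by (intro power_mono) auto
    also have "\<dots> = exp (64 * 0.0523)" by (simp flip: exp_of_nat_mult)
    also have "\<dots> \<le> exp 3.34754" by simp
    finally show ?thesis .
  qed
  ultimately have "exp (pi / (2 * \<beta>)) \<ge> 28.25" by linarith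
  then have q: "0 < q" "q \<le> 0.0354"
    by (simp_all add: q_def exp_minus field_simps)
  then have q1: "q < 1" by simp
  have geo: "((\<lambda>n::int. q ^ nat \<bar>n\<bar>) has_sum (1 + 2 * (q / (1 - q)))) UNIV"
    by (rule has_sum_geometric_abs) (use q q1 in auto)
  have "exp (- (pi / (2 * \<beta>)) * (of_int a)\<^sup>2) \<le> q ^ nat \<bar>a\<bar>" for a :: int
  proof -
    have "nat \<bar>a\<bar> \<le> nat \<bar>a\<bar> ^ 2" by (cases "nat \<bar>a\<bar>") (auto simp: power2_eq_square)
    moreover have "exp (- (pi / (2 * \<beta>)) * (of_int a)\<^sup>2) = q ^ (nat \<bar>a\<bar> ^ 2)"
      by (simp add: q_def mult.commute flip: exp_of_nat_mult)
    ultimately show ?thesis using q q1 by (simp add: power_decreasing)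
  qed
  then have "T \<le> 1 + 2 * (q / (1 - q))"
    unfolding T_def using geo summable_on_gauss[of "pi / (2 * \<beta>)" 0] \<beta>
    by (subst infsumI[OF geo, symmetric], intro infsum_mono) (auto simp: has_sum_imp_summable)
  also have "q / (1 - q) \<le> 0.0354 / (1 - 0.0354)" using q by (intro frac_le) auto
  finally have T: "T \<le> 1.0735" by simp
  have "T \<ge> 0" unfolding T_def by (intro infsum_nonneg) auto
  then have "(T\<^sup>2)\<^sup>2 \<le> (1.0735\<^sup>2)\<^sup>2" by (intro power_mono T) auto
  also have "\<dots> \<le> 1.33" by (simp add: power2_eq_square)
  finally show ?thesis unfolding gram_l1(2)[OF \<beta>(1)] T_def[symmetric] by simp
qed

lemma gabor_vacuum_star: "cnj (gabor \<beta> 1 (0, 0) (- z)) = gabor \<beta> 1 (0, 0) z"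
proof (cases z)
  case (Pair m n)
  have "even (- m - n - 1) \<longleftrightarrow> even (m + n - 1)" by presburger
  moreover have "((- of_int m - of_int n) / 2)\<^sup>2 = ((of_int m + of_int n) / 2 :: real)\<^sup>2"
    "((- of_int m + of_int n) / 2)\<^sup>2 = ((of_int m - of_int n) / 2 :: real)\<^sup>2"
    by (simp_all add: power2_eq_square field_simps)
  ultimately show ?thesis using Pair by (simp add: gabor_def cis_cnj)
qed

text \<open>
  Rotating \<open>(m, n)\<close> by a right angle changes the sign \<open>(-1)\<^sup>n\<close> to \<open>(-1)\<^sup>m\<close>, its negative when
  \<open>m + n\<close> is odd. Hence the difference of the two frame operators is odd under the Fourier transform.
\<close>

lemma gabor_vacuum_rotate: "gabor \<beta> 1 (0, 0) (n, - m) = - gabor \<beta> 1 (0, 0) (m, n)"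
proof (cases "even (m + n - 1)")
  case True
  then have ev: "even (n + - m - 1)" by presburger
  have "cis (pi * of_int (- m)) = cis (pi * of_int (n + 1))"
    by (rule cis_pi_even) (use True in presburger)
  also have "\<dots> = - cis (pi * of_int n)" by (simp add: distrib_left flip: cis_mult)
  finally have c: "cis (pi * of_int (- m)) = - cis (pi * of_int n)" .
  have s: "((of_int n - of_int (- m)) / 2)\<^sup>2 = ((of_int m + of_int n) / 2 :: real)\<^sup>2"
    "((of_int n + of_int (- m)) / 2)\<^sup>2 = ((of_int m - of_int n) / 2 :: real)\<^sup>2"
    by (simp_all add: power2_eq_square field_simps)
  show ?thesis unfolding gabor_def prod.case if_P[OF True] if_P[OF ev]
    using c s by (simp add: add.commute)
next
  case False
  then have "odd (n + - m - 1)" by presburger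
  with False show ?thesis by (simp add: gabor_def)
qed

text \<open>
  The trace of \<open>F k F\<^sup>*\<close> is \<open>\<beta>\<close> times the trace of \<open>k G\<close> on the adjoint side.
\<close>

lemma gabor_sum_at_0:
  assumes \<beta>: "\<beta> > 0"
  shows "gabor_sum \<beta> 0 k 0 = \<beta> * tconv (dualc \<beta>) k (gram \<beta> 0) 0"
proof -
  have "gabor \<beta> 0 w 0 = of_real \<beta> * (gram \<beta> 0 (0 - w) * dualc \<beta> w (0 - w))" for w
  proof (cases w)
    case (Pair a b)
    have "exp (- pi * \<beta> / 2 * ((0 - of_int a / \<beta>)\<^sup>2 + (0 - of_int b / \<beta>)\<^sup>2)) =
      exp (- pi * ((of_int a)\<^sup>2 + (of_int b)\<^sup>2) / (2 * \<beta>))"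
      by (rule arg_cong[of _ _ exp]) (use \<beta> in \<open>simp add: power2_eq_square field_simps\<close>)
    then show ?thesis using Pair by (simp add: gabor_def gram_def dualc_def zero_prod_def)
  qed
  then show ?thesis
    unfolding gabor_sum_def tconv_def by (subst infsum_cmult_right'[symmetric]) (simp add: mult_ac)
qed

lemma gabor_sum_l1delta: "gabor_sum \<beta> i l1delta = gabor \<beta> i (0, 0)"
proof
  fix z
  have "((\<lambda>w. l1delta w * gabor \<beta> i w z) has_sum gabor \<beta> i (0, 0) z) UNIV"
    by (rule has_sum_finite_neutralI[of "{0}"]) (auto simp: l1delta_def zero_prod_def)
  then show "gabor_sum \<beta> i l1delta z = gabor \<beta> i (0, 0) z" unfolding gabor_sum_def by (rule infsumI)
qed

section \<open>Limits, inverse square roots and *-homomorphisms in C*-algebras\<close>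

context cstar_algebra
begin

lemma smult_closed' [simp, intro]: "x \<in> carrier A \<Longrightarrow> c \<odot> x \<in> carrier A"
  using scalars.smult_closed[of c x] by (simp add: ring_of_type_algebra_def)

lemma smult_add_left: "x \<in> carrier A \<Longrightarrow> (a + b) \<odot> x = a \<odot> x \<oplus> b \<odot> x"
  using scalars.smult_l_distr[of a b x] by (simp add: ring_of_type_algebra_def)

lemma smult_add_right: "x \<in> carrier A \<Longrightarrow> y \<in> carrier A \<Longrightarrow> a \<odot> (x \<oplus> y) = a \<odot> x \<oplus> a \<odot> y"
  using scalars.smult_r_distr[of a x y] by (simp add: ring_of_type_algebra_def)

lemma smult_smult: "x \<in> carrier A \<Longrightarrow> a \<odot> (b \<odot> x) = (a * b) \<odot> x"
  using scalars.smult_assoc1[of a b x] by (simp add: ring_of_type_algebra_def)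

lemma smult_1 [simp]: "x \<in> carrier A \<Longrightarrow> 1 \<odot> x = x"
  using scalars.smult_one[of x] by (simp add: ring_of_type_algebra_def)

lemma smult_0_left [simp]: "x \<in> carrier A \<Longrightarrow> 0 \<odot> x = \<zero>"
  using scalars.smult_l_null[of x] by (simp add: ring_of_type_algebra_def)

lemma smult_0_right [simp]: "c \<odot> \<zero> = \<zero>"
  using scalars.smult_r_null[of c] by (simp add: ring_of_type_algebra_def)

lemma uminus_eq_smult:
  assumes x: "x \<in> carrier A"
  shows "\<ominus> x = (- 1) \<odot> x"
proof (rule minus_equality)
  have "(- 1) \<odot> x \<oplus> x = (- 1 + 1) \<odot> x"
    using x by (subst smult_add_left) auto
  then show "(- 1) \<odot> x \<oplus> x = \<zero>" using x by simp
qed (use x in auto)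

lemma minus_eq_smult: "x \<in> carrier A \<Longrightarrow> y \<in> carrier A \<Longrightarrow> x \<ominus> y = x \<oplus> (- 1) \<odot> y"
  by (simp add: minus_eq uminus_eq_smult)

lemma smult_minus_right: "x \<in> carrier A \<Longrightarrow> y \<in> carrier A \<Longrightarrow> a \<odot> (x \<ominus> y) = a \<odot> x \<ominus> a \<odot> y"
  by (simp add: minus_eq_smult smult_add_right smult_smult)

declare invol_closed [simp, intro] invol_invol [simp]

lemma invol_minus: "x \<in> carrier A \<Longrightarrow> y \<in> carrier A \<Longrightarrow> (x \<ominus> y)\<^sup>\<star> = x\<^sup>\<star> \<ominus> y\<^sup>\<star>"
  by (simp add: minus_eq_smult invol_add invol_smult)

lemma invol_one [simp]: "\<one>\<^sup>\<star> = \<one>"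
proof -
  have "((\<one>\<^sup>\<star>) \<otimes> \<one>)\<^sup>\<star> = \<one>\<^sup>\<star> \<otimes> (\<one>\<^sup>\<star>)\<^sup>\<star>"
    by (rule invol_mult) auto
  then show ?thesis by simp
qed

lemma nrm_zero [simp]: "nrm A \<zero> = 0"
  by (simp add: nrm_eq_0)

lemma nrm_uminus [simp]: "x \<in> carrier A \<Longrightarrow> nrm A (\<ominus> x) = nrm A x"
  by (simp add: uminus_eq_smult nrm_smult)

lemma nrm_minus_le: "x \<in> carrier A \<Longrightarrow> y \<in> carrier A \<Longrightarrow> nrm A (x \<ominus> y) \<le> nrm A x + nrm A y"
  using nrm_triangle[of x "\<ominus> y"] by (simp add: minus_eq)

lemma nrm_minus_commute: "x \<in> carrier A \<Longrightarrow> y \<in> carrier A \<Longrightarrow> nrm A (x \<ominus> y) = nrm A (y \<ominus> x)"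
  using metric.commute[of x y] by (simp add: cstar_dist_def)

lemma nrm_minus_triangle:
  "x \<in> carrier A \<Longrightarrow> y \<in> carrier A \<Longrightarrow> z \<in> carrier A \<Longrightarrow> nrm A (x \<ominus> z) \<le> nrm A (x \<ominus> y) + nrm A (y \<ominus> z)"
  using metric.triangle[of x y z] by (simp add: cstar_dist_def)

lemma nrm_le_minus: "x \<in> carrier A \<Longrightarrow> y \<in> carrier A \<Longrightarrow> nrm A x \<le> nrm A (x \<ominus> y) + nrm A y"
  using nrm_minus_triangle[of x y \<zero>] by (simp add: minus_eq)

lemma nrm_star_le: "x \<in> carrier A \<Longrightarrow> nrm A x \<le> nrm A (x\<^sup>\<star>)"
proof -
  assume x: "x \<in> carrier A"
  have "nrm A x * nrm A x \<le> nrm A (x\<^sup>\<star>) * nrm A x"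
    using cstar_identity[OF x] nrm_mult[of "x\<^sup>\<star>" x] x by (simp add: power2_eq_square)
  then show ?thesis using nrm_nonneg[OF x] nrm_nonneg[of "x\<^sup>\<star>"] x
    by (cases "nrm A x = 0") (simp_all add: mult_le_cancel_right)
qed

lemma nrm_star [simp]: "x \<in> carrier A \<Longrightarrow> nrm A (x\<^sup>\<star>) = nrm A x"
  using nrm_star_le[of x] nrm_star_le[of "x\<^sup>\<star>"] by simp

lemma nrm_one_le: "nrm A \<one> \<le> 1"
proof -
  have "nrm A \<one> = (nrm A \<one>)\<^sup>2" using cstar_identity[of \<one>] by simp
  then show ?thesis using nrm_nonneg[of \<one>]
    by (cases "nrm A \<one> = 0") (auto simp: power2_eq_square)
qed

definition conv_in :: "(nat \<Rightarrow> 'a) \<Rightarrow> 'a \<Rightarrow> bool" where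
  "conv_in f x \<longleftrightarrow> range f \<subseteq> carrier A \<and> x \<in> carrier A \<and> (\<lambda>n. nrm A (f n \<ominus> x)) \<longlonglongrightarrow> 0"

lemma conv_inD: "conv_in f x \<Longrightarrow> f n \<in> carrier A" "conv_in f x \<Longrightarrow> x \<in> carrier A"
  "conv_in f x \<Longrightarrow> (\<lambda>n. nrm A (f n \<ominus> x)) \<longlonglongrightarrow> 0"
  by (auto simp: conv_in_def)

lemma conv_inI:
  assumes "\<And>n. f n \<in> carrier A" "x \<in> carrier A" "\<And>n. nrm A (f n \<ominus> x) \<le> e n" "e \<longlonglongrightarrow> 0"
  shows "conv_in f x"
  unfolding conv_in_def
  using assms tendsto_sandwich[of "\<lambda>_. 0" "\<lambda>n. nrm A (f n \<ominus> x)" sequentially e 0]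
  by (auto simp: nrm_nonneg)

lemma conv_in_unique:
  assumes "conv_in f x" "conv_in f y"
  shows "x = y"
proof -
  note c = conv_inD[OF assms(1)] conv_inD[OF assms(2)]
  have "nrm A (x \<ominus> y) \<le> nrm A (f n \<ominus> x) + nrm A (f n \<ominus> y)" for n
    using nrm_minus_triangle[of x "f n" y] nrm_minus_commute[of x "f n"] c by simp
  moreover have "(\<lambda>n. nrm A (f n \<ominus> x) + nrm A (f n \<ominus> y)) \<longlonglongrightarrow> 0 + 0"
    by (intro tendsto_add c)
  ultimately have "nrm A (x \<ominus> y) \<le> 0 + 0"
    by (intro LIMSEQ_le_const[of "\<lambda>n. nrm A (f n \<ominus> x) + nrm A (f n \<ominus> y)"]) auto
  then show ?thesis using c nrm_nonneg[of "x \<ominus> y"] nrm_eq_0[of "x \<ominus> y"] by simp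
qed

lemma conv_in_const: "x \<in> carrier A \<Longrightarrow> conv_in (\<lambda>_. x) x"
  by (auto simp: conv_in_def minus_eq r_neg)

lemma conv_in_subseq: "conv_in f x \<Longrightarrow> strict_mono r \<Longrightarrow> conv_in (\<lambda>n. f (r n)) x"
  using LIMSEQ_subseq_LIMSEQ[of "\<lambda>n. nrm A (f n \<ominus> x)" 0 r] by (auto simp: conv_in_def o_def)

lemma conv_in_add:
  assumes f: "conv_in f x" and g: "conv_in g y"
  shows "conv_in (\<lambda>n. f n \<oplus> g n) (x \<oplus> y)"
proof (rule conv_inI[where e = "\<lambda>n. nrm A (f n \<ominus> x) + nrm A (g n \<ominus> y)"])
  note c = conv_inD[OF f] conv_inD[OF g]
  show "f n \<oplus> g n \<in> carrier A" "x \<oplus> y \<in> carrier A" for n using c by auto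
  show "(\<lambda>n. nrm A (f n \<ominus> x) + nrm A (g n \<ominus> y)) \<longlonglongrightarrow> 0"
    using tendsto_add[OF c(3) c(6)] by simp
  fix n
  have "f n \<oplus> g n \<ominus> (x \<oplus> y) = (f n \<ominus> x) \<oplus> (g n \<ominus> y)"
    using c by (simp add: minus_eq minus_add a_ac)
  then show "nrm A (f n \<oplus> g n \<ominus> (x \<oplus> y)) \<le> nrm A (f n \<ominus> x) + nrm A (g n \<ominus> y)"
    using nrm_triangle[of "f n \<ominus> x" "g n \<ominus> y"] c by simp
qed

lemma conv_in_smult:
  assumes f: "conv_in f x"
  shows "conv_in (\<lambda>n. c \<odot> f n) (c \<odot> x)"
proof (rule conv_inI[where e = "\<lambda>n. cmod c * nrm A (f n \<ominus> x)"])
  note c = conv_inD[OF f]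
  show "(\<lambda>n. cmod c * nrm A (f n \<ominus> x)) \<longlonglongrightarrow> 0" using tendsto_mult_left[OF c(3), of "cmod c"] by simp
  show "nrm A (c \<odot> f n \<ominus> c \<odot> x) \<le> cmod c * nrm A (f n \<ominus> x)" for n
    using c by (simp add: nrm_smult flip: smult_minus_right)
qed (use conv_inD[OF f] in auto)

lemma conv_in_minus:
  assumes f: "conv_in f x" and g: "conv_in g y"
  shows "conv_in (\<lambda>n. f n \<ominus> g n) (x \<ominus> y)"
  using conv_in_add[OF f conv_in_smult[OF g, of "- 1"]] conv_inD(1,2)[OF f] conv_inD(1,2)[OF g]
  by (simp add: minus_eq_smult)

lemma conv_in_star:
  assumes f: "conv_in f x"
  shows "conv_in (\<lambda>n. (f n)\<^sup>\<star>) (x\<^sup>\<star>)"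
  using conv_inD[OF f] by (auto simp: conv_in_def simp flip: invol_minus)

lemma conv_in_mult_left:
  assumes f: "conv_in f x" and a: "a \<in> carrier A"
  shows "conv_in (\<lambda>n. a \<otimes> f n) (a \<otimes> x)"
proof (rule conv_inI[where e = "\<lambda>n. nrm A a * nrm A (f n \<ominus> x)"])
  note c = conv_inD[OF f]
  show "(\<lambda>n. nrm A a * nrm A (f n \<ominus> x)) \<longlonglongrightarrow> 0" using tendsto_mult_left[OF c(3), of "nrm A a"] by simp
  show "nrm A (a \<otimes> f n \<ominus> a \<otimes> x) \<le> nrm A a * nrm A (f n \<ominus> x)" for n
    using c a nrm_mult[of a "f n \<ominus> x"] by (simp add: minus_eq r_distr r_minus)
qed (use conv_inD[OF f] a in auto)

lemma conv_in_bounded: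
  assumes f: "conv_in f x"
  obtains B where "\<And>n. nrm A (f n) \<le> B" "B \<ge> 0"
proof -
  note c = conv_inD[OF f]
  obtain K where K: "\<And>n. norm (nrm A (f n \<ominus> x)) \<le> K"
    using convergent_imp_Bseq[OF convergentI[OF c(3)]] unfolding Bseq_def by auto
  have "nrm A (f n) \<le> \<bar>K\<bar> + nrm A x" for n
    using nrm_le_minus[of "f n" x] K[of n] c by fastforce
  then show ?thesis using that[of "\<bar>K\<bar> + nrm A x"] nrm_nonneg[of x] c by simp
qed

lemma conv_in_mult:
  assumes f: "conv_in f x" and g: "conv_in g y"
  shows "conv_in (\<lambda>n. f n \<otimes> g n) (x \<otimes> y)"
proof -
  note c = conv_inD[OF f] conv_inD[OF g]
  obtain B where B: "\<And>n. nrm A (f n) \<le> B" "B \<ge> 0" using conv_in_bounded[OF f] by blast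
  show ?thesis
  proof (rule conv_inI[where e = "\<lambda>n. B * nrm A (g n \<ominus> y) + nrm A (f n \<ominus> x) * nrm A y"])
    show "(\<lambda>n. B * nrm A (g n \<ominus> y) + nrm A (f n \<ominus> x) * nrm A y) \<longlonglongrightarrow> 0"
      using tendsto_add[OF tendsto_mult_left[OF c(6), of B] tendsto_mult_right[OF c(3), of "nrm A y"]] by simp
    fix n
    have "f n \<otimes> g n \<ominus> x \<otimes> y = f n \<otimes> (g n \<ominus> y) \<oplus> (f n \<ominus> x) \<otimes> y"
    proof -
      have "f n \<otimes> (g n \<ominus> y) \<oplus> (f n \<ominus> x) \<otimes> y = f n \<otimes> g n \<oplus> (\<ominus> (f n \<otimes> y) \<oplus> (f n \<otimes> y \<oplus> \<ominus> (x \<otimes> y)))"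
        using c by (simp add: minus_eq r_distr l_distr r_minus l_minus a_assoc)
      also have "\<dots> = f n \<otimes> g n \<ominus> x \<otimes> y"
        using c by (simp add: minus_eq r_neg1)
      finally show ?thesis by simp
    qed
    also have "nrm A \<dots> \<le> nrm A (f n) * nrm A (g n \<ominus> y) + nrm A (f n \<ominus> x) * nrm A y"
      using c nrm_triangle[of "f n \<otimes> (g n \<ominus> y)" "(f n \<ominus> x) \<otimes> y"] nrm_mult[of "f n" "g n \<ominus> y"] nrm_mult[of "f n \<ominus> x" y]
      by fastforce
    also have "\<dots> \<le> B * nrm A (g n \<ominus> y) + nrm A (f n \<ominus> x) * nrm A y"
      using c B by (intro add_right_mono mult_right_mono) (auto simp: nrm_nonneg)
    finally show "nrm A (f n \<otimes> g n \<ominus> x \<otimes> y) \<le> B * nrm A (g n \<ominus> y) + nrm A (f n \<ominus> x) * nrm A y" .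
  qed (use c in auto)
qed

lemma conv_in_nrm_le:
  assumes f: "conv_in f x" and "\<And>n. nrm A (f n) \<le> B"
  shows "nrm A x \<le> B"
proof -
  note c = conv_inD[OF f]
  have "nrm A x \<le> nrm A (f n \<ominus> x) + B" for n
    using nrm_le_minus[of x "f n"] nrm_minus_commute[of x "f n"] assms(2)[of n] c by simp
  moreover have "(\<lambda>n. nrm A (f n \<ominus> x) + B) \<longlonglongrightarrow> 0 + B" by (intro tendsto_add c tendsto_const)
  ultimately show ?thesis using LIMSEQ_le_const[of "\<lambda>n. nrm A (f n \<ominus> x) + B" B "nrm A x"] by auto
qed

lemma Cauchy_conv_in:
  assumes f: "\<And>n. f n \<in> carrier A"
    and cau: "\<And>e. e > 0 \<Longrightarrow> \<exists>N. \<forall>m\<ge>N. \<forall>n\<ge>N. nrm A (f m \<ominus> f n) < e"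
  obtains x where "conv_in f x"
proof -
  have "metric.MCauchy f"
    unfolding metric.MCauchy_def using f cau by (auto simp: cstar_dist_def)
  then obtain x where "limitin metric.mtopology f x sequentially"
    using complete unfolding metric.mcomplete_def by blast
  then have x: "x \<in> carrier A" and lim: "\<And>e. e > 0 \<Longrightarrow> \<exists>N. \<forall>n\<ge>N. cstar_dist A (f n) x < e"
    unfolding metric.limit_metric_sequentially by (blast, meson)
  have "(\<lambda>n. nrm A (f n \<ominus> x)) \<longlonglongrightarrow> 0"
    using lim f x by (intro LIMSEQ_I) (auto simp: cstar_dist_def nrm_nonneg)
  then show ?thesis using that f x by (auto simp: conv_in_def)
qed

lemma geometric_conv_in:
  assumes f: "\<And>n. f n \<in> carrier A" and q: "0 \<le> q" "q < 1"
    and step: "\<And>n. nrm A (f (Suc n) \<ominus> f n) \<le> C * q ^ n"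
  obtains x where "conv_in f x" and "\<And>n. nrm A (x \<ominus> f n) \<le> C / (1 - q) * q ^ n"
proof -
  have C: "C \<ge> 0" using step[of 0] nrm_nonneg[of "f 1 \<ominus> f 0"] f by simp
  have bd: "nrm A (f (n + k) \<ominus> f n) \<le> C / (1 - q) * q ^ n" for n k
  proof -
    have "nrm A (f (n + k) \<ominus> f n) \<le> C * q ^ n * (\<Sum>j<k. q ^ j)"
    proof (induction k)
      case 0
      then show ?case using f by (simp add: minus_eq r_neg)
    next
      case (Suc k)
      have "nrm A (f (n + Suc k) \<ominus> f n) \<le> nrm A (f (Suc (n + k)) \<ominus> f (n + k)) + nrm A (f (n + k) \<ominus> f n)"
        using nrm_minus_triangle f by simp
      also have "\<dots> \<le> C * q ^ (n + k) + C * q ^ n * (\<Sum>j<k. q ^ j)"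
        by (intro add_mono step Suc.IH)
      finally show ?case by (simp add: power_add algebra_simps)
    qed
    also have "\<dots> \<le> C * q ^ n * (1 / (1 - q))"
      using C q by (intro mult_left_mono) (auto simp: sum_gp_strict divide_right_mono)
    finally show ?thesis by simp
  qed
  have lim0: "(\<lambda>n. C / (1 - q) * q ^ n) \<longlonglongrightarrow> 0"
    using tendsto_mult_left[OF LIMSEQ_power_zero[of q], of "C / (1 - q)"] q by simp
  obtain x where x: "conv_in f x"
  proof (rule Cauchy_conv_in[OF f])
    fix e :: real assume e: "e > 0"
    obtain N where N: "C / (1 - q) * q ^ N < e / 2"
      using order_tendstoD(2)[OF lim0, of "e / 2"] e by (auto simp: eventually_sequentially)
    have "nrm A (f m \<ominus> f n) < e" if "m \<ge> N" "n \<ge> N" for m n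
    proof -
      have "nrm A (f m \<ominus> f n) \<le> nrm A (f m \<ominus> f N) + nrm A (f N \<ominus> f n)"
        using nrm_minus_triangle f by simp
      also have "\<dots> < e"
        using bd[of N "m - N"] bd[of N "n - N"] N nrm_minus_commute[OF f[of N] f[of n]]
        unfolding le_add_diff_inverse[OF that(1)] le_add_diff_inverse[OF that(2)] by linarith
      finally show ?thesis .
    qed
    then show "\<exists>N. \<forall>m\<ge>N. \<forall>n\<ge>N. nrm A (f m \<ominus> f n) < e" by blast
  qed (use that in blast)
  moreover have "nrm A (x \<ominus> f n) \<le> C / (1 - q) * q ^ n" for n
  proof (rule conv_in_nrm_le)
    show "conv_in (\<lambda>k. f (k + n) \<ominus> f n) (x \<ominus> f n)"
      by (intro conv_in_minus conv_in_const f conv_in_subseq[OF x]) (auto simp: strict_mono_def)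
    show "nrm A (f (k + n) \<ominus> f n) \<le> C / (1 - q) * q ^ n" for k
      using bd[of n k] by (simp add: add.commute)
  qed
  ultimately show ?thesis by (rule that)
qed

text \<open>
  Banach's fixed point theorem on a sequentially closed set, by iteration.
\<close>

lemma contraction_fixpoint:
  assumes T: "\<And>z. z \<in> S \<Longrightarrow> T z \<in> S" and SA: "S \<subseteq> carrier A" and z0: "z0 \<in> S"
    and closed: "\<And>f z. range f \<subseteq> S \<Longrightarrow> conv_in f z \<Longrightarrow> z \<in> S"
    and q: "0 \<le> q" "q < 1"
    and contr: "\<And>z w. z \<in> S \<Longrightarrow> w \<in> S \<Longrightarrow> nrm A (T z \<ominus> T w) \<le> q * nrm A (z \<ominus> w)"
  obtains z where "z \<in> S" "T z = z"
proof -
  define f where "f n = (T ^^ n) z0" for n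
  have fS: "f n \<in> S" for n by (induction n) (auto simp: f_def z0 T)
  then have fA: "f n \<in> carrier A" for n using SA by auto
  have step: "nrm A (f (Suc n) \<ominus> f n) \<le> nrm A (f 1 \<ominus> f 0) * q ^ n" for n
  proof (induction n)
    case (Suc n)
    have "nrm A (f (Suc (Suc n)) \<ominus> f (Suc n)) = nrm A (T (f (Suc n)) \<ominus> T (f n))" by (simp add: f_def)
    also have "\<dots> \<le> q * nrm A (f (Suc n) \<ominus> f n)" by (rule contr[OF fS fS])
    also have "\<dots> \<le> q * (nrm A (f 1 \<ominus> f 0) * q ^ n)" by (rule mult_left_mono[OF Suc.IH q(1)])
    finally show ?case by (simp add: mult_ac)
  qed simp
  obtain z where z: "conv_in f z" using geometric_conv_in[OF fA q step] by blast
  have zS: "z \<in> S" by (rule closed[OF _ z]) (use fS in auto)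
  have "conv_in (\<lambda>n. T (f n)) (T z)"
  proof (rule conv_inI[where e = "\<lambda>n. q * nrm A (f n \<ominus> z)"])
    show "(\<lambda>n. q * nrm A (f n \<ominus> z)) \<longlonglongrightarrow> 0"
      using tendsto_mult_left[OF conv_inD(3)[OF z], of q] by simp
  qed (use T SA fS zS contr in auto)
  moreover have "conv_in (\<lambda>n. T (f n)) z"
    using conv_in_subseq[OF z, of Suc] by (simp add: f_def strict_mono_def)
  ultimately have "T z = z" by (rule conv_in_unique)
  with zS show ?thesis by (rule that)
qed

text \<open>
  The equation \<open>(1 - t) (1 + z)\<^sup>2 = 1\<close> is equivalent to the fixed point equation
  \<open>z = (t (1 + z)\<^sup>2 - z\<^sup>2) / 2\<close>. For \<open>\<parallel>t\<parallel> \<le> 0.33\<close> its right-hand side maps the ball of radius \<open>0.45\<close>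
  into itself, because \<open>(0.33 * 1.45\<^sup>2 + 0.45\<^sup>2) / 2 \<le> 0.45\<close>, and is a contraction there with constant
  \<open>0.33 * 1.45 + 0.45 = 0.9285\<close>. The set \<open>S\<close> lets the caller transfer to \<open>z\<close> any closed
  property that the iteration preserves.
\<close>

lemma inverse_sqrt_exists:
  assumes SA: "S \<subseteq> carrier A" and t: "t \<in> S" "nrm A t \<le> 0.33" and S0: "\<zero> \<in> S"
    and closed: "\<And>f z. range f \<subseteq> S \<Longrightarrow> conv_in f z \<Longrightarrow> z \<in> S"
    and TS: "\<And>z. z \<in> S \<Longrightarrow> (1 / 2) \<odot> (t \<otimes> ((\<one> \<oplus> z) \<otimes> (\<one> \<oplus> z)) \<ominus> z \<otimes> z) \<in> S"
  obtains z where "z \<in> S" "(\<one> \<ominus> t) \<otimes> ((\<one> \<oplus> z) \<otimes> (\<one> \<oplus> z)) = \<one>"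
proof -
  define T where "T z = (1 / 2) \<odot> (t \<otimes> ((\<one> \<oplus> z) \<otimes> (\<one> \<oplus> z)) \<ominus> z \<otimes> z)" for z
  define B where "B = {z \<in> S. nrm A z \<le> 0.45}"
  have tA: "t \<in> carrier A" using t SA by auto
  have one: "nrm A (\<one> \<oplus> z) \<le> 1.45" if "z \<in> B" for z
    using nrm_triangle[of \<one> z] nrm_one_le that SA by (auto simp: B_def)
  have BA: "z \<in> carrier A" if "z \<in> B" for z using that SA by (auto simp: B_def)
  have T_B: "T z \<in> B" if z: "z \<in> B" for z
  proof -
    note zA = BA[OF z]
    have "nrm A ((\<one> \<oplus> z) \<otimes> (\<one> \<oplus> z)) \<le> nrm A (\<one> \<oplus> z) * nrm A (\<one> \<oplus> z)"
      using zA by (intro nrm_mult) auto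
    also have "\<dots> \<le> 1.45 * 1.45" using one[OF z] zA by (intro mult_mono nrm_nonneg) auto
    finally have 1: "nrm A ((\<one> \<oplus> z) \<otimes> (\<one> \<oplus> z)) \<le> 2.1025" by simp
    have "nrm A (t \<otimes> ((\<one> \<oplus> z) \<otimes> (\<one> \<oplus> z))) \<le> nrm A t * nrm A ((\<one> \<oplus> z) \<otimes> (\<one> \<oplus> z))"
      using zA tA by (intro nrm_mult) auto
    also have "\<dots> \<le> 0.33 * 2.1025" using 1 t zA tA by (intro mult_mono nrm_nonneg) auto
    finally have 2: "nrm A (t \<otimes> ((\<one> \<oplus> z) \<otimes> (\<one> \<oplus> z))) \<le> 0.33 * 2.1025" .
    have "nrm A (z \<otimes> z) \<le> nrm A z * nrm A z" using zA by (intro nrm_mult)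
    also have "\<dots> \<le> 0.45 * 0.45" using z zA by (intro mult_mono nrm_nonneg) (auto simp: B_def)
    finally have 3: "nrm A (z \<otimes> z) \<le> 0.45 * 0.45" .
    have "nrm A (T z) \<le> 1 / 2 * (0.33 * 2.1025 + 0.45 * 0.45)"
      unfolding T_def using 2 3 zA tA nrm_minus_le[of "t \<otimes> ((\<one> \<oplus> z) \<otimes> (\<one> \<oplus> z))" "z \<otimes> z"]
      by (simp add: nrm_smult)
    then have "nrm A (T z) \<le> 0.45" by simp
    moreover have "T z \<in> S" unfolding T_def by (rule TS) (use z in \<open>simp add: B_def\<close>)
    ultimately show ?thesis by (simp add: B_def)
  qed
  have sq_diff: "nrm A (x \<otimes> x \<ominus> y \<otimes> y) \<le> (nrm A x + nrm A y) * nrm A (x \<ominus> y)" if x: "x \<in> carrier A" and y: "y \<in> carrier A" for x y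
  proof -
    have "x \<otimes> (x \<ominus> y) \<oplus> (x \<ominus> y) \<otimes> y = x \<otimes> x \<oplus> (\<ominus> (x \<otimes> y) \<oplus> (x \<otimes> y \<oplus> \<ominus> (y \<otimes> y)))"
      using x y by (simp add: minus_eq r_distr l_distr r_minus l_minus a_assoc)
    also have "\<dots> = x \<otimes> x \<ominus> y \<otimes> y" using x y by (simp add: minus_eq r_neg1)
    finally have "nrm A (x \<otimes> x \<ominus> y \<otimes> y) = nrm A (x \<otimes> (x \<ominus> y) \<oplus> (x \<ominus> y) \<otimes> y)" by simp
    also have "\<dots> \<le> nrm A x * nrm A (x \<ominus> y) + nrm A (x \<ominus> y) * nrm A y"
      using x y nrm_triangle[of "x \<otimes> (x \<ominus> y)" "(x \<ominus> y) \<otimes> y"] nrm_mult[of x "x \<ominus> y"] nrm_mult[of "x \<ominus> y" y] by fastforce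
    finally show ?thesis by (simp add: algebra_simps)
  qed
  have contr: "nrm A (T z \<ominus> T w) \<le> 0.9285 * nrm A (z \<ominus> w)" if z: "z \<in> B" and w: "w \<in> B" for z w
  proof -
    note zA = BA[OF z] and wA = BA[OF w]
    define N where "N = nrm A (z \<ominus> w)"
    have N0: "N \<ge> 0" unfolding N_def using zA wA by (intro nrm_nonneg) auto
    let ?p = "(\<one> \<oplus> z) \<otimes> (\<one> \<oplus> z)" and ?q = "(\<one> \<oplus> w) \<otimes> (\<one> \<oplus> w)"
    have "(\<one> \<oplus> z) \<ominus> (\<one> \<oplus> w) = z \<ominus> w"
    proof -
      have "\<one> \<oplus> (\<ominus> w \<oplus> \<ominus> \<one>) = \<ominus> w"
        using wA a_lcomm[of \<one> "\<ominus> w" "\<ominus> \<one>"] by (simp add: r_neg)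
      then show ?thesis using zA wA by (simp add: minus_eq minus_add a_ac)
    qed
    then have "nrm A (?p \<ominus> ?q) \<le> (nrm A (\<one> \<oplus> z) + nrm A (\<one> \<oplus> w)) * N"
      using sq_diff[of "\<one> \<oplus> z" "\<one> \<oplus> w"] zA wA by (simp add: N_def)
    also have "\<dots> \<le> (1.45 + 1.45) * N" using one[OF z] one[OF w] N0 by (intro mult_right_mono) auto
    finally have 1: "nrm A (?p \<ominus> ?q) \<le> 2.9 * N" by simp
    have "nrm A (t \<otimes> (?p \<ominus> ?q)) \<le> nrm A t * nrm A (?p \<ominus> ?q)" using tA zA wA by (intro nrm_mult) auto
    also have "\<dots> \<le> 0.33 * (2.9 * N)" using 1 t tA zA wA by (intro mult_mono nrm_nonneg) auto
    finally have 2: "nrm A (t \<otimes> (?p \<ominus> ?q)) \<le> 0.957 * N" by simp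
    have "nrm A (z \<otimes> z \<ominus> w \<otimes> w) \<le> (nrm A z + nrm A w) * N" unfolding N_def by (rule sq_diff[OF zA wA])
    also have "\<dots> \<le> (0.45 + 0.45) * N" using z w N0 by (intro mult_right_mono) (auto simp: B_def)
    finally have 3: "nrm A (z \<otimes> z \<ominus> w \<otimes> w) \<le> 0.9 * N" by simp
    have "T z \<ominus> T w = (1 / 2) \<odot> (t \<otimes> (?p \<ominus> ?q) \<ominus> (z \<otimes> z \<ominus> w \<otimes> w))"
    proof -
      have "(t \<otimes> ?p \<ominus> z \<otimes> z) \<ominus> (t \<otimes> ?q \<ominus> w \<otimes> w) = t \<otimes> (?p \<ominus> ?q) \<ominus> (z \<otimes> z \<ominus> w \<otimes> w)"
      proof -
        define P Q X' Y' where "P = t \<otimes> ?p" and "Q = t \<otimes> ?q" and "X' = z \<otimes> z" and "Y' = w \<otimes> w"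
        have c: "P \<in> carrier A" "Q \<in> carrier A" "X' \<in> carrier A" "Y' \<in> carrier A"
          using tA zA wA by (auto simp: P_def Q_def X'_def Y'_def)
        have "t \<otimes> (?p \<ominus> ?q) = P \<ominus> Q" using tA zA wA by (simp add: minus_eq r_distr r_minus P_def Q_def)
        moreover have "(P \<ominus> X') \<ominus> (Q \<ominus> Y') = (P \<ominus> Q) \<ominus> (X' \<ominus> Y')"
          using c by (simp add: minus_eq minus_add a_ac)
        ultimately show ?thesis by (simp add: P_def Q_def X'_def Y'_def)
      qed
      then show ?thesis unfolding T_def using tA zA wA by (simp flip: smult_minus_right)
    qed
    then have "nrm A (T z \<ominus> T w) \<le> 1 / 2 * (0.957 * N + 0.9 * N)"
      using 2 3 nrm_minus_le[of "t \<otimes> (?p \<ominus> ?q)" "z \<otimes> z \<ominus> w \<otimes> w"] tA zA wA by (simp add: nrm_smult)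
    then show ?thesis by (simp add: N_def)
  qed
  obtain z where z: "z \<in> B" "T z = z"
  proof (rule contraction_fixpoint[of B T \<zero> "0.9285"])
    show "z \<in> B" if "range f \<subseteq> B" "conv_in f z" for f z
    proof -
      have "z \<in> S" using closed[of f z] that by (auto simp: B_def)
      moreover have "nrm A z \<le> 0.45" by (rule conv_in_nrm_le[OF that(2)]) (use that(1) in \<open>auto simp: B_def\<close>)
      ultimately show ?thesis by (simp add: B_def)
    qed
  qed (use T_B contr BA S0 in \<open>auto simp: B_def\<close>)
  note zA = BA[OF z(1)]
  let ?p = "(\<one> \<oplus> z) \<otimes> (\<one> \<oplus> z)"
  have "z \<oplus> z = 2 \<odot> z" using smult_add_left[of z 1 1] zA by simp
  also have "\<dots> = 2 \<odot> T z" using z by simp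
  also have "\<dots> = t \<otimes> ?p \<ominus> z \<otimes> z" unfolding T_def using zA tA by (simp add: smult_smult)
  finally have zz: "z \<oplus> z = t \<otimes> ?p \<ominus> z \<otimes> z" .
  have "?p = \<one> \<oplus> (z \<oplus> z \<oplus> z \<otimes> z)" using zA by (simp add: l_distr r_distr a_assoc)
  also have "z \<oplus> z \<oplus> z \<otimes> z = t \<otimes> ?p"
    unfolding zz using zA tA by (simp add: minus_eq a_assoc l_neg)
  finally have p: "?p = \<one> \<oplus> t \<otimes> ?p" .
  have "(\<one> \<ominus> t) \<otimes> ?p = ?p \<ominus> t \<otimes> ?p" using zA tA by (simp add: minus_eq l_distr l_minus)
  also have "\<dots> = (\<one> \<oplus> t \<otimes> ?p) \<ominus> t \<otimes> ?p" using p by simp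
  also have "\<dots> = \<one>" using zA tA by (simp add: minus_eq a_assoc r_neg)
  finally show ?thesis using that z(1) by (auto simp: B_def)
qed

lemma selfadjoint_nrm_square:
  "a \<in> carrier A \<Longrightarrow> a\<^sup>\<star> = a \<Longrightarrow> nrm A (a \<otimes> a) = (nrm A a)\<^sup>2"
  using cstar_identity[of a] by simp

lemma selfadjoint_nrm_pow:
  assumes a: "a \<in> carrier A" and sa: "a\<^sup>\<star> = a"
  shows "(a [^] (2 ^ n :: nat))\<^sup>\<star> = a [^] (2 ^ n :: nat) \<and> nrm A (a [^] (2 ^ n :: nat)) = nrm A a ^ (2 ^ n)"
proof (induction n)
  case (Suc n)
  have "a [^] (2 ^ Suc n :: nat) = a [^] (2 ^ n :: nat) \<otimes> a [^] (2 ^ n :: nat)"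
    using a by (simp add: nat_pow_mult mult_2)
  then show ?case
    using Suc.IH a selfadjoint_nrm_square[of "a [^] (2 ^ n :: nat)"]
    by (simp add: invol_mult power_mult[symmetric] power2_eq_square power_add[symmetric] mult_2)
qed (use assms in auto)

text \<open>
  For a self-adjoint element the norm is the spectral radius, because \<open>\<parallel>a\<^sup>k\<parallel> = \<parallel>a\<parallel>\<^sup>k\<close> along the powers
  of two; so a geometric rate for the powers bounds the norm.
\<close>

lemma selfadjoint_nrm_le:
  assumes a: "a \<in> carrier A" and sa: "a\<^sup>\<star> = a" and q: "0 \<le> q"
    and pw: "\<And>n. nrm A (a [^] (n::nat)) \<le> C * q ^ n"
  shows "nrm A a \<le> q"
proof (rule ccontr)
  assume "\<not> nrm A a \<le> q"
  then have qa: "q < nrm A a" by simp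
  have C: "C \<ge> 0" using pw[of 0] nrm_nonneg[of \<one>] a by simp
  define x where "x = q / nrm A a"
  have x: "0 \<le> x" "x < 1" using q qa by (auto simp: x_def)
  have ge: "1 \<le> C * x ^ (2 ^ n)" for n
  proof -
    have "nrm A a ^ (2 ^ n) \<le> C * q ^ (2 ^ n)"
      using pw[of "2 ^ n"] selfadjoint_nrm_pow[OF a sa, of n] by simp
    then show ?thesis using q qa by (simp add: x_def power_divide field_simps)
  qed
  have "(\<lambda>n. x ^ n) \<longlonglongrightarrow> 0" using x by (intro LIMSEQ_power_zero) auto
  from LIMSEQ_subseq_LIMSEQ[OF this, of "\<lambda>n. 2 ^ n"]
  have "(\<lambda>n. x ^ (2 ^ n)) \<longlonglongrightarrow> 0" by (simp add: o_def strict_mono_def)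
  from tendsto_mult_left[OF this, of C] have "(\<lambda>n. C * x ^ (2 ^ n)) \<longlonglongrightarrow> 0" by simp
  from LIMSEQ_le_const[OF this, of 1] ge show False by auto
qed

lemma star_hom_props:
  fixes \<sigma> :: "'a \<Rightarrow> 'a"
  assumes h: "star_hom A A \<sigma>"
  shows "x \<in> carrier A \<Longrightarrow> \<sigma> x \<in> carrier A"
    "x \<in> carrier A \<Longrightarrow> y \<in> carrier A \<Longrightarrow> \<sigma> (x \<oplus> y) = \<sigma> x \<oplus> \<sigma> y"
    "x \<in> carrier A \<Longrightarrow> y \<in> carrier A \<Longrightarrow> \<sigma> (x \<otimes> y) = \<sigma> x \<otimes> \<sigma> y"
    "x \<in> carrier A \<Longrightarrow> \<sigma> (c \<odot> x) = c \<odot> \<sigma> x"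
    "x \<in> carrier A \<Longrightarrow> \<sigma> (x\<^sup>\<star>) = (\<sigma> x)\<^sup>\<star>"
    "\<sigma> \<one> = \<one>"
    "x \<in> carrier A \<Longrightarrow> y \<in> carrier A \<Longrightarrow> \<sigma> (x \<ominus> y) = \<sigma> x \<ominus> \<sigma> y"
proof -
  have r: "\<sigma> \<in> ring_hom A A" using h by (simp add: star_hom_def)
  show cl: "\<And>x. x \<in> carrier A \<Longrightarrow> \<sigma> x \<in> carrier A" and
    ad: "\<And>x y. x \<in> carrier A \<Longrightarrow> y \<in> carrier A \<Longrightarrow> \<sigma> (x \<oplus> y) = \<sigma> x \<oplus> \<sigma> y" and
    "\<And>x y. x \<in> carrier A \<Longrightarrow> y \<in> carrier A \<Longrightarrow> \<sigma> (x \<otimes> y) = \<sigma> x \<otimes> \<sigma> y"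
    "\<sigma> \<one> = \<one>"
    using ring_hom_closed[OF r] ring_hom_add[OF r] ring_hom_mult[OF r] ring_hom_one[OF r] by auto
  show sm: "\<And>c x. x \<in> carrier A \<Longrightarrow> \<sigma> (c \<odot> x) = c \<odot> \<sigma> x"
    and "\<And>x. x \<in> carrier A \<Longrightarrow> \<sigma> (x\<^sup>\<star>) = (\<sigma> x)\<^sup>\<star>"
    using h by (auto simp: star_hom_def)
  show "\<And>x y. x \<in> carrier A \<Longrightarrow> y \<in> carrier A \<Longrightarrow> \<sigma> (x \<ominus> y) = \<sigma> x \<ominus> \<sigma> y"
    by (simp add: minus_eq_smult ad sm cl)
qed

text \<open>
  With \<open>k\<close> a square root of \<open>1 - x\<^sup>2\<close> that commutes with \<open>x\<close>, the element \<open>u = x + \<i> k\<close>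
  satisfies \<open>u\<^sup>* u = 1\<close>. This identity is preserved by \<open>\<sigma>\<close> and bounds the norm of \<open>\<sigma> u\<close>, hence
  of its real part \<open>\<sigma> x\<close>.
\<close>

lemma star_hom_bounded_selfadjoint:
  fixes \<sigma> :: "'a \<Rightarrow> 'a"
  assumes h: "star_hom A A \<sigma>" and x: "x \<in> carrier A" "x\<^sup>\<star> = x" and nx: "nrm A x \<le> 1 / 2"
  shows "nrm A (\<sigma> x) \<le> 1"
proof -
  note H = star_hom_props[OF h]
  define t where "t = x \<otimes> x"
  have tA: "t \<in> carrier A" using x by (simp add: t_def)
  define S where "S = {z \<in> carrier A. z\<^sup>\<star> = z \<and> z \<otimes> x = x \<otimes> z}"
  have SD: "z \<in> carrier A" "z\<^sup>\<star> = z" "z \<otimes> x = x \<otimes> z" if "z \<in> S" for z using that by (auto simp: S_def)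
  have Smult: "y \<otimes> z \<in> S" if "y \<in> S" "z \<in> S" "y \<otimes> z = z \<otimes> y" for y z
  proof -
    note c = SD[OF that(1)] SD[OF that(2)]
    have "y \<otimes> z \<otimes> x = y \<otimes> (x \<otimes> z)" using c x by (simp add: m_assoc)
    also have "\<dots> = x \<otimes> y \<otimes> z" using c x by (simp flip: m_assoc)
    also have "\<dots> = x \<otimes> (y \<otimes> z)" using c x by (simp add: m_assoc)
    finally show ?thesis using c that(3) by (simp add: S_def invol_mult)
  qed
  have Sadd: "y \<oplus> z \<in> S" if "y \<in> S" "z \<in> S" for y z
    using that x by (auto simp: S_def invol_add l_distr r_distr)
  have Ssm: "complex_of_real r \<odot> z \<in> S" if "z \<in> S" for r z
    using that x by (auto simp: S_def invol_smult smult_mult_left smult_mult_right)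
  have Sminus: "y \<ominus> z \<in> S" if "y \<in> S" "z \<in> S" for y z
    using Sadd[OF that(1) Ssm[OF that(2), of "- 1"]] SD(1)[OF that(1)] SD(1)[OF that(2)] by (simp add: minus_eq_smult)
  have xS: "x \<in> S" and S1: "\<one> \<in> S" and S0: "\<zero> \<in> S"
    using x invol_minus[of \<one> \<one>] by (auto simp: S_def minus_eq r_neg)
  have tS: "t \<in> S" unfolding t_def by (rule Smult[OF xS xS]) simp
  have t_comm: "t \<otimes> z = z \<otimes> t" if "z \<in> S" for z
    using SD[OF that] x unfolding t_def by (metis m_assoc)
  obtain z where z: "z \<in> S" and eq: "(\<one> \<ominus> t) \<otimes> ((\<one> \<oplus> z) \<otimes> (\<one> \<oplus> z)) = \<one>"
  proof (rule inverse_sqrt_exists[of S t])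
    have "nrm A t \<le> (1 / 2) * (1 / 2)"
      using nrm_mult[OF x(1) x(1)] mult_mono[OF nx nx] nrm_nonneg[OF x(1)] by (simp add: t_def)
    then show "nrm A t \<le> 0.33" by simp
    show "z \<in> S" if "range f \<subseteq> S" "conv_in f z" for f z
    proof -
      have f: "f n \<in> S" for n using that by auto
      note fc = SD[OF f]
      have "z\<^sup>\<star> = z" using conv_in_unique[OF conv_in_star[OF that(2)]] that(2) by (simp add: fc)
      moreover have "z \<otimes> x = x \<otimes> z"
        using conv_in_unique[OF conv_in_mult[OF that(2) conv_in_const[OF x(1)]]] conv_in_mult_left[OF that(2) x(1)]
        by (simp add: fc)
      ultimately show ?thesis using conv_inD(2)[OF that(2)] by (simp add: S_def)
    qed
    show "(1 / 2) \<odot> (t \<otimes> ((\<one> \<oplus> z) \<otimes> (\<one> \<oplus> z)) \<ominus> z \<otimes> z) \<in> S" if z: "z \<in> S" for z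
    proof -
      have p: "(\<one> \<oplus> z) \<otimes> (\<one> \<oplus> z) \<in> S" by (intro Smult Sadd S1 z) simp
      show ?thesis
        using Ssm[OF Sminus[OF Smult[OF tS p t_comm[OF p]] Smult[OF z z refl]], of "1 / 2"] by simp
    qed
  qed (use tS S0 SD in auto)
  define y where "y = \<one> \<oplus> z"
  have yS: "y \<in> S" unfolding y_def by (intro Sadd S1 z)
  define k where "k = (\<one> \<ominus> t) \<otimes> y"
  note yc = SD[OF yS]
  have yt: "(\<one> \<ominus> t) \<otimes> y = y \<otimes> (\<one> \<ominus> t)"
    using yc tA t_comm[OF yS] by (simp add: minus_eq l_distr r_distr l_minus r_minus)
  have kS: "k \<in> S" unfolding k_def by (intro Smult Sminus S1 tS yS yt)
  note kc = SD[OF kS]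
  have kk: "k \<otimes> k = \<one> \<ominus> t"
  proof -
    have "k \<otimes> k = (\<one> \<ominus> t) \<otimes> (y \<otimes> ((\<one> \<ominus> t) \<otimes> y))"
      unfolding k_def using yc tA by (simp add: m_assoc)
    also have "\<dots> = (\<one> \<ominus> t) \<otimes> ((y \<otimes> (\<one> \<ominus> t)) \<otimes> y)" using yc tA by (simp add: m_assoc)
    also have "\<dots> = (\<one> \<ominus> t) \<otimes> ((\<one> \<ominus> t) \<otimes> (y \<otimes> y))" unfolding yt[symmetric] using yc tA by (simp add: m_assoc)
    also have "\<dots> = \<one> \<ominus> t" using eq tA unfolding y_def[symmetric] by simp
    finally show ?thesis .
  qed
  define u where "u = x \<oplus> \<i> \<odot> k"
  have uA: "u \<in> carrier A" using x kc by (simp add: u_def)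
  have us: "u\<^sup>\<star> = x \<oplus> (- \<i>) \<odot> k" using x kc by (simp add: u_def invol_add invol_smult)
  have "u\<^sup>\<star> \<otimes> u = x \<otimes> x \<oplus> \<i> \<odot> (x \<otimes> k) \<oplus> ((- \<i>) \<odot> (x \<otimes> k) \<oplus> k \<otimes> k)"
    unfolding us unfolding u_def using x kc
    by (simp add: l_distr r_distr smult_mult_left smult_mult_right smult_smult smult_add_right a_ac)
  also have "\<dots> = x \<otimes> x \<oplus> ((\<i> + - \<i>) \<odot> (x \<otimes> k) \<oplus> k \<otimes> k)"
    using x kc by (subst smult_add_left) (auto simp: a_assoc)
  also have "\<dots> = t \<oplus> (\<one> \<ominus> t)" using x kc by (simp add: kk t_def)
  also have "\<dots> = \<one>" using tA a_lcomm[of t \<one> "\<ominus> t"] by (simp add: minus_eq r_neg)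
  finally have uu: "u\<^sup>\<star> \<otimes> u = \<one>" .
  then have "(\<sigma> u)\<^sup>\<star> \<otimes> \<sigma> u = \<one>" using uA by (simp flip: H(3) H(5) add: H(6))
  then have "(nrm A (\<sigma> u))\<^sup>2 \<le> 1" using cstar_identity[of "\<sigma> u"] uA H(1) nrm_one_le by simp
  then have nu: "nrm A (\<sigma> u) \<le> 1" using nrm_nonneg[of "\<sigma> u"] uA H(1) by (simp add: power_le_one_iff)
  have "x = (1 / 2) \<odot> (u \<oplus> u\<^sup>\<star>)"
  proof -
    have "u \<oplus> u\<^sup>\<star> = (x \<oplus> x) \<oplus> (\<i> \<odot> k \<oplus> (- \<i>) \<odot> k)"
      unfolding us unfolding u_def using x kc by (simp add: a_ac)
    also have "\<i> \<odot> k \<oplus> (- \<i>) \<odot> k = (\<i> + - \<i>) \<odot> k" using kc by (subst smult_add_left) auto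
    also have "x \<oplus> x = (1 + 1) \<odot> x" using x by (subst smult_add_left) auto
    finally show ?thesis using x kc by (simp add: smult_smult)
  qed
  then have "\<sigma> x = (1 / 2) \<odot> (\<sigma> u \<oplus> (\<sigma> u)\<^sup>\<star>)"
    using uA by (metis H(2,4,5) a_closed invol_closed)
  then have "nrm A (\<sigma> x) \<le> 1 / 2 * (nrm A (\<sigma> u) + nrm A (\<sigma> u))"
    using uA H(1) nrm_triangle[of "\<sigma> u" "(\<sigma> u)\<^sup>\<star>"] by (simp add: nrm_smult)
  with nu show ?thesis by simp
qed

text \<open>
  Real and imaginary part are rescaled separately to norm \<open>1 / 2\<close>, and each contributes a factor 2.
  Continuity is what allows \<open>\<sigma>\<close> to be applied to infinite series and to limits.
\<close>

lemma star_hom_bounded: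
  fixes \<sigma> :: "'a \<Rightarrow> 'a"
  assumes h: "star_hom A A \<sigma>" and x: "x \<in> carrier A"
  shows "nrm A (\<sigma> x) \<le> 4 * nrm A x"
proof -
  note H = star_hom_props[OF h]
  have sa: "nrm A (\<sigma> y) \<le> 2 * nrm A y" if y: "y \<in> carrier A" "y\<^sup>\<star> = y" for y
  proof (cases "y = \<zero>")
    case True
    have "\<sigma> \<zero> = \<sigma> (0 \<odot> \<one>)" by simp
    also have "\<dots> = \<zero>" by (simp add: H del: smult_0_left) (simp add: H)
    finally show ?thesis by (simp add: True)
  next
    case False
    define r where "r = 2 * nrm A y"
    have r: "r > 0" using False y nrm_nonneg[of y] nrm_eq_0[of y] by (simp add: r_def less_le)
    have "nrm A (\<sigma> (complex_of_real (1 / r) \<odot> y)) \<le> 1"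
      by (rule star_hom_bounded_selfadjoint[OF h]) (use y r in \<open>auto simp: invol_smult nrm_smult r_def norm_divide\<close>)
    then show ?thesis using y r by (simp add: H nrm_smult norm_divide field_simps r_def)
  qed
  define a where "a = (1 / 2) \<odot> (x \<oplus> x\<^sup>\<star>)"
  define b where "b = (\<i> / 2) \<odot> (x\<^sup>\<star> \<ominus> x)"
  have a: "a \<in> carrier A" "a\<^sup>\<star> = a" and b: "b \<in> carrier A" "b\<^sup>\<star> = b"
  proof -
    show "a \<in> carrier A" "a\<^sup>\<star> = a" using x by (auto simp: a_def invol_smult invol_add a_comm)
    show "b \<in> carrier A" using x by (simp add: b_def)
    show "b\<^sup>\<star> = b" using x
      by (simp add: b_def invol_smult invol_minus minus_eq_smult smult_add_right smult_smult invol_add a_comm)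
  qed
  have na: "nrm A a \<le> nrm A x" and nb: "nrm A b \<le> nrm A x"
    using x nrm_triangle[of x "x\<^sup>\<star>"] nrm_minus_le[of "x\<^sup>\<star>" x] by (auto simp: a_def b_def nrm_smult norm_divide)
  have "x = a \<oplus> \<i> \<odot> b"
  proof -
    have "a \<oplus> \<i> \<odot> b = ((1 / 2) \<odot> x \<oplus> (1 / 2) \<odot> x) \<oplus> ((1 / 2) \<odot> x\<^sup>\<star> \<oplus> (- (1 / 2)) \<odot> x\<^sup>\<star>)"
      unfolding a_def b_def using x by (simp add: minus_eq_smult smult_add_right smult_smult a_ac)
    also have "\<dots> = (1 / 2 + 1 / 2) \<odot> x \<oplus> (1 / 2 + - (1 / 2)) \<odot> x\<^sup>\<star>"
      using x by (subst (1 2) smult_add_left) auto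
    finally show ?thesis using x by simp
  qed
  then have "\<sigma> x = \<sigma> a \<oplus> \<i> \<odot> \<sigma> b" using a b H by simp
  then have "nrm A (\<sigma> x) \<le> nrm A (\<sigma> a) + nrm A (\<sigma> b)"
    using nrm_triangle[of "\<sigma> a" "\<i> \<odot> \<sigma> b"] a b H by (simp add: nrm_smult)
  also have "\<dots> \<le> 2 * nrm A x + 2 * nrm A x"
    using sa[OF a] sa[OF b] na nb by linarith
  finally show ?thesis by simp
qed

lemma star_hom_conv_in:
  fixes \<sigma> :: "'a \<Rightarrow> 'a"
  assumes h: "star_hom A A \<sigma>" and f: "conv_in f x"
  shows "conv_in (\<lambda>n. \<sigma> (f n)) (\<sigma> x)"
proof (rule conv_inI[where e = "\<lambda>n. 4 * nrm A (f n \<ominus> x)"])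
  note H = star_hom_props[OF h] and c = conv_inD[OF f]
  show "(\<lambda>n. 4 * nrm A (f n \<ominus> x)) \<longlonglongrightarrow> 0" using tendsto_mult_left[OF c(3), of 4] by simp
  show "nrm A (\<sigma> (f n) \<ominus> \<sigma> x) \<le> 4 * nrm A (f n \<ominus> x)" for n
    using star_hom_bounded[OF h, of "f n \<ominus> x"] c H by simp
qed (use star_hom_props(1)[OF h] conv_inD[OF f] in auto)

end

section \<open>Absolutely convergent series in a C*-algebra\<close>

definition point_mass :: "'g \<Rightarrow> complex \<Rightarrow> 'g \<Rightarrow> complex" where
  "point_mass x r = (\<lambda>z. if z = x then r else 0)"

lemma has_sum_point_mass: "((\<lambda>z. norm (point_mass x r z)) has_sum norm r) UNIV"
  by (rule has_sum_finite_neutralI[of "{x}"]) (auto simp: point_mass_def)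

lemma l1_point_mass [simp]: "l1 (point_mass x r)"
  by (rule has_sum_imp_summable[OF has_sum_point_mass])

lemma l1norm_point_mass [simp]: "l1norm (point_mass x r) = norm r"
  unfolding l1norm_def by (rule infsumI[OF has_sum_point_mass])

lemma l1_tail_small:
  assumes a: "l1 a" and e: "e > 0"
  obtains F where "finite F" "l1 (\<lambda>z. if z \<in> F then a z else 0)" "l1 (\<lambda>z. if z \<in> F then 0 else a z)"
    "l1norm (\<lambda>z. if z \<in> F then 0 else a z) < e"
proof -
  obtain F where F: "finite F" "norm (sum (\<lambda>z. norm (a z)) F - l1norm a) \<le> e / 2"
    using infsum_finite_approximation[OF a, of "e / 2"] e by (auto simp: l1norm_def dist_norm)
  have s1: "l1 (\<lambda>z. if z \<in> F then a z else 0)" and s2: "l1 (\<lambda>z. if z \<in> F then 0 else a z)"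
    by (rule summable_on_comparison_test[OF a]; simp)+
  have "l1norm a = (\<Sum>\<^sub>\<infinity>z. norm (if z \<in> F then a z else 0) + norm (if z \<in> F then 0 else a z))"
    unfolding l1norm_def by (rule infsum_cong) auto
  also have "\<dots> = (\<Sum>\<^sub>\<infinity>z. norm (if z \<in> F then a z else 0)) + l1norm (\<lambda>z. if z \<in> F then 0 else a z)"
    unfolding l1norm_def by (rule infsum_add[OF s1 s2])
  also have "(\<Sum>\<^sub>\<infinity>z. norm (if z \<in> F then a z else 0)) = sum (\<lambda>z. norm (a z)) F"
    by (rule infsumI, rule has_sum_finite_neutralI[OF F(1)]) auto
  finally have "l1norm (\<lambda>z. if z \<in> F then 0 else a z) < e" using F e by simp
  with F s1 s2 that show ?thesis by blast
qed

context cstar_algebra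
begin

text \<open>
  Finitely supported functions are dense, so two bounded additive maps agree as soon as they agree on
  point masses.
\<close>

lemma l1_map_ext:
  assumes T: "\<And>a b. l1 a \<Longrightarrow> l1 b \<Longrightarrow> T (\<lambda>z. a z + b z) = T a \<oplus> T b" "\<And>a. l1 a \<Longrightarrow> T a \<in> carrier A"
      "\<And>a. l1 a \<Longrightarrow> nrm A (T a) \<le> C * l1norm a"
    and R: "\<And>a b. l1 a \<Longrightarrow> l1 b \<Longrightarrow> R (\<lambda>z. a z + b z) = R a \<oplus> R b" "\<And>a. l1 a \<Longrightarrow> R a \<in> carrier A"
      "\<And>a. l1 a \<Longrightarrow> nrm A (R a) \<le> D * l1norm a"
    and mono: "\<And>x r. T (point_mass x r) = R (point_mass x r)"
    and a: "l1 (a :: 'g \<Rightarrow> complex)"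
  shows "T a = R a"
proof -
  have fin: "T (\<lambda>z. if z \<in> F then a z else 0) = R (\<lambda>z. if z \<in> F then a z else 0)
      \<and> l1 (\<lambda>z. if z \<in> F then a z else 0)" if "finite F" for F
    using that
  proof (induction F)
    case empty
    then show ?case using mono[of undefined 0] by (simp add: point_mass_def)
  next
    case (insert x F)
    have eq: "(\<lambda>z. if z \<in> insert x F then a z else 0) = (\<lambda>z. point_mass x (a x) z + (if z \<in> F then a z else 0))"
      using insert.hyps by (auto simp: point_mass_def fun_eq_iff)
    let ?g = "\<lambda>z. if z \<in> F then a z else 0"
    have g: "T ?g = R ?g" "l1 ?g" using insert.IH by auto
    have "T (\<lambda>z. if z \<in> insert x F then a z else 0) = R (\<lambda>z. if z \<in> insert x F then a z else 0)"
      unfolding eq by (simp only: T(1)[OF l1_point_mass g(2)] R(1)[OF l1_point_mass g(2)] mono g(1))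
    moreover have "l1 (\<lambda>z. if z \<in> insert x F then a z else 0)"
      using l1_add[OF l1_point_mass g(2), of x "a x"] unfolding fun_cong[OF eq, symmetric] .
    ultimately show ?case by blast
  qed
  have small: "nrm A (T a \<ominus> R a) \<le> 0 + e" if e: "e > 0" for e
  proof -
    define e' where "e' = e / (\<bar>C\<bar> + \<bar>D\<bar> + 1)"
    have "e' > 0" using e by (auto simp: e'_def intro!: divide_pos_pos add_nonneg_pos)
    then obtain F where F: "finite F" "l1 (\<lambda>z. if z \<in> F then a z else 0)" "l1 (\<lambda>z. if z \<in> F then 0 else a z)"
      "l1norm (\<lambda>z. if z \<in> F then 0 else a z) < e'"
      using l1_tail_small[OF a] by blast
    let ?f = "\<lambda>z. if z \<in> F then a z else 0" and ?t = "\<lambda>z. if z \<in> F then 0 else a z"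
    have split: "(\<lambda>z. ?f z + ?t z) = a" by auto
    have Ta: "T a = T ?f \<oplus> T ?t" using T(1)[OF F(2,3)] unfolding split .
    have Ra: "R a = T ?f \<oplus> R ?t" using R(1)[OF F(2,3)] fin[OF F(1)] unfolding split by simp
    have "T a \<ominus> R a = T ?t \<ominus> R ?t"
    proof -
      define x y z where "x = T ?f" and "y = T ?t" and "z = R ?t"
      have c: "x \<in> carrier A" "y \<in> carrier A" "z \<in> carrier A"
        using T(2)[OF F(2)] T(2)[OF F(3)] R(2)[OF F(3)] by (auto simp: x_def y_def z_def)
      have "(x \<oplus> y) \<ominus> (x \<oplus> z) = y \<oplus> (x \<oplus> (\<ominus> x \<oplus> \<ominus> z))"
        using c by (simp add: minus_eq minus_add a_ac)
      also have "\<dots> = y \<ominus> z" using c by (simp add: minus_eq r_neg2)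
      finally show ?thesis unfolding Ta Ra x_def y_def z_def .
    qed
    then have "nrm A (T a \<ominus> R a) \<le> nrm A (T ?t) + nrm A (R ?t)"
      using nrm_minus_le T(2)[OF F(3)] R(2)[OF F(3)] by simp
    also have "\<dots> \<le> C * l1norm ?t + D * l1norm ?t" by (intro add_mono T(3) R(3) F)
    also have "\<dots> \<le> (\<bar>C\<bar> + \<bar>D\<bar> + 1) * l1norm ?t"
      using add_mono[OF add_mono[OF mult_right_mono[OF abs_ge_self[of C] l1norm_nonneg[of ?t]]
        mult_right_mono[OF abs_ge_self[of D] l1norm_nonneg[of ?t]]] l1norm_nonneg[of ?t]]
      by (simp only: distrib_right mult_1 add_0_right)
    also have "\<dots> \<le> (\<bar>C\<bar> + \<bar>D\<bar> + 1) * e'" using F(4) by (intro mult_left_mono) auto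
    also have "\<dots> = e"
    proof -
      have "\<bar>C\<bar> + \<bar>D\<bar> + 1 > 0" by (simp add: add_nonneg_pos)
      then show ?thesis by (simp add: e'_def)
    qed
    finally show ?thesis by simp
  qed
  have "nrm A (T a \<ominus> R a) \<le> 0" by (rule field_le_epsilon) (rule small)
  then have "nrm A (T a \<ominus> R a) = 0" using nrm_nonneg[of "T a \<ominus> R a"] T(2)[OF a] R(2)[OF a] by simp
  then show ?thesis using nrm_eq_0[of "T a \<ominus> R a"] T(2)[OF a] R(2)[OF a] by simp
qed

end

locale bounded_family = cstar_algebra A
  for A :: "('a, 'm) cstar_scheme" (structure) +
  fixes W :: "'g::countable \<Rightarrow> 'a"
  assumes W_closed [simp, intro]: "W z \<in> carrier A"
    and W_nrm: "nrm A (W z) \<le> 1"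
begin

definition psum :: "('g \<Rightarrow> complex) \<Rightarrow> 'g set \<Rightarrow> 'a" where
  "psum a F = (\<Oplus>z\<in>F. a z \<odot> W z)"

definition stage :: "nat \<Rightarrow> 'g set" where
  "stage N = {z. to_nat z < N}"

text \<open>
  The sum of the series with coefficients \<open>a\<close>. For summable \<open>a\<close> it does not depend on the enumeration
  behind \<open>stage\<close>.
\<close>

definition rep :: "('g \<Rightarrow> complex) \<Rightarrow> 'a" where
  "rep a = (THE x. conv_in (\<lambda>N. psum a (stage N)) x)"

lemma psum_closed [simp, intro]: "psum a F \<in> carrier A"
  unfolding psum_def by (rule finsum_closed) auto

lemma finite_stage [simp]: "finite (stage N)"
proof -
  have "stage N \<subseteq> from_nat ` {..<N}" unfolding stage_def by (auto intro!: image_eqI[of _ _ "to_nat _"])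
  then show ?thesis by (rule finite_subset) simp
qed

lemma stage_mono: "M \<le> N \<Longrightarrow> stage M \<subseteq> stage N"
  by (auto simp: stage_def)

lemma stage_eventually: "finite F \<Longrightarrow> \<exists>N. \<forall>M\<ge>N. F \<subseteq> stage M"
proof -
  assume "finite F"
  then obtain K where K: "\<And>z. z \<in> F \<Longrightarrow> to_nat z \<le> K"
    using finite_nat_set_iff_bounded_le[of "to_nat ` F"] by auto
  have "F \<subseteq> stage M" if "M \<ge> Suc K" for M
  proof
    fix z assume "z \<in> F"
    from K[OF this] that show "z \<in> stage M" by (simp add: stage_def)
  qed
  then show ?thesis by blast
qed

lemma filterlim_stage: "filterlim stage (finite_subsets_at_top UNIV) sequentially"
  unfolding filterlim_finite_subsets_at_top eventually_sequentially using stage_eventually by auto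

lemma psum_insert: "finite F \<Longrightarrow> x \<notin> F \<Longrightarrow> psum a (insert x F) = a x \<odot> W x \<oplus> psum a F"
  unfolding psum_def by (rule finsum_insert) auto

lemma psum_empty [simp]: "psum a {} = \<zero>"
  by (simp add: psum_def)

lemma psum_nrm: "finite F \<Longrightarrow> nrm A (psum a F) \<le> (\<Sum>z\<in>F. norm (a z))"
proof (induction F rule: finite_induct)
  case (insert x F)
  have "nrm A (psum a (insert x F)) \<le> nrm A (a x \<odot> W x) + nrm A (psum a F)"
    using insert.hyps by (simp add: psum_insert nrm_triangle)
  also have "nrm A (a x \<odot> W x) \<le> norm (a x) * 1"
    using W_nrm[of x] by (simp add: nrm_smult mult_left_le)
  finally show ?case using insert by simp
qed simp

lemma psum_Un_disjoint: "finite F \<Longrightarrow> finite G \<Longrightarrow> F \<inter> G = {} \<Longrightarrow> psum a (F \<union> G) = psum a F \<oplus> psum a G"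
  unfolding psum_def by (rule finsum_Un_disjoint) auto

lemma psum_diff_nrm:
  assumes "finite G" "F \<subseteq> G"
  shows "nrm A (psum a G \<ominus> psum a F) \<le> (\<Sum>z\<in>G. norm (a z)) - (\<Sum>z\<in>F. norm (a z))"
proof -
  have f: "finite F" using assms by (rule rev_finite_subset)
  have "psum a G = psum a F \<oplus> psum a (G - F)"
    using psum_Un_disjoint[of F "G - F"] assms f by (simp add: Un_absorb1)
  then have "psum a G \<ominus> psum a F = psum a (G - F)"
    by (simp add: minus_eq a_comm[of "psum a F"] a_assoc r_neg)
  then show ?thesis using psum_nrm[of "G - F" a] assms f by (simp add: sum_diff)
qed

lemma rep_conv_in:
  assumes a: "l1 a"
  shows "conv_in (\<lambda>N. psum a (stage N)) (rep a)"
proof -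
  define s where "s N = (\<Sum>z\<in>stage N. norm (a z))" for N
  have "s \<longlonglongrightarrow> l1norm a"
    using filterlim_compose[OF has_sum_infsum[OF a, unfolded has_sum_def] filterlim_stage]
    by (simp add: s_def[abs_def] l1norm_def)
  then have cau: "Cauchy s" by (intro convergent_Cauchy convergentI)
  have le: "nrm A (psum a (stage m) \<ominus> psum a (stage n)) \<le> \<bar>s m - s n\<bar>" for m n
  proof (cases "n \<le> m")
    case True
    then show ?thesis using psum_diff_nrm[of "stage m" "stage n" a] stage_mono[OF True] by (simp add: s_def)
  next
    case False
    then show ?thesis
      using psum_diff_nrm[of "stage n" "stage m" a] stage_mono[of m n]
      by (subst nrm_minus_commute) (auto simp: s_def)
  qed
  obtain x where x: "conv_in (\<lambda>N. psum a (stage N)) x"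
  proof (rule Cauchy_conv_in)
    fix e :: real assume "e > 0"
    then obtain N where N: "\<And>m n. m \<ge> N \<Longrightarrow> n \<ge> N \<Longrightarrow> \<bar>s m - s n\<bar> < e"
      using cau unfolding Cauchy_def dist_real_def by blast
    then show "\<exists>N. \<forall>m\<ge>N. \<forall>n\<ge>N. nrm A (psum a (stage m) \<ominus> psum a (stage n)) < e"
      using le by (meson le_less_trans)
  qed auto
  then show ?thesis unfolding rep_def by (rule theI2) (auto intro: conv_in_unique x)
qed

lemma rep_closed: "l1 a \<Longrightarrow> rep a \<in> carrier A"
  using conv_inD(2)[OF rep_conv_in] .

lemma rep_eqI: "l1 a \<Longrightarrow> conv_in (\<lambda>N. psum a (stage N)) x \<Longrightarrow> rep a = x"
  using conv_in_unique rep_conv_in by blast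

lemma rep_add: "l1 a \<Longrightarrow> l1 b \<Longrightarrow> rep (\<lambda>z. a z + b z) = rep a \<oplus> rep b"
proof (rule rep_eqI[OF l1_add])
  assume a: "l1 a" and b: "l1 b"
  have "psum (\<lambda>z. a z + b z) F = psum a F \<oplus> psum b F" if "finite F" for F
    unfolding psum_def by (subst finsum_addf[symmetric]) (auto simp: smult_add_left)
  then show "conv_in (\<lambda>N. psum (\<lambda>z. a z + b z) (stage N)) (rep a \<oplus> rep b)"
    using conv_in_add[OF rep_conv_in[OF a] rep_conv_in[OF b]] by simp
qed

lemma rep_smult: "l1 a \<Longrightarrow> rep (\<lambda>z. r * a z) = r \<odot> rep a"
proof (rule rep_eqI[OF l1_cmult])
  assume a: "l1 a"
  have "psum (\<lambda>z. r * a z) F = r \<odot> psum a F" if "finite F" for F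
    using that by (induction F) (auto simp: psum_insert smult_add_right smult_smult)
  then show "conv_in (\<lambda>N. psum (\<lambda>z. r * a z) (stage N)) (r \<odot> rep a)"
    using conv_in_smult[OF rep_conv_in[OF a], of r] by simp
qed

lemma rep_diff: "l1 a \<Longrightarrow> l1 b \<Longrightarrow> rep (\<lambda>z. a z - b z) = rep a \<ominus> rep b"
  using rep_add[of a "\<lambda>z. - 1 * b z"] rep_smult[of b "- 1"] l1_cmult[of b "- 1"]
  by (simp add: minus_eq_smult rep_closed)

lemma rep_nrm: "l1 a \<Longrightarrow> nrm A (rep a) \<le> l1norm a"
proof (rule conv_in_nrm_le[OF rep_conv_in])
  assume a: "l1 a"
  show "nrm A (psum a (stage n)) \<le> l1norm a" for n
    using psum_nrm[of "stage n" a] finite_sum_le_infsum[OF a, of "stage n"] by (simp add: l1norm_def)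
qed

lemma rep_point_mass: "rep (point_mass x r) = r \<odot> W x"
proof (rule rep_eqI)
  obtain N where N: "\<And>M. M \<ge> N \<Longrightarrow> {x} \<subseteq> stage M" using stage_eventually[of "{x}"] by auto
  have "psum (point_mass x r) F = (if x \<in> F then r \<odot> W x else \<zero>)" if "finite F" for F
    using that by (induction F) (auto simp: psum_insert point_mass_def)
  then have "nrm A (psum (point_mass x r) (stage M) \<ominus> r \<odot> W x) = 0" if "M \<ge> N" for M
    using N[OF that] by (simp add: minus_eq r_neg)
  then have "(\<lambda>M. nrm A (psum (point_mass x r) (stage M) \<ominus> r \<odot> W x)) \<longlonglongrightarrow> 0"
    by (intro tendsto_eventually) (auto simp: eventually_sequentially)
  then show "conv_in (\<lambda>M. psum (point_mass x r) (stage M)) (r \<odot> W x)" by (auto simp: conv_in_def)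
qed simp

lemma rep_star:
  fixes n :: "'g \<Rightarrow> 'g"
  assumes W: "\<And>z. (W z)\<^sup>\<star> = W (n z)" and n: "\<And>z. n (n z) = z" and a: "l1 a"
  shows "(rep a)\<^sup>\<star> = rep (\<lambda>z. cnj (a (n z)))"
proof -
  have bij: "bij n" by (rule bij_betwI[where g = n]) (auto simp: n)
  have l: "l1 (\<lambda>z. cnj (b (n z)))" "l1norm (\<lambda>z. cnj (b (n z))) = l1norm b" if "l1 b" for b
    using summable_on_reindex_bij_betw[OF bij, of "\<lambda>z. norm (b z)"] that
      infsum_reindex_bij_betw[OF bij, of "\<lambda>z. norm (b z)"] by (simp_all add: l1norm_def)
  show ?thesis
  proof (rule l1_map_ext[where T = "\<lambda>a. (rep a)\<^sup>\<star>" and R = "\<lambda>a. rep (\<lambda>z. cnj (a (n z)))" and C = 1 and D = 1, OF _ _ _ _ _ _ _ a])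
    fix b :: "'g \<Rightarrow> complex" assume b: "l1 b"
    show "nrm A (rep (\<lambda>z. cnj (b (n z)))) \<le> 1 * l1norm b" using rep_nrm[OF l(1)[OF b]] l(2)[OF b] by simp
  next
    fix x r
    have "(\<lambda>z. cnj (point_mass x r (n z))) = point_mass (n x) (cnj r)"
      by (auto simp: point_mass_def fun_eq_iff n)
    then show "(rep (point_mass x r))\<^sup>\<star> = rep (\<lambda>z. cnj (point_mass x r (n z)))"
      by (simp add: rep_point_mass invol_smult W)
  next
    fix a b :: "'g \<Rightarrow> complex" assume ab: "l1 a" "l1 b"
    show "(rep (\<lambda>z. a z + b z))\<^sup>\<star> = (rep a)\<^sup>\<star> \<oplus> (rep b)\<^sup>\<star>"
      by (simp add: rep_add[OF ab] invol_add rep_closed ab)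
    show "rep (\<lambda>z. cnj (a (n z) + b (n z))) = rep (\<lambda>z. cnj (a (n z))) \<oplus> rep (\<lambda>z. cnj (b (n z)))"
      unfolding complex_cnj_add by (rule rep_add[OF l(1)[OF ab(1)] l(1)[OF ab(2)]])
  next
    fix b :: "'g \<Rightarrow> complex" assume b: "l1 b"
    show "(rep b)\<^sup>\<star> \<in> carrier A" "nrm A ((rep b)\<^sup>\<star>) \<le> 1 * l1norm b"
      using rep_closed[OF b] rep_nrm[OF b] by auto
    show "rep (\<lambda>z. cnj (b (n z))) \<in> carrier A" by (rule rep_closed[OF l(1)[OF b]])
  qed
qed

lemma rep_hom:
  fixes n n' :: "'g \<Rightarrow> 'g" and \<sigma> :: "'a \<Rightarrow> 'a"
  assumes h: "star_hom A A \<sigma>"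
    and W: "\<And>z. \<sigma> (W z) = W (n z)" and n: "\<And>z. n (n' z) = z" "\<And>z. n' (n z) = z" and a: "l1 a"
  shows "\<sigma> (rep a) = rep (\<lambda>z. a (n' z))"
proof -
  note H = star_hom_props[OF h]
  have bij: "bij n'" by (rule bij_betwI[where g = n]) (auto simp: n)
  have l: "l1 (\<lambda>z. b (n' z))" "l1norm (\<lambda>z. b (n' z)) = l1norm b" if "l1 b" for b
    using summable_on_reindex_bij_betw[OF bij, of "\<lambda>z. norm (b z)"] that
      infsum_reindex_bij_betw[OF bij, of "\<lambda>z. norm (b z)"] by (simp_all add: l1norm_def)
  show ?thesis
  proof (rule l1_map_ext[where T = "\<lambda>a. \<sigma> (rep a)" and R = "\<lambda>a. rep (\<lambda>z. a (n' z))" and C = 4 and D = 1, OF _ _ _ _ _ _ _ a])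
    fix b :: "'g \<Rightarrow> complex" assume b: "l1 b"
    show "nrm A (\<sigma> (rep b)) \<le> 4 * l1norm b"
      using star_hom_bounded[OF h rep_closed[OF b]] rep_nrm[OF b] by simp
    show "nrm A (rep (\<lambda>z. b (n' z))) \<le> 1 * l1norm b" using rep_nrm[OF l(1)[OF b]] l(2)[OF b] by simp
  next
    fix x r
    have "(\<lambda>z. point_mass x r (n' z)) = point_mass (n x) r"
      by (auto simp: point_mass_def fun_eq_iff n)
    then show "\<sigma> (rep (point_mass x r)) = rep (\<lambda>z. point_mass x r (n' z))"
      by (simp add: rep_point_mass H W)
  next
    fix a b :: "'g \<Rightarrow> complex" assume ab: "l1 a" "l1 b"
    show "\<sigma> (rep (\<lambda>z. a z + b z)) = \<sigma> (rep a) \<oplus> \<sigma> (rep b)"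
      by (simp add: rep_add[OF ab] H rep_closed ab)
    show "rep (\<lambda>z. a (n' z) + b (n' z)) = rep (\<lambda>z. a (n' z)) \<oplus> rep (\<lambda>z. b (n' z))"
      by (rule rep_add[OF l(1)[OF ab(1)] l(1)[OF ab(2)]])
  next
    fix b :: "'g \<Rightarrow> complex" assume b: "l1 b"
    show "\<sigma> (rep b) \<in> carrier A" by (rule H(1)[OF rep_closed[OF b]])
    show "rep (\<lambda>z. b (n' z)) \<in> carrier A" by (rule rep_closed[OF l(1)[OF b]])
  qed
qed

text \<open>
  Multiplying the values by the unit turns both sides into maps into the algebra, so that the density
  argument applies to a functional as well.
\<close>

lemma rep_functional:
  assumes \<tau>: "\<And>x y. x \<in> carrier A \<Longrightarrow> y \<in> carrier A \<Longrightarrow> \<tau> (x \<oplus> y) = \<tau> x + \<tau> y"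
    "\<And>c x. x \<in> carrier A \<Longrightarrow> \<tau> (c \<odot> x) = c * \<tau> x" "\<And>x. x \<in> carrier A \<Longrightarrow> cmod (\<tau> x) \<le> nrm A x"
    "\<tau> \<one> = (1::complex)" and W: "\<And>z. \<tau> (W z) = (if z = z0 then 1 else 0)" and a: "l1 a"
  shows "\<tau> (rep a) = a z0"
proof -
  have le: "norm (b z0) \<le> l1norm b" if "l1 b" for b :: "'g \<Rightarrow> complex"
    using finite_sum_le_infsum[OF that, of "{z0}"] by (simp add: l1norm_def)
  have "\<tau> (rep a) \<odot> \<one> = a z0 \<odot> \<one>"
  proof (rule l1_map_ext[where T = "\<lambda>a. \<tau> (rep a) \<odot> \<one>" and R = "\<lambda>a. a z0 \<odot> \<one>" and C = 1 and D = 1, OF _ _ _ _ _ _ _ a])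
    fix b :: "'g \<Rightarrow> complex" assume b: "l1 b"
    have "cmod (\<tau> (rep b)) * nrm A \<one> \<le> l1norm b * 1"
      using \<tau>(3)[OF rep_closed[OF b]] rep_nrm[OF b] nrm_one_le by (intro mult_mono) (auto simp: l1norm_nonneg nrm_nonneg)
    then show "nrm A (\<tau> (rep b) \<odot> \<one>) \<le> 1 * l1norm b" by (simp add: nrm_smult)
    have "cmod (b z0) * nrm A \<one> \<le> l1norm b * 1"
      using le[OF b] nrm_one_le by (intro mult_mono) (auto simp: l1norm_nonneg nrm_nonneg)
    then show "nrm A (b z0 \<odot> \<one>) \<le> 1 * l1norm b" by (simp add: nrm_smult)
  next
    fix x r
    show "\<tau> (rep (point_mass x r)) \<odot> \<one> = point_mass x r z0 \<odot> \<one>"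
      by (simp add: rep_point_mass \<tau> W) (simp add: point_mass_def)
  next
    fix a b :: "'g \<Rightarrow> complex" assume ab: "l1 a" "l1 b"
    show "\<tau> (rep (\<lambda>z. a z + b z)) \<odot> \<one> = \<tau> (rep a) \<odot> \<one> \<oplus> \<tau> (rep b) \<odot> \<one>"
      by (simp add: rep_add[OF ab] \<tau>(1)[OF rep_closed[OF ab(1)] rep_closed[OF ab(2)]] smult_add_left)
  qed (simp_all add: smult_add_left)
  then have "\<tau> (\<tau> (rep a) \<odot> \<one>) = \<tau> (a z0 \<odot> \<one>)" by simp
  then show ?thesis by (simp add: \<tau>)
qed

end

locale twisted_rep = bounded_family A W
  for A :: "('a, 'm) cstar_scheme" (structure) and W :: "'g::{ab_group_add, countable} \<Rightarrow> 'a" +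
  fixes c :: "'g \<Rightarrow> 'g \<Rightarrow> complex"
  assumes W_mult: "W x \<otimes> W y = c x y \<odot> W (x + y)"
    and norm_c: "norm (c x y) = 1"
begin

text \<open>
  The density argument is applied first in the right factor, with a point mass on the left, and then in
  the left factor.
\<close>

lemma rep_mult:
  assumes a: "l1 a" and b: "l1 b"
  shows "rep a \<otimes> rep b = rep (tconv c a b)"
proof -
  have l: "l1 (tconv c a b)" "l1norm (tconv c a b) \<le> l1norm a * l1norm b" if "l1 a" "l1 b" for a b
    by (rule l1_tconv[OF that norm_c])+
  have nm: "nrm A (rep a \<otimes> rep b) \<le> l1norm a * l1norm b" if a: "l1 a" and b: "l1 b" for a b
    using nrm_mult[OF rep_closed[OF a] rep_closed[OF b]]
      mult_mono[OF rep_nrm[OF a] rep_nrm[OF b] l1norm_nonneg nrm_nonneg[OF rep_closed[OF b]]] by linarith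
  have nt: "nrm A (rep (tconv c a b)) \<le> l1norm a * l1norm b" if "l1 a" "l1 b" for a b
    using rep_nrm[OF l(1)[OF that]] l(2)[OF that] by linarith
  have adl: "rep (tconv c (\<lambda>z. a z + a' z) b) = rep (tconv c a b) \<oplus> rep (tconv c a' b)" if "l1 a" "l1 a'" "l1 b" for a a' b
  proof -
    have "tconv c (\<lambda>z. a z + a' z) b = (\<lambda>v. tconv c a b v + tconv c a' b v)"
      by (rule ext) (rule tconv_add_left[where c = c, OF that norm_c])
    then show ?thesis using rep_add[OF l(1)[OF that(1,3)] l(1)[OF that(2,3)]] by (simp only:)
  qed
  have adr: "rep (tconv c a (\<lambda>z. b z + b' z)) = rep (tconv c a b) \<oplus> rep (tconv c a b')" if "l1 a" "l1 b" "l1 b'" for a b b'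
  proof -
    have "tconv c a (\<lambda>z. b z + b' z) = (\<lambda>v. tconv c a b v + tconv c a b' v)"
      by (rule ext) (rule tconv_add_right[where c = c, OF that norm_c])
    then show ?thesis using rep_add[OF l(1)[OF that(1,2)] l(1)[OF that(1,3)]] by (simp only:)
  qed
  have mono: "rep (point_mass x r) \<otimes> rep (point_mass y s) = rep (tconv c (point_mass x r) (point_mass y s))" for x y r s
  proof -
    have "tconv c (point_mass x r) (point_mass y s) v = point_mass (x + y) (r * s * c x y) v" for v
    proof -
      have "((\<lambda>w. point_mass x r w * point_mass y s (v - w) * c w (v - w)) has_sum point_mass (x + y) (r * s * c x y) v) UNIV"
        by (rule has_sum_finite_neutralI[of "{x}"]) (auto simp: point_mass_def algebra_simps)
      then show ?thesis unfolding tconv_def by (rule infsumI)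
    qed
    then have "tconv c (point_mass x r) (point_mass y s) = point_mass (x + y) (r * s * c x y)" by (rule ext)
    then show ?thesis by (simp add: rep_point_mass smult_mult_left smult_mult_right smult_smult W_mult mult_ac)
  qed
  have mono2: "rep (point_mass x r) \<otimes> rep b = rep (tconv c (point_mass x r) b)" if b: "l1 b" for x r b
  proof (rule l1_map_ext[where T = "\<lambda>b. rep (point_mass x r) \<otimes> rep b" and R = "\<lambda>b. rep (tconv c (point_mass x r) b)"
          and C = "l1norm (point_mass x r)" and D = "l1norm (point_mass x r)", OF _ _ _ _ _ _ _ b])
    fix a b :: "'g \<Rightarrow> complex" assume ab: "l1 a" "l1 b"
    show "rep (point_mass x r) \<otimes> rep (\<lambda>z. a z + b z) = rep (point_mass x r) \<otimes> rep a \<oplus> rep (point_mass x r) \<otimes> rep b"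
      unfolding rep_add[OF ab] by (intro r_distr rep_closed l1_point_mass ab)
    show "rep (tconv c (point_mass x r) (\<lambda>z. a z + b z)) = rep (tconv c (point_mass x r) a) \<oplus> rep (tconv c (point_mass x r) b)"
      by (rule adr[OF l1_point_mass ab])
  next
    fix b :: "'g \<Rightarrow> complex" assume b: "l1 b"
    show "rep (point_mass x r) \<otimes> rep b \<in> carrier A" by (intro m_closed rep_closed l1_point_mass b)
    show "rep (tconv c (point_mass x r) b) \<in> carrier A" by (rule rep_closed[OF l(1)[OF l1_point_mass b]])
    show "nrm A (rep (point_mass x r) \<otimes> rep b) \<le> l1norm (point_mass x r) * l1norm b" by (rule nm[OF l1_point_mass b])
    show "nrm A (rep (tconv c (point_mass x r) b)) \<le> l1norm (point_mass x r) * l1norm b" by (rule nt[OF l1_point_mass b])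
  qed (rule mono)
  show ?thesis
  proof (rule l1_map_ext[where T = "\<lambda>a. rep a \<otimes> rep b" and R = "\<lambda>a. rep (tconv c a b)"
          and C = "l1norm b" and D = "l1norm b", OF _ _ _ _ _ _ _ a])
    fix a a' :: "'g \<Rightarrow> complex" assume aa: "l1 a" "l1 a'"
    show "rep (\<lambda>z. a z + a' z) \<otimes> rep b = rep a \<otimes> rep b \<oplus> rep a' \<otimes> rep b"
      unfolding rep_add[OF aa] by (intro l_distr rep_closed b aa)
    show "rep (tconv c (\<lambda>z. a z + a' z) b) = rep (tconv c a b) \<oplus> rep (tconv c a' b)"
      by (rule adl[OF aa b])
  next
    fix a :: "'g \<Rightarrow> complex" assume a: "l1 a"
    show "rep a \<otimes> rep b \<in> carrier A" by (intro m_closed rep_closed a b)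
    show "rep (tconv c a b) \<in> carrier A" by (rule rep_closed[OF l(1)[OF a b]])
    show "nrm A (rep a \<otimes> rep b) \<le> l1norm b * l1norm a" using nm[OF a b] by (simp only: mult.commute)
    show "nrm A (rep (tconv c a b)) \<le> l1norm b * l1norm a" using nt[OF a b] by (simp only: mult.commute)
  qed (rule mono2[OF b])
qed

end

section \<open>Weyl unitaries of a rotation algebra\<close>

context cstar_algebra
begin

lemma unitary_in_closed: "unitary_in A u \<Longrightarrow> u \<in> carrier A"
  by (simp add: unitary_in_def)

lemma unitary_in_Units: "unitary_in A u \<Longrightarrow> u \<in> Units A"
  unfolding unitary_in_def Units_def by auto

lemma unitary_in_inv: "unitary_in A u \<Longrightarrow> inv u = u\<^sup>\<star>"
  unfolding unitary_in_def by (intro inv_unique'[symmetric]) auto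

lemma unitary_in_mult: "unitary_in A u \<Longrightarrow> unitary_in A v \<Longrightarrow> unitary_in A (u \<otimes> v)"
proof -
  assume u: "unitary_in A u" and v: "unitary_in A v"
  then have c: "u \<in> carrier A" "v \<in> carrier A" "u\<^sup>\<star> \<otimes> u = \<one>" "u \<otimes> u\<^sup>\<star> = \<one>" "v\<^sup>\<star> \<otimes> v = \<one>" "v \<otimes> v\<^sup>\<star> = \<one>"
    by (auto simp: unitary_in_def)
  have "(u \<otimes> v)\<^sup>\<star> \<otimes> (u \<otimes> v) = v\<^sup>\<star> \<otimes> ((u\<^sup>\<star> \<otimes> u) \<otimes> v)" using c(1,2) by (simp add: invol_mult m_assoc)
  moreover have "(u \<otimes> v) \<otimes> (u \<otimes> v)\<^sup>\<star> = u \<otimes> ((v \<otimes> v\<^sup>\<star>) \<otimes> u\<^sup>\<star>)" using c(1,2) by (simp add: invol_mult m_assoc)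
  ultimately show ?thesis using c by (simp add: unitary_in_def)
qed

lemma unitary_in_star: "unitary_in A u \<Longrightarrow> unitary_in A (u\<^sup>\<star>)"
  by (auto simp: unitary_in_def)

lemma units_of_int_pow: "u \<in> Units A \<Longrightarrow> u [^]\<^bsub>units_of A\<^esub> (k::int) = u [^] k"
  unfolding int_pow_def2 by (simp add: units_of_pow units_of_inv Units_pow_closed del: pow_nat)

lemma unit_int_pow_add: "u \<in> Units A \<Longrightarrow> u [^] (j + k :: int) = u [^] j \<otimes> u [^] k"
  using group.int_pow_mult[OF units_group, of u j k] by (simp add: units_of_int_pow units_of_carrier units_of_mult)

lemma unit_int_pow_neg: "u \<in> Units A \<Longrightarrow> u [^] (- k :: int) = inv (u [^] k)"
proof -
  assume u: "u \<in> Units A"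
  have "u [^] k \<in> Units A"
    using group.int_pow_closed[OF units_group, of u k] u by (simp add: units_of_int_pow units_of_carrier)
  then show ?thesis
    using group.int_pow_neg[OF units_group, of u k] u by (simp add: units_of_int_pow units_of_carrier units_of_inv)
qed

lemma int_pow_one_exp: "u \<in> carrier A \<Longrightarrow> u [^] (1::int) = u"
  using int_pow_int[of A u 1] by simp

lemma unitary_pow_step:
  assumes u: "unitary_in A u"
  shows "u [^] (k + 1 :: int) = u [^] k \<otimes> u" "u [^] (k - 1 :: int) = u [^] k \<otimes> u\<^sup>\<star>"
  using unit_int_pow_add[OF unitary_in_Units[OF u], of k 1] unit_int_pow_add[OF unitary_in_Units[OF u], of k "- 1"]
    unit_int_pow_neg[OF unitary_in_Units[OF u], of 1] int_pow_one_exp[OF unitary_in_closed[OF u]] unitary_in_inv[OF u]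
  by simp_all

lemma unitary_in_pow: "unitary_in A u \<Longrightarrow> unitary_in A (u [^] (k::int))"
proof (induction k rule: int_induct[where k = 0])
  case base
  then show ?case by (simp add: unitary_in_def)
qed (auto simp: unitary_pow_step intro: unitary_in_mult unitary_in_star)

lemma unitary_pow_star: "unitary_in A u \<Longrightarrow> (u [^] (k::int))\<^sup>\<star> = u [^] (- k)"
  using unit_int_pow_neg[OF unitary_in_Units, of u k] unitary_in_inv[OF unitary_in_pow, of u k] by simp

lemma unitary_star_pow:
  assumes u: "unitary_in A u"
  shows "(u\<^sup>\<star>) [^] (k::int) = u [^] (- k)"
proof (induction k rule: int_induct[where k = 0])
  case (step1 i)
  then show ?case using unitary_pow_step(1)[OF unitary_in_star[OF u], of i] unitary_pow_step(2)[OF u, of "- i"] by simp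
next
  case (step2 i)
  then show ?case using unitary_pow_step(2)[OF unitary_in_star[OF u], of i] unitary_pow_step(1)[OF u, of "- i"] u
    by (simp add: unitary_in_closed)
qed simp

lemma star_hom_unitary_pow:
  fixes \<sigma> :: "'a \<Rightarrow> 'a"
  assumes h: "star_hom A A \<sigma>" and u: "unitary_in A u" and su: "unitary_in A (\<sigma> u)"
  shows "\<sigma> (u [^] (k::int)) = (\<sigma> u) [^] k"
proof -
  note H = star_hom_props[OF h]
  have c: "u [^] (k::int) \<in> carrier A" "u \<in> carrier A" for k
    using unitary_in_closed[OF unitary_in_pow[OF u]] unitary_in_closed[OF u] by auto
  show ?thesis
  proof (induction k rule: int_induct[where k = 0])
    case (step1 i)
    then show ?case using c by (simp add: unitary_pow_step[OF u] unitary_pow_step[OF su] H)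
  next
    case (step2 i)
    then show ?case using c by (simp add: unitary_pow_step[OF u] unitary_pow_step[OF su] H)
  qed (simp add: H)
qed

text \<open>
  The commutation relation passes to negative powers because it can be conjugated by the adjoint of
  \<open>x\<close>.
\<close>

lemma commute_unitary_pow:
  assumes x: "unitary_in A x" and y: "y \<in> carrier A" and yx: "y \<otimes> x = cis t \<odot> (x \<otimes> y)"
  shows "y \<otimes> x [^] (m::int) = cis (of_int m * t) \<odot> (x [^] m \<otimes> y)"
proof -
  have c: "x [^] (k::int) \<in> carrier A" "x \<in> carrier A" "x\<^sup>\<star> \<otimes> x = \<one>" "x \<otimes> x\<^sup>\<star> = \<one>" for k
    using unitary_in_closed[OF unitary_in_pow[OF x]] x by (auto simp: unitary_in_def)
  have yxs: "y \<otimes> x\<^sup>\<star> = cis (- t) \<odot> (x\<^sup>\<star> \<otimes> y)"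
  proof -
    have "x\<^sup>\<star> \<otimes> y = x\<^sup>\<star> \<otimes> ((y \<otimes> x) \<otimes> x\<^sup>\<star>)" using c y by (simp add: m_assoc)
    also have "\<dots> = cis t \<odot> ((x\<^sup>\<star> \<otimes> x) \<otimes> (y \<otimes> x\<^sup>\<star>))"
      unfolding yx using c(1,2) y by (simp add: smult_mult_left smult_mult_right m_assoc)
    also have "\<dots> = cis t \<odot> (y \<otimes> x\<^sup>\<star>)" using c y by simp
    finally show ?thesis using c y by (simp add: smult_smult cis_mult)
  qed
  show ?thesis
  proof (induction m rule: int_induct[where k = 0])
    case base
    show ?case using y by simp
  next
    case (step1 i)
    have "y \<otimes> x [^] (i + 1) = (y \<otimes> x [^] i) \<otimes> x" using c y by (simp add: unitary_pow_step[OF x] m_assoc)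
    also have "\<dots> = cis (of_int i * t) \<odot> (x [^] i \<otimes> (y \<otimes> x))"
      unfolding step1.IH using c y by (simp add: smult_mult_left m_assoc)
    also have "\<dots> = cis (of_int i * t + t) \<odot> (x [^] i \<otimes> x \<otimes> y)"
      unfolding yx using c y by (simp add: smult_mult_right smult_smult cis_mult m_assoc)
    finally show ?case by (simp add: unitary_pow_step[OF x] distrib_right)
  next
    case (step2 i)
    have "y \<otimes> x [^] (i - 1) = (y \<otimes> x [^] i) \<otimes> x\<^sup>\<star>" using c y by (simp add: unitary_pow_step[OF x] m_assoc)
    also have "\<dots> = cis (of_int i * t) \<odot> (x [^] i \<otimes> (y \<otimes> x\<^sup>\<star>))"
      unfolding step2.IH using c y by (simp add: smult_mult_left m_assoc)
    also have "\<dots> = cis (of_int i * t - t) \<odot> (x [^] i \<otimes> x\<^sup>\<star> \<otimes> y)"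
      unfolding yxs using c y by (simp add: smult_mult_right smult_smult cis_mult m_assoc)
    finally show ?case by (simp add: unitary_pow_step[OF x] left_diff_distrib)
  qed
qed

end

locale rotation_system = cstar_algebra A
  for A :: "('a, 'm) cstar_scheme" (structure) +
  fixes \<theta> :: real and U V :: 'a
  assumes rotation: "rotation_pair \<theta> A U V"
begin

lemma U: "unitary_in A U" and V: "unitary_in A V" and VU: "V \<otimes> U = cis (2 * pi * \<theta>) \<odot> (U \<otimes> V)"
  using rotation by (auto simp: rotation_pair_def cis_conv_exp mult_ac)

lemma UV_closed [simp, intro]: "U [^] (k::int) \<in> carrier A" "V [^] (k::int) \<in> carrier A"
  using unitary_in_closed[OF unitary_in_pow] U V by auto

lemma VU_pow: "V [^] (n::int) \<otimes> U [^] (m::int) = cis (2 * pi * \<theta> * of_int n * of_int m) \<odot> (U [^] m \<otimes> V [^] n)"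
proof -
  note UV = unitary_in_closed[OF U] unitary_in_closed[OF V]
  have "V \<otimes> U [^] m = cis (of_int m * (2 * pi * \<theta>)) \<odot> (U [^] m \<otimes> V)"
    by (rule commute_unitary_pow[OF U UV(2) VU])
  then have "U [^] m \<otimes> V = cis (- (of_int m * (2 * pi * \<theta>))) \<odot> (V \<otimes> U [^] m)"
    using UV by (simp add: smult_smult cis_mult)
  from commute_unitary_pow[OF V _ this, of n]
  have "U [^] m \<otimes> V [^] n = cis (of_int n * - (of_int m * (2 * pi * \<theta>))) \<odot> (V [^] n \<otimes> U [^] m)" by auto
  then show ?thesis by (simp add: smult_smult cis_mult algebra_simps)
qed

text \<open>
  The phase orders \<open>U\<close> and \<open>V\<close> symmetrically. With it the adjoint and the Fourier transform act on the
  index alone.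
\<close>

definition weyl :: "int \<times> int \<Rightarrow> 'a" where
  "weyl = (\<lambda>(m, n). cis (pi * \<theta> * of_int m * of_int n) \<odot> (U [^] m \<otimes> V [^] n))"

lemma weyl_closed [simp, intro]: "weyl z \<in> carrier A"
  by (auto simp: weyl_def case_prod_unfold)

lemma weyl_0: "weyl 0 = \<one>"
  by (simp add: weyl_def zero_prod_def)

lemma weyl_mult: "weyl z \<otimes> weyl z' = rotc \<theta> z z' \<odot> weyl (z + z')"
proof -
  obtain m n where z: "z = (m, n)" by force
  obtain m' n' where z': "z' = (m', n')" by force
  have "weyl z \<otimes> weyl z' = (cis (pi * \<theta> * of_int m * of_int n) * cis (pi * \<theta> * of_int m' * of_int n')) \<odot>
      (U [^] m \<otimes> (V [^] n \<otimes> U [^] m') \<otimes> V [^] n')"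
    by (simp add: weyl_def z z' smult_mult_left smult_mult_right smult_smult m_assoc mult.commute)
  also have "U [^] m \<otimes> (V [^] n \<otimes> U [^] m') \<otimes> V [^] n' =
      cis (2 * pi * \<theta> * of_int n * of_int m') \<odot> ((U [^] m \<otimes> U [^] m') \<otimes> (V [^] n \<otimes> V [^] n'))"
    by (simp add: VU_pow smult_mult_left smult_mult_right m_assoc)
  also have "(U [^] m \<otimes> U [^] m') \<otimes> (V [^] n \<otimes> V [^] n') = U [^] (m + m') \<otimes> V [^] (n + n')"
    using unit_int_pow_add[OF unitary_in_Units[OF U]] unit_int_pow_add[OF unitary_in_Units[OF V]] by simp
  also have "(cis (pi * \<theta> * of_int m * of_int n) * cis (pi * \<theta> * of_int m' * of_int n')) \<odot>
      (cis (2 * pi * \<theta> * of_int n * of_int m') \<odot> (U [^] (m + m') \<otimes> V [^] (n + n'))) = rotc \<theta> z z' \<odot> weyl (z + z')"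
    by (simp add: weyl_def rotc_def z z' smult_smult cis_mult) (simp add: algebra_simps)
  finally show ?thesis .
qed

lemma weyl_star: "(weyl z)\<^sup>\<star> = weyl (- z)"
proof -
  obtain m n where z: "z = (m, n)" by force
  have "(weyl z)\<^sup>\<star> = cis (- (pi * \<theta> * of_int m * of_int n)) \<odot> (V [^] (- n) \<otimes> U [^] (- m))"
    by (simp add: weyl_def z invol_smult invol_mult unitary_pow_star[OF U] unitary_pow_star[OF V] cis_cnj)
  also have "\<dots> = weyl (- z)"
    by (simp add: weyl_def z VU_pow smult_smult cis_mult mult_ac)
  finally show ?thesis .
qed

lemma weyl_nrm: "nrm A (weyl z) \<le> 1"
proof -
  have "(nrm A (weyl z))\<^sup>2 = nrm A (rotc \<theta> (- z) z \<odot> \<one>)"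
    using cstar_identity[of "weyl z"] by (simp add: weyl_star weyl_mult weyl_0)
  also have "\<dots> \<le> 1" using nrm_one_le by (simp add: nrm_smult)
  finally show ?thesis using nrm_nonneg[of "weyl z"] by (simp add: power_le_one_iff)
qed

end

sublocale rotation_system \<subseteq> twisted_rep A weyl "rotc \<theta>"
  by unfold_locales (auto simp: weyl_nrm weyl_mult)

context rotation_system
begin

lemma fourier_weyl:
  fixes \<sigma> :: "'a \<Rightarrow> 'a"
  assumes h: "star_hom A A \<sigma>" and sU: "\<sigma> U = V" and sV: "\<sigma> V = U\<^sup>\<star>"
  shows "\<sigma> (weyl (m, n)) = weyl (- n, m)"
proof -
  note H = star_hom_props[OF h]
  have "\<sigma> (U [^] m) = V [^] m" using star_hom_unitary_pow[OF h U, of m] V sU by simp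
  moreover have "\<sigma> (V [^] n) = U [^] (- n)"
    using star_hom_unitary_pow[OF h V, of n] unitary_in_star[OF U] sV unitary_star_pow[OF U] by simp
  ultimately have "\<sigma> (weyl (m, n)) = cis (pi * \<theta> * of_int m * of_int n) \<odot> (V [^] m \<otimes> U [^] (- n))"
    by (simp add: weyl_def H)
  also have "\<dots> = weyl (- n, m)"
    by (simp add: weyl_def VU_pow smult_smult cis_mult mult_ac)
  finally show ?thesis .
qed

end

section \<open>Tripotents from almost tripotent elements\<close>

context cstar_algebra
begin

lemma l_distr_minus: "x \<in> carrier A \<Longrightarrow> y \<in> carrier A \<Longrightarrow> z \<in> carrier A \<Longrightarrow> (x \<ominus> y) \<otimes> z = x \<otimes> z \<ominus> y \<otimes> z"
  by (simp add: minus_eq l_distr l_minus)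

lemma r_distr_minus: "x \<in> carrier A \<Longrightarrow> y \<in> carrier A \<Longrightarrow> z \<in> carrier A \<Longrightarrow> z \<otimes> (x \<ominus> y) = z \<otimes> x \<ominus> z \<otimes> y"
  by (simp add: minus_eq r_distr r_minus)

lemma invol_pow: "x \<in> carrier A \<Longrightarrow> (x [^] (n::nat))\<^sup>\<star> = (x\<^sup>\<star>) [^] n"
proof (induction n)
  case (Suc n)
  have "(x [^] Suc n)\<^sup>\<star> = x\<^sup>\<star> \<otimes> (x [^] n)\<^sup>\<star>" using Suc.prems by (simp add: invol_mult)
  also have "\<dots> = (x\<^sup>\<star>) [^] Suc n"
    using Suc by (simp only: nat_pow_Suc2[OF invol_closed])
  finally show ?case .
qed simp

text \<open>
  The decay of \<open>d (1 - d\<^sup>2)\<^sup>n\<close> makes \<open>1 - (1 - d\<^sup>2)\<^sup>n\<close> converge to the range projection \<open>P\<close> of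
  \<open>d\<close>. The defect \<open>E = P - d\<^sup>2\<close> has powers \<open>E\<^sup>n = P - (1 - (1 - d\<^sup>2)\<^sup>n)\<close>, which decay at rate \<open>q\<close>, so its norm is at
  most \<open>q\<close> by \<open>selfadjoint_nrm_le\<close>. With \<open>y\<close> an inverse square root of \<open>1 - E\<close>, the element
  \<open>s = d y\<close> satisfies \<open>s\<^sup>2 = d\<^sup>2 y\<^sup>2 = P (1 - E) y\<^sup>2 = P\<close>. The closed algebra \<open>K\<close> serves to keep track of
  symmetries of \<open>d\<^sup>2\<close> that \<open>P\<close> and \<open>y\<close> inherit.
\<close>

lemma selfadjoint_tripotent_exists:
  assumes d: "d \<in> carrier A" "d\<^sup>\<star> = d" and q: "0 \<le> q" "q \<le> 0.33"
    and decay: "\<And>n. nrm A (d \<otimes> (\<one> \<ominus> d \<otimes> d) [^] (n::nat)) \<le> C * q ^ n"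
    and K: "K \<subseteq> carrier A" "\<one> \<in> K" "d \<otimes> d \<in> K"
      "\<And>x y. x \<in> K \<Longrightarrow> y \<in> K \<Longrightarrow> x \<oplus> y \<in> K" "\<And>x y. x \<in> K \<Longrightarrow> y \<in> K \<Longrightarrow> x \<otimes> y \<in> K"
      "\<And>c x. x \<in> K \<Longrightarrow> c \<odot> x \<in> K" "\<And>f x. range f \<subseteq> K \<Longrightarrow> conv_in f x \<Longrightarrow> x \<in> K"
  obtains P s y where "conv_in (\<lambda>n. \<one> \<ominus> (\<one> \<ominus> d \<otimes> d) [^] (n::nat)) P" "P \<in> K" "P\<^sup>\<star> = P" "P \<otimes> P = P"
    "s = d \<otimes> y" "y \<in> K" "s\<^sup>\<star> = s" "s \<otimes> s = P" "P \<otimes> s = s" "s \<otimes> P = s"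
proof -
  define D where "D = d \<otimes> d"
  define b where "b = \<one> \<ominus> D"
  define p where "p n = \<one> \<ominus> b [^] n" for n :: nat
  have DA: "D \<in> carrier A" and bA: "b \<in> carrier A" using d by (auto simp: D_def b_def)
  have pA: "p n \<in> carrier A" for n using bA by (simp add: p_def)
  have dD: "d \<otimes> D = D \<otimes> d" using d by (simp add: D_def m_assoc)
  have Dstar: "D\<^sup>\<star> = D" using d by (simp add: D_def invol_mult)
  have bstar: "b\<^sup>\<star> = b" using Dstar DA by (simp add: b_def invol_minus)
  have b_comm: "x \<otimes> b [^] n = b [^] n \<otimes> x" if x: "x \<in> carrier A" "x \<otimes> D = D \<otimes> x" for x and n :: nat
  proof (induction n)
    case (Suc n)
    have xb: "x \<otimes> b = b \<otimes> x" using x DA by (simp add: b_def minus_eq l_distr r_distr l_minus r_minus)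
    have "x \<otimes> b [^] Suc n = (x \<otimes> b [^] n) \<otimes> b" using x bA by (simp add: m_assoc)
    also have "\<dots> = b [^] n \<otimes> (x \<otimes> b)" unfolding Suc.IH using x bA by (simp add: m_assoc)
    also have "\<dots> = b [^] Suc n \<otimes> x" unfolding xb using x bA by (simp add: m_assoc)
    finally show ?case .
  qed (use x in simp)
  have step: "p (Suc n) = p n \<oplus> D \<otimes> b [^] n" for n
  proof -
    have "b [^] Suc n = b \<otimes> b [^] n" by (rule nat_pow_Suc2[OF bA])
    also have "\<dots> = b [^] n \<ominus> D \<otimes> b [^] n" using bA DA unfolding b_def[of] by (simp add: minus_eq l_distr l_minus)
    finally have e: "b [^] Suc n = b [^] n \<ominus> D \<otimes> b [^] n" .
    define X1 X2 where "X1 = b [^] n" and "X2 = D \<otimes> b [^] n"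
    have "X1 \<in> carrier A" "X2 \<in> carrier A" using bA DA by (auto simp: X1_def X2_def)
    then have "\<one> \<ominus> (X1 \<ominus> X2) = \<one> \<ominus> X1 \<oplus> X2" by (simp add: minus_eq minus_add a_assoc)
    then show ?thesis unfolding p_def e X1_def X2_def .
  qed
  have db_nrm: "nrm A (D \<otimes> b [^] n) \<le> nrm A d * C * q ^ n" for n :: nat
  proof -
    have "D \<otimes> b [^] n = d \<otimes> (d \<otimes> b [^] n)" using d bA by (simp add: D_def m_assoc)
    then have "nrm A (D \<otimes> b [^] n) \<le> nrm A d * nrm A (d \<otimes> b [^] n)" using d bA by (simp add: nrm_mult)
    also have "\<dots> \<le> nrm A d * (C * q ^ n)"
      using decay[of n] nrm_nonneg[OF d(1)] by (intro mult_left_mono) (auto simp: b_def D_def)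
    finally show ?thesis by (simp add: mult.assoc)
  qed
  have q1: "q < 1" using q by simp
  have diff: "p (Suc n) \<ominus> p n = D \<otimes> b [^] n" for n
    unfolding step using pA[of n] DA bA by (simp add: minus_eq a_comm[of "p n"] a_assoc r_neg)
  obtain P where P: "conv_in p P" and Pn: "\<And>n. nrm A (P \<ominus> p n) \<le> nrm A d * C / (1 - q) * q ^ n"
  proof (rule geometric_conv_in[of p q "nrm A d * C"])
    show "nrm A (p (Suc n) \<ominus> p n) \<le> nrm A d * C * q ^ n" for n unfolding diff by (rule db_nrm)
  qed (use pA q q1 in auto)
  have PA: "P \<in> carrier A" by (rule conv_inD(2)[OF P])
  have "conv_in (\<lambda>n. d \<otimes> p n) d"
  proof (rule conv_inI[where e = "\<lambda>n. C * q ^ n"])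
    show "(\<lambda>n. C * q ^ n) \<longlonglongrightarrow> 0"
      using tendsto_mult_left[OF LIMSEQ_power_zero[of q], of C] q q1 by simp
    fix n
    have "d \<otimes> p n \<ominus> d = \<ominus> (d \<otimes> b [^] n)"
      using d bA by (simp add: p_def minus_eq r_distr r_minus a_comm[of d] a_assoc r_neg)
    then show "nrm A (d \<otimes> p n \<ominus> d) \<le> C * q ^ n" using decay[of n] d bA by (simp add: b_def D_def)
  qed (use d pA in auto)
  then have dP: "d \<otimes> P = d" using conv_in_unique[OF conv_in_mult_left[OF P d(1)]] by blast
  have pstar: "(p n)\<^sup>\<star> = p n" for n using bA bstar by (simp add: p_def invol_minus invol_pow)
  have Pstar: "P\<^sup>\<star> = P" using conv_in_unique[OF conv_in_star[OF P]] P by (simp add: pstar)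
  have Pd: "P \<otimes> d = d"
    using arg_cong[OF dP, of "invol A"] d PA Pstar by (simp add: invol_mult)
  have PD: "P \<otimes> D = D" "D \<otimes> P = D" using Pd dP d PA by (simp_all add: D_def m_assoc) (simp flip: m_assoc)
  have Pp: "P \<otimes> p n = p n" for n
  proof (induction n)
    case 0
    have "p 0 = \<zero>" using bA by (simp add: p_def minus_eq r_neg)
    then show ?case using PA by simp
  next
    case (Suc n)
    have "P \<otimes> (D \<otimes> b [^] n) = D \<otimes> b [^] n" using PA DA bA PD by (simp flip: m_assoc)
    then show ?case unfolding step using Suc.IH PA pA DA bA by (simp add: r_distr)
  qed
  have PP: "P \<otimes> P = P" using conv_in_unique[OF conv_in_mult_left[OF P PA]] P by (simp add: Pp)
  define E where "E = P \<ominus> D"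
  have EA: "E \<in> carrier A" using PA DA by (simp add: E_def)
  have Estar: "E\<^sup>\<star> = E" using PA DA Pstar Dstar by (simp add: E_def invol_minus)
  have Epow: "E [^] Suc n = P \<ominus> p (Suc n)" for n
  proof (induction n)
    case 0
    have "p 1 = D" using step[of 0] bA DA by (simp add: p_def minus_eq r_neg)
    then show ?case using EA by (simp add: E_def)
  next
    case (Suc n)
    let ?n = "Suc n"
    have Dp: "D \<otimes> p ?n = D \<ominus> D \<otimes> b [^] ?n" using DA bA by (simp add: p_def minus_eq r_distr r_minus)
    have "E [^] Suc ?n = E \<otimes> (P \<ominus> p ?n)" unfolding Suc.IH[symmetric] by (rule nat_pow_Suc2[OF EA])
    also have "\<dots> = (P \<otimes> P \<ominus> P \<otimes> p ?n) \<ominus> (D \<otimes> P \<ominus> D \<otimes> p ?n)"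
      unfolding E_def l_distr_minus[OF PA DA minus_closed[OF PA pA]] r_distr_minus[OF PA pA PA] r_distr_minus[OF PA pA DA] ..
    also have "\<dots> = (P \<ominus> p ?n) \<ominus> (D \<ominus> (D \<ominus> D \<otimes> b [^] ?n))"
      unfolding PP Pp PD Dp ..
    also have "\<dots> = P \<ominus> p (Suc ?n)"
    proof -
      define X1 X2 where "X1 = p ?n" and "X2 = D \<otimes> b [^] ?n"
      have c: "X1 \<in> carrier A" "X2 \<in> carrier A" using bA DA pA by (auto simp: X1_def X2_def)
      have "D \<ominus> (D \<ominus> X2) = X2" using c DA by (simp add: minus_eq minus_add r_neg2)
      moreover have "(P \<ominus> X1) \<ominus> X2 = P \<ominus> (X1 \<oplus> X2)" using c PA by (simp add: minus_eq minus_add a_assoc)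
      ultimately show ?thesis unfolding step[of ?n] X1_def X2_def by simp
    qed
    finally show ?case .
  qed
  (* the summand 1 covers the exponent 0, where the formula for the powers of \<open>E\<close> fails *)
  define M where "M = 1 + nrm A d * C / (1 - q)"
  have C0: "C \<ge> 0" using decay[of 0] nrm_nonneg[OF d(1)] d by simp
  have "nrm A (E [^] n) \<le> M * q ^ n" for n :: nat
  proof (cases n)
    case 0
    have "nrm A d * C / (1 - q) \<ge> 0" using C0 q1 nrm_nonneg[OF d(1)] by simp
    then show ?thesis using 0 nrm_one_le by (simp add: M_def)
  next
    case (Suc k)
    have "nrm A (E [^] n) \<le> nrm A d * C / (1 - q) * q ^ n" using Pn[of n] unfolding Suc Epow .
    also have "\<dots> \<le> M * q ^ n" unfolding M_def using q by (intro mult_right_mono) auto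
    finally show ?thesis .
  qed
  then have nE: "nrm A E \<le> 0.33" using selfadjoint_nrm_le[OF EA Estar q(1)] q(2) by force
  have Kminus: "x \<ominus> y \<in> K" if "x \<in> K" "y \<in> K" for x y
    using K(4)[OF that(1) K(6)[OF that(2), of "- 1"]] that K(1) by (simp add: minus_eq_smult subset_iff)
  have DK: "D \<in> K" using K(3) by (simp add: D_def)
  have bK: "b [^] n \<in> K" for n :: nat
  proof (induction n)
    case (Suc n)
    then show ?case using K(5) Kminus[OF K(2) DK] by (simp add: b_def)
  qed (simp add: K(2))
  have PK: "P \<in> K" by (rule K(7)[OF _ P]) (auto simp: p_def intro!: Kminus K(2) bK)
  have EK: "E \<in> K" unfolding E_def by (rule Kminus[OF PK DK])
  (* the iteration must commute with \<open>E\<close> to stay self-adjoint, and with \<open>d\<close> so that \<open>d y\<close> is self-adjoint *)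
  define S where "S = {z \<in> K. z\<^sup>\<star> = z \<and> z \<otimes> d = d \<otimes> z \<and> z \<otimes> E = E \<otimes> z}"
  have SD: "z \<in> carrier A" "z \<in> K" "z\<^sup>\<star> = z" "z \<otimes> d = d \<otimes> z" "z \<otimes> E = E \<otimes> z" if "z \<in> S" for z
    using that K(1) by (auto simp: S_def)
  have prod_comm: "(y \<otimes> z) \<otimes> x = x \<otimes> (y \<otimes> z)"
    if "y \<in> carrier A" "z \<in> carrier A" "x \<in> carrier A" "y \<otimes> x = x \<otimes> y" "z \<otimes> x = x \<otimes> z" for x y z
  proof -
    have "(y \<otimes> z) \<otimes> x = y \<otimes> (x \<otimes> z)" using that by (simp add: m_assoc)
    also have "\<dots> = (x \<otimes> y) \<otimes> z" using that by (simp flip: m_assoc)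
    finally show ?thesis using that by (simp add: m_assoc)
  qed
  have Smult: "y \<otimes> z \<in> S" if "y \<in> S" "z \<in> S" "y \<otimes> z = z \<otimes> y" for y z
    using SD[OF that(1)] SD[OF that(2)] that(3) d EA by (auto simp: S_def invol_mult K(5) prod_comm)
  have Sadd: "y \<oplus> z \<in> S" if "y \<in> S" "z \<in> S" for y z
    using SD[OF that(1)] SD[OF that(2)] d EA by (auto simp: S_def invol_add K(4) l_distr r_distr)
  have Ssm: "complex_of_real r \<odot> z \<in> S" if "z \<in> S" for r z
    using SD[OF that] d EA by (auto simp: S_def invol_smult K(6) smult_mult_left smult_mult_right)
  have Sminus: "y \<ominus> z \<in> S" if "y \<in> S" "z \<in> S" for y z
    using Sadd[OF that(1) Ssm[OF that(2), of "- 1"]] SD(1)[OF that(1)] SD(1)[OF that(2)] by (simp add: minus_eq_smult)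
  have S1: "\<one> \<in> S" using d EA K(2) by (simp add: S_def)
  have S0: "\<zero> \<in> S" using Sminus[OF S1 S1] by (simp add: minus_eq r_neg)
  have ES: "E \<in> S"
    using EK Estar PA DA d Pd dP dD by (simp add: S_def) (simp add: E_def minus_eq l_distr r_distr l_minus r_minus)
  obtain z where z: "z \<in> S" and eq: "(\<one> \<ominus> E) \<otimes> ((\<one> \<oplus> z) \<otimes> (\<one> \<oplus> z)) = \<one>"
  proof (rule inverse_sqrt_exists[of S E])
    show "z \<in> S" if f: "range f \<subseteq> S" "conv_in f z" for f z
    proof -
      have fS: "f n \<in> S" for n using f by auto
      note fc = SD[OF fS]
      have "z\<^sup>\<star> = z" using conv_in_unique[OF conv_in_star[OF f(2)]] f(2) by (simp add: fc)
      moreover have "z \<otimes> x = x \<otimes> z" if x: "x \<in> carrier A" "\<And>n. f n \<otimes> x = x \<otimes> f n" for x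
        using conv_in_unique[OF conv_in_mult[OF f(2) conv_in_const[OF x(1)]]] conv_in_mult_left[OF f(2) x(1)]
        by (simp add: x(2))
      moreover have "z \<in> K" by (rule K(7)[OF _ f(2)]) (use fc in auto)
      ultimately show ?thesis using d EA by (simp add: S_def fc)
    qed
    show "(1 / 2) \<odot> (E \<otimes> ((\<one> \<oplus> z) \<otimes> (\<one> \<oplus> z)) \<ominus> z \<otimes> z) \<in> S" if z: "z \<in> S" for z
    proof -
      have p: "(\<one> \<oplus> z) \<otimes> (\<one> \<oplus> z) \<in> S" by (intro Smult Sadd S1 z) simp
      show ?thesis
        using Ssm[OF Sminus[OF Smult[OF ES p SD(5)[OF p, symmetric]] Smult[OF z z refl]], of "1 / 2"] by simp
    qed
  qed (use ES S0 nE SD in auto)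
  define y where "y = \<one> \<oplus> z"
  have yS: "y \<in> S" unfolding y_def by (intro Sadd S1 z)
  note yc = SD[OF yS]
  define s where "s = d \<otimes> y"
  have sA: "s \<in> carrier A" using d yc by (simp add: s_def)
  have sstar: "s\<^sup>\<star> = s" using d yc by (simp add: s_def invol_mult)
  have Ps: "P \<otimes> s = s" unfolding s_def using PA d yc Pd by (simp flip: m_assoc)
  have sP: "s \<otimes> P = s" using arg_cong[OF Ps, of "invol A"] PA sA Pstar sstar by (simp add: invol_mult)
  have PE: "P \<otimes> (\<one> \<ominus> E) = D"
  proof -
    have "P \<otimes> (\<one> \<ominus> E) = P \<ominus> (P \<otimes> P \<ominus> P \<otimes> D)"
      unfolding E_def using PA DA by (simp add: minus_eq r_distr r_minus minus_add)
    also have "\<dots> = D" unfolding PP PD using PA DA by (simp add: minus_eq minus_add r_neg2)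
    finally show ?thesis .
  qed
  have ss: "s \<otimes> s = P"
  proof -
    have "s \<otimes> s = d \<otimes> ((y \<otimes> d) \<otimes> y)" unfolding s_def using d(1) yc(1) by (simp add: m_assoc)
    also have "\<dots> = D \<otimes> (y \<otimes> y)" unfolding yc(4) D_def using d(1) yc(1) by (simp add: m_assoc)
    also have "\<dots> = P \<otimes> ((\<one> \<ominus> E) \<otimes> (y \<otimes> y))" unfolding PE[symmetric] using PA EA yc(1) by (simp add: m_assoc)
    also have "\<dots> = P" using eq PA by (simp add: y_def)
    finally show ?thesis .
  qed
  show ?thesis
    by (rule that[OF P[unfolded p_def b_def D_def] PK Pstar PP s_def yc(2) sstar ss Ps sP])
qed

end

section \<open>The Fourier-orthogonal projection\<close>

context bounded_family
begin

text \<open>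
  On this closed subalgebra an identity between continuous maps can be checked on the series, where
  coefficients are available.
\<close>

definition rep_closure :: "'a set" where
  "rep_closure = {x \<in> carrier A. \<forall>e>0. \<exists>a. l1 a \<and> nrm A (x \<ominus> rep a) < e}"

lemma rep_closure_iff: "x \<in> rep_closure \<longleftrightarrow> (\<exists>a. (\<forall>n::nat. l1 (a n)) \<and> conv_in (\<lambda>n. rep (a n)) x)"
proof
  assume x: "x \<in> rep_closure"
  then have "\<forall>n::nat. \<exists>a. l1 a \<and> nrm A (x \<ominus> rep a) < 1 / Suc n" by (auto simp: rep_closure_def)
  then obtain a where a: "\<And>n. l1 (a n)" "\<And>n::nat. nrm A (x \<ominus> rep (a n)) < 1 / Suc n" by metis
  have "conv_in (\<lambda>n. rep (a n)) x"
  proof (rule conv_inI[where e = "\<lambda>n. 1 / Suc n"])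
    show "nrm A (rep (a n) \<ominus> x) \<le> 1 / Suc n" for n
      using a(2)[of n] x by (subst nrm_minus_commute) (auto simp: rep_closure_def rep_closed a)
    show "(\<lambda>n. 1 / real (Suc n)) \<longlonglongrightarrow> 0" using LIMSEQ_inverse_real_of_nat by (simp add: inverse_eq_divide)
  qed (use x in \<open>auto simp: rep_closure_def rep_closed a\<close>)
  with a show "\<exists>a. (\<forall>n::nat. l1 (a n)) \<and> conv_in (\<lambda>n. rep (a n)) x" by blast
next
  assume "\<exists>a. (\<forall>n::nat. l1 (a n)) \<and> conv_in (\<lambda>n. rep (a n)) x"
  then obtain a where a: "\<And>n::nat. l1 (a n)" "conv_in (\<lambda>n. rep (a n)) x" by blast
  note c = conv_inD[OF a(2)]
  have "\<exists>a. l1 a \<and> nrm A (x \<ominus> rep a) < e" if "e > 0" for e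
  proof -
    have "eventually (\<lambda>n. nrm A (rep (a n) \<ominus> x) < e) sequentially"
      by (rule order_tendstoD(2)[OF c(3) that])
    then obtain n where "nrm A (rep (a n) \<ominus> x) < e" by (auto simp: eventually_sequentially)
    then show ?thesis using a(1)[of n] c nrm_minus_commute[of x "rep (a n)"] by auto
  qed
  then show "x \<in> rep_closure" using c by (simp add: rep_closure_def)
qed

lemma rep_in_rep_closure: "l1 a \<Longrightarrow> rep a \<in> rep_closure"
  unfolding rep_closure_iff by (intro exI[of _ "\<lambda>_. a"]) (auto intro: conv_in_const rep_closed)

lemma rep_closure_add: "x \<in> rep_closure \<Longrightarrow> y \<in> rep_closure \<Longrightarrow> x \<oplus> y \<in> rep_closure"
proof -
  assume "x \<in> rep_closure" "y \<in> rep_closure"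
  then obtain a b where a: "\<And>n::nat. l1 (a n)" "conv_in (\<lambda>n. rep (a n)) x"
    and b: "\<And>n::nat. l1 (b n)" "conv_in (\<lambda>n. rep (b n)) y"
    unfolding rep_closure_iff by blast
  have "conv_in (\<lambda>n. rep (\<lambda>z. a n z + b n z)) (x \<oplus> y)"
    using conv_in_add[OF a(2) b(2)] by (simp add: rep_add[OF a(1) b(1)])
  then show ?thesis unfolding rep_closure_iff using l1_add[OF a(1) b(1)] by (intro exI[of _ "\<lambda>n z. a n z + b n z"]) auto
qed

lemma rep_closure_smult: "x \<in> rep_closure \<Longrightarrow> c \<odot> x \<in> rep_closure"
proof -
  assume "x \<in> rep_closure"
  then obtain a where a: "\<And>n::nat. l1 (a n)" "conv_in (\<lambda>n. rep (a n)) x"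
    unfolding rep_closure_iff by blast
  have "conv_in (\<lambda>n. rep (\<lambda>z. c * a n z)) (c \<odot> x)"
    using conv_in_smult[OF a(2), of c] by (simp add: rep_smult[OF a(1)])
  then show ?thesis unfolding rep_closure_iff using l1_cmult[OF a(1)] by (intro exI[of _ "\<lambda>n z. c * a n z"]) auto
qed

lemma rep_closure_limit:
  assumes f: "range f \<subseteq> rep_closure" and x: "conv_in f x"
  shows "x \<in> rep_closure"
proof -
  note c = conv_inD[OF x]
  have "\<exists>a. l1 a \<and> nrm A (x \<ominus> rep a) < e" if e: "e > 0" for e
  proof -
    have "eventually (\<lambda>n. nrm A (f n \<ominus> x) < e / 2) sequentially"
      by (rule order_tendstoD(2)[OF c(3)]) (use e in simp)
    then obtain n where n: "nrm A (f n \<ominus> x) < e / 2" by (auto simp: eventually_sequentially)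
    have "f n \<in> rep_closure" using f by auto
    then obtain a where a: "l1 a" "nrm A (f n \<ominus> rep a) < e / 2"
      using half_gt_zero[OF e] unfolding rep_closure_def mem_Collect_eq by blast
    have "nrm A (x \<ominus> rep a) \<le> nrm A (x \<ominus> f n) + nrm A (f n \<ominus> rep a)"
      by (rule nrm_minus_triangle) (use c rep_closed[OF a(1)] in auto)
    also have "\<dots> < e" using n a(2) nrm_minus_commute[of x "f n"] c by simp
    finally show ?thesis using a by blast
  qed
  then show ?thesis using c by (simp add: rep_closure_def)
qed

end

lemma (in twisted_rep) rep_closure_mult: "x \<in> rep_closure \<Longrightarrow> y \<in> rep_closure \<Longrightarrow> x \<otimes> y \<in> rep_closure"
proof -
  assume "x \<in> rep_closure" "y \<in> rep_closure"
  then obtain a b where a: "\<And>n::nat. l1 (a n)" "conv_in (\<lambda>n. rep (a n)) x"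
    and b: "\<And>n::nat. l1 (b n)" "conv_in (\<lambda>n. rep (b n)) y"
    unfolding rep_closure_iff by blast
  have "conv_in (\<lambda>n. rep (tconv c (a n) (b n))) (x \<otimes> y)"
    using conv_in_mult[OF a(2) b(2)] by (simp add: rep_mult[OF a(1) b(1)])
  moreover have "l1 (tconv c (a n) (b n))" for n by (rule l1_tconv(1)[OF a(1) b(1) norm_c])
  ultimately show ?thesis unfolding rep_closure_iff by (intro exI[of _ "\<lambda>n. tconv c (a n) (b n)"]) auto
qed

context rotation_system
begin

text \<open>
  Each further factor \<open>1 - d\<^sup>2\<close> is two applications of the product formula \<open>gabor_sum_tconv\<close>, which is
  one step of \<open>dual_iter\<close>.
\<close>

lemma vacuum_power:
  assumes \<theta>: "0 < \<theta>"
  defines "d \<equiv> rep (gabor (2 * \<theta>) 1 (0, 0))"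
  shows "d \<otimes> (\<one> \<ominus> d \<otimes> d) [^] (n::nat) = rep (gabor_sum (2 * \<theta>) 1 (dual_iter (2 * \<theta>) n))"
    and "d \<otimes> (\<one> \<ominus> d \<otimes> d) [^] n \<otimes> d =
      rep (gabor_sum (2 * \<theta>) 0 (tconv (dualc (2 * \<theta>)) (dual_iter (2 * \<theta>) n) (gram (2 * \<theta>) 1)))"
proof -
  let ?\<beta> = "2 * \<theta>"
  have \<beta>: "?\<beta> > 0" using \<theta> by simp
  have dl: "l1 (gabor ?\<beta> 1 (0, 0))" by (rule gabor_l1(1)[OF \<beta>])
  have dA: "d \<in> carrier A" unfolding d_def by (rule rep_closed[OF dl])
  have mult_d: "rep (gabor_sum ?\<beta> i k) \<otimes> d = rep (gabor_sum ?\<beta> (i + 1) (tconv (dualc ?\<beta>) k (gram ?\<beta> i)))" if "l1 k" for i k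
  proof -
    have "rep (gabor_sum ?\<beta> i k) \<otimes> d = rep (tconv (rotc \<theta>) (gabor_sum ?\<beta> i k) (gabor ?\<beta> 1 (0, 0)))"
      unfolding d_def by (rule rep_mult[OF l1_gabor_sum(1)[OF \<beta> that] dl])
    also have "tconv (rotc \<theta>) (gabor_sum ?\<beta> i k) (gabor ?\<beta> 1 (0, 0)) = gabor_sum ?\<beta> (i + 1) (tconv (dualc ?\<beta>) k (gram ?\<beta> i))"
      using gabor_sum_tconv[OF \<beta> that, of i] by (intro ext) simp
    finally show ?thesis .
  qed
  have gs: "gabor_sum ?\<beta> i k = gabor_sum ?\<beta> j k" if "even (i - j)" for i j k
    unfolding gabor_sum_def gabor_parity[OF that] ..
  have tl: "l1 (tconv (dualc ?\<beta>) k (gram ?\<beta> i))" if "l1 k" for k i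
    by (rule l1_tconv(1)[OF that gram_l1(1)[OF \<beta>] norm_dualc])
  have once: "rep (gabor_sum ?\<beta> 1 k) \<otimes> d = rep (gabor_sum ?\<beta> 0 (tconv (dualc ?\<beta>) k (gram ?\<beta> 1)))" if "l1 k" for k
    using mult_d[OF that, of 1] gs[of 2 0] by simp
  have twice: "rep (gabor_sum ?\<beta> 1 k) \<otimes> d \<otimes> d =
      rep (gabor_sum ?\<beta> 1 (tconv (dualc ?\<beta>) (tconv (dualc ?\<beta>) k (gram ?\<beta> 1)) (gram ?\<beta> 0)))" if "l1 k" for k
    unfolding once[OF that] using mult_d[OF tl[OF that], of 0] by simp
  have main: "d \<otimes> (\<one> \<ominus> d \<otimes> d) [^] n = rep (gabor_sum ?\<beta> 1 (dual_iter ?\<beta> n))" for n :: nat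
  proof (induction n)
    case 0
    then show ?case using dA by (simp add: gabor_sum_l1delta d_def)
  next
    case (Suc n)
    let ?x = "rep (gabor_sum ?\<beta> 1 (dual_iter ?\<beta> n))"
    let ?l = "tconv (dualc ?\<beta>) (tconv (dualc ?\<beta>) (dual_iter ?\<beta> n) (gram ?\<beta> 1)) (gram ?\<beta> 0)"
    note k = l1_dual_iter[OF \<beta>, of n]
    have xA: "?x \<in> carrier A" by (rule rep_closed[OF l1_gabor_sum(1)[OF \<beta> k]])
    have "d \<otimes> (\<one> \<ominus> d \<otimes> d) [^] Suc n = (d \<otimes> (\<one> \<ominus> d \<otimes> d) [^] n) \<otimes> (\<one> \<ominus> d \<otimes> d)"
      using dA by (simp add: m_assoc)
    also have "\<dots> = ?x \<ominus> ?x \<otimes> d \<otimes> d"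
      unfolding Suc.IH using dA xA by (simp add: r_distr_minus m_assoc)
    also have "\<dots> = rep (\<lambda>z. gabor_sum ?\<beta> 1 (dual_iter ?\<beta> n) z - gabor_sum ?\<beta> 1 ?l z)"
      unfolding twice[OF k] by (intro rep_diff[symmetric] l1_gabor_sum(1)[OF \<beta>] k tl)
    also have "(\<lambda>z. gabor_sum ?\<beta> 1 (dual_iter ?\<beta> n) z - gabor_sum ?\<beta> 1 ?l z) = gabor_sum ?\<beta> 1 (dual_iter ?\<beta> (Suc n))"
      unfolding dual_iter.simps by (intro ext gabor_sum_diff[OF \<beta>, symmetric] k tl)
    finally show ?case .
  qed
  show "d \<otimes> (\<one> \<ominus> d \<otimes> d) [^] n = rep (gabor_sum ?\<beta> 1 (dual_iter ?\<beta> n))" by (rule main)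
  show "d \<otimes> (\<one> \<ominus> d \<otimes> d) [^] n \<otimes> d =
      rep (gabor_sum ?\<beta> 0 (tconv (dualc ?\<beta>) (dual_iter ?\<beta> n) (gram ?\<beta> 1)))"
    unfolding main by (rule once[OF l1_dual_iter[OF \<beta>]])
qed

text \<open>
  The element \<open>s\<close> of \<open>selfadjoint_tripotent_exists\<close> satisfies \<open>\<sigma> s = - s\<close> because \<open>\<sigma> d = - d\<close>
  and \<open>y\<close> is fixed by \<open>\<sigma>\<close>. Hence \<open>e = (P + s) / 2\<close> and \<open>\<sigma> e = (P - s) / 2\<close> are orthogonal projections with
  sum \<open>P\<close>. The trace of \<open>s\<close> is its own negative, and that of \<open>P\<close> is computed from the telescoping
  coefficients at the origin.
\<close>

theorem fourier_projection_exists: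
  fixes \<sigma> :: "'a \<Rightarrow> 'a" and \<tau> :: "'a \<Rightarrow> complex"
  assumes \<theta>: "0 < \<theta>" "\<theta> < 0.2345"
    and h: "star_hom A A \<sigma>" and sU: "\<sigma> U = V" and sV: "\<sigma> V = U\<^sup>\<star>"
    and tr: "tracial_state A \<tau>"
    and tr0: "\<And>(m::int) (n::int). (m, n) \<noteq> (0, 0) \<Longrightarrow> \<tau> (U [^] m \<otimes> V [^] n) = 0"
  shows "\<exists>e. projection_in A e \<and> \<tau> e = of_real \<theta> \<and> e \<otimes> \<sigma> e = \<zero> \<and> \<sigma> (\<sigma> e) = e \<and>
             projection_in A (e \<oplus> \<sigma> e) \<and> \<sigma> (e \<oplus> \<sigma> e) = e \<oplus> \<sigma> e \<and>
             \<tau> (e \<oplus> \<sigma> e) = of_real (2 * \<theta>)"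
proof -
  note H = star_hom_props[OF h]
  define \<beta> where "\<beta> = 2 * \<theta>"
  have \<beta>: "0 < \<beta>" "\<beta> \<le> 0.469" using \<theta> by (auto simp: \<beta>_def)
  have T: "x \<in> carrier A \<Longrightarrow> y \<in> carrier A \<Longrightarrow> \<tau> (x \<oplus> y) = \<tau> x + \<tau> y"
    "x \<in> carrier A \<Longrightarrow> \<tau> (c \<odot> x) = c * \<tau> x" "x \<in> carrier A \<Longrightarrow> cmod (\<tau> x) \<le> nrm A x" "\<tau> \<one> = 1" for x y c
    using tr by (auto simp: tracial_state_def)
  have Tminus: "\<tau> (x \<ominus> y) = \<tau> x - \<tau> y" if "x \<in> carrier A" "y \<in> carrier A" for x y
    using that by (simp add: minus_eq_smult T)
  have Tconv: "(\<lambda>n. \<tau> (f n)) \<longlonglongrightarrow> \<tau> x" if f: "conv_in f x" for f x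
  proof -
    note c = conv_inD[OF f]
    have "(\<lambda>n. \<tau> (f n) - \<tau> x) \<longlonglongrightarrow> 0"
      by (rule Lim_null_comparison[OF _ c(3)]) (use c T(3) in \<open>auto simp flip: Tminus intro!: always_eventually\<close>)
    then show ?thesis by (simp add: LIM_zero_iff)
  qed
  have Tweyl: "\<tau> (weyl z) = (if z = 0 then 1 else 0)" for z
    using tr0 by (cases z) (auto simp: weyl_0 T zero_prod_def weyl_def)
  have Trep: "\<tau> (rep a) = a 0" if "l1 a" for a
    by (rule rep_functional[OF T(1,2,3,4) Tweyl that])
  have \<sigma>rep: "\<sigma> (rep a) = rep (\<lambda>(m, n). a (n, - m))" if "l1 a" for a
  proof -
    have "\<sigma> (rep a) = rep (\<lambda>z. a ((\<lambda>(m, n). (n, - m)) z))"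
      by (rule rep_hom[OF h, where n = "\<lambda>(m, n). (- n, m)"]) (auto simp: fourier_weyl[OF h sU sV] that)
    then show ?thesis by (simp add: case_prod_unfold)
  qed
  have T\<sigma>: "\<tau> (\<sigma> x) = \<tau> x" if x: "x \<in> rep_closure" for x
  proof -
    obtain a where a: "\<And>n::nat. l1 (a n)" "conv_in (\<lambda>n. rep (a n)) x" using x unfolding rep_closure_iff by blast
    have "l1 (\<lambda>(m, n). a k (n, - m))" for k
    proof -
      have "bij (\<lambda>(m, n). (n, - m) :: int \<times> int)"
        by (rule bij_betwI[where g = "\<lambda>(m, n). (- n, m)"]) auto
      from summable_on_reindex_bij_betw[OF this, of "\<lambda>z. norm (a k z)"] a(1)[of k]
      show ?thesis by (simp add: case_prod_unfold)
    qed
    then have eq: "\<tau> (\<sigma> (rep (a k))) = \<tau> (rep (a k))" for k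
      by (simp add: \<sigma>rep[OF a(1)] Trep a(1)) (simp add: zero_prod_def)
    have "(\<lambda>n. \<tau> (\<sigma> (rep (a n)))) \<longlonglongrightarrow> \<tau> (\<sigma> x)" by (rule Tconv[OF star_hom_conv_in[OF h a(2)]])
    then have "(\<lambda>n. \<tau> (rep (a n))) \<longlonglongrightarrow> \<tau> (\<sigma> x)" unfolding eq .
    then show ?thesis using LIMSEQ_unique Tconv[OF a(2)] by blast
  qed
  define d where "d = rep (gabor \<beta> 1 (0, 0))"
  have dl: "l1 (gabor \<beta> 1 (0, 0))" by (rule gabor_l1(1)[OF \<beta>(1)])
  have dA: "d \<in> carrier A" unfolding d_def by (rule rep_closed[OF dl])
  have dstar: "d\<^sup>\<star> = d"
    unfolding d_def using rep_star[where n = uminus, OF weyl_star _ dl] by (simp add: gabor_vacuum_star)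
  have d\<sigma>: "\<sigma> d = (- 1) \<odot> d"
  proof -
    have "(\<lambda>(m, n). gabor \<beta> 1 (0, 0) (n, - m)) = (\<lambda>z. - 1 * gabor \<beta> 1 (0, 0) z)"
      using gabor_vacuum_rotate[of \<beta>] by auto
    then show ?thesis unfolding d_def \<sigma>rep[OF dl] by (simp only: rep_smult[OF dl])
  qed
  note pow = vacuum_power[OF \<theta>(1), folded \<beta>_def, folded d_def]
  define q where "q = (l1norm (gram \<beta> 0))\<^sup>2 - 1"
  have kq: "l1norm (dual_iter \<beta> n) \<le> q ^ n" for n unfolding q_def by (rule dual_iter_norm[OF \<beta>(1)])
  have q: "0 \<le> q" "q \<le> 0.33"
    using kq[of 1] l1norm_nonneg[of "dual_iter \<beta> 1"] gram_norm_bound[OF \<beta>] by (auto simp: q_def)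
  have gb: "gabor_bound \<beta> \<ge> 0" using \<beta>(1) by (simp add: gabor_bound_def)
  have decay: "nrm A (d \<otimes> (\<one> \<ominus> d \<otimes> d) [^] n) \<le> gabor_bound \<beta> * q ^ n" for n :: nat
  proof -
    note k = l1_dual_iter[OF \<beta>(1), of n]
    have "nrm A (d \<otimes> (\<one> \<ominus> d \<otimes> d) [^] n) \<le> l1norm (gabor_sum \<beta> 1 (dual_iter \<beta> n))"
      unfolding pow(1) by (rule rep_nrm[OF l1_gabor_sum(1)[OF \<beta>(1) k]])
    also have "\<dots> \<le> gabor_bound \<beta> * l1norm (dual_iter \<beta> n)" by (rule l1_gabor_sum(2)[OF \<beta>(1) k])
    also have "\<dots> \<le> gabor_bound \<beta> * q ^ n" by (rule mult_left_mono[OF kq gb])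
    finally show ?thesis .
  qed
  (* membership in \<open>K\<close> gives \<open>\<sigma> y = y\<close>, and makes the trace of \<open>d y\<close> invariant under \<open>\<sigma>\<close> *)
  define K where "K = {x \<in> rep_closure. \<sigma> x = x}"
  have clA: "x \<in> rep_closure \<Longrightarrow> x \<in> carrier A" for x by (simp add: rep_closure_def)
  have d_cl: "d \<in> rep_closure" unfolding d_def by (rule rep_in_rep_closure[OF dl])
  have one_cl: "\<one> \<in> rep_closure"
    using rep_in_rep_closure[of "point_mass 0 1"] by (simp add: rep_point_mass weyl_0)
  obtain P s y where P: "conv_in (\<lambda>n. \<one> \<ominus> (\<one> \<ominus> d \<otimes> d) [^] (n::nat)) P" and PK: "P \<in> K"
    and Pstar: "P\<^sup>\<star> = P" and PP: "P \<otimes> P = P" and s: "s = d \<otimes> y" and yK: "y \<in> K"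
    and sstar: "s\<^sup>\<star> = s" and ss: "s \<otimes> s = P" and Ps: "P \<otimes> s = s" and sP: "s \<otimes> P = s"
  proof (rule selfadjoint_tripotent_exists[OF dA dstar q decay])
    show "K \<subseteq> carrier A" by (auto simp: K_def clA)
    show "\<one> \<in> K" by (simp add: K_def one_cl H)
    show "d \<otimes> d \<in> K" using dA by (simp add: K_def rep_closure_mult d_cl H d\<sigma> smult_mult_left smult_mult_right smult_smult)
    show "x \<oplus> y \<in> K" "x \<otimes> y \<in> K" if "x \<in> K" "y \<in> K" for x y
      using that by (auto simp: K_def rep_closure_add rep_closure_mult H clA)
    show "c \<odot> x \<in> K" if "x \<in> K" for c x using that by (simp add: K_def rep_closure_smult H clA)
    show "x \<in> K" if f: "range f \<subseteq> K" "conv_in f x" for f x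
    proof -
      have fK: "f n \<in> K" for n using f by auto
      have "x \<in> rep_closure" by (rule rep_closure_limit[OF _ f(2)]) (use f(1) in \<open>auto simp: K_def\<close>)
      moreover have "conv_in f (\<sigma> x)"
        using star_hom_conv_in[OF h f(2)] fK by (simp add: K_def)
      ultimately show ?thesis using conv_in_unique f(2) by (auto simp: K_def)
    qed
  qed
  have PA: "P \<in> carrier A" and \<sigma>P: "\<sigma> P = P" using PK by (auto simp: K_def clA)
  have yA: "y \<in> carrier A" and \<sigma>y: "\<sigma> y = y" using yK by (auto simp: K_def clA)
  have sA: "s \<in> carrier A" using dA yA by (simp add: s)
  have \<sigma>s: "\<sigma> s = (- 1) \<odot> s" using dA yA by (simp add: s H d\<sigma> \<sigma>y smult_mult_left)
  have "s \<in> rep_closure" using yK unfolding s by (intro rep_closure_mult d_cl) (simp add: K_def)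
  from T\<sigma>[OF this] have Ts: "\<tau> s = 0" using sA by (simp add: \<sigma>s T)
  have TP: "\<tau> P = of_real \<beta>"
  proof -
    have Tn: "\<tau> (\<one> \<ominus> (\<one> \<ominus> d \<otimes> d) [^] n) = of_real \<beta> * (1 - dual_iter \<beta> n 0)" for n :: nat
    proof (induction n)
      case 0
      then show ?case by (simp add: Tminus l1delta_def)
    next
      case (Suc n)
      let ?b = "\<one> \<ominus> d \<otimes> d" and ?k = "dual_iter \<beta> n"
      let ?l = "tconv (dualc \<beta>) ?k (gram \<beta> 1)"
      have bA: "?b \<in> carrier A" using dA by simp
      have l: "l1 ?l" by (rule l1_tconv(1)[OF l1_dual_iter[OF \<beta>(1)] gram_l1(1)[OF \<beta>(1)] norm_dualc])
      have tc: "\<tau> (x \<otimes> y) = \<tau> (y \<otimes> x)" if "x \<in> carrier A" "y \<in> carrier A" for x y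
        using tr that by (auto simp: tracial_state_def)
      have "\<tau> (d \<otimes> d \<otimes> ?b [^] n) = \<tau> (d \<otimes> ?b [^] n \<otimes> d)"
        using tc[of d "d \<otimes> ?b [^] n"] dA bA by (simp add: m_assoc)
      also have "\<dots> = gabor_sum \<beta> 0 ?l 0"
        unfolding pow(2) by (rule Trep[OF l1_gabor_sum(1)[OF \<beta>(1) l]])
      also have "\<dots> = of_real \<beta> * (?k 0 - dual_iter \<beta> (Suc n) 0)"
        by (simp add: gabor_sum_at_0[OF \<beta>(1)])
      finally have t: "\<tau> (d \<otimes> d \<otimes> ?b [^] n) = of_real \<beta> * (?k 0 - dual_iter \<beta> (Suc n) 0)" .
      have "?b [^] Suc n = ?b \<otimes> ?b [^] n" by (rule nat_pow_Suc2[OF bA])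
      also have "\<dots> = ?b [^] n \<ominus> d \<otimes> d \<otimes> ?b [^] n"
        using l_distr_minus[OF one_closed m_closed[OF dA dA] nat_pow_closed[OF bA], of n] bA by simp
      finally have "\<tau> (?b [^] Suc n) = \<tau> (?b [^] n) - \<tau> (d \<otimes> d \<otimes> ?b [^] n)"
        using Tminus bA dA by (metis m_closed nat_pow_closed)
      moreover have one_minus: "\<tau> (\<one> \<ominus> ?b [^] m) = 1 - \<tau> (?b [^] m)" for m :: nat
        using Tminus[OF one_closed nat_pow_closed[OF bA]] T(4) by simp
      ultimately have "\<tau> (\<one> \<ominus> ?b [^] Suc n) = \<tau> (\<one> \<ominus> ?b [^] n) + \<tau> (d \<otimes> d \<otimes> ?b [^] n)"
        by (simp only: one_minus diff_diff_eq2 diff_add_eq)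
      also have "\<dots> = of_real \<beta> * (1 - dual_iter \<beta> (Suc n) 0)"
        unfolding Suc.IH t distrib_left[symmetric] by (simp only: diff_add_cancel add_diff_eq)
      finally show ?case .
    qed
    have "(\<lambda>n. dual_iter \<beta> n 0) \<longlonglongrightarrow> 0"
    proof (rule Lim_null_comparison)
      show "(\<lambda>n. q ^ n) \<longlonglongrightarrow> 0" using q by (intro LIMSEQ_power_zero) auto
      have "norm (dual_iter \<beta> n 0) \<le> q ^ n" for n
        using finite_sum_le_infsum[OF l1_dual_iter[OF \<beta>(1), of n], of "{0}"] kq[of n] by (simp add: l1norm_def)
      then show "\<forall>\<^sub>F n in sequentially. norm (dual_iter \<beta> n 0) \<le> q ^ n" by simp
    qed
    then have "(\<lambda>n. of_real \<beta> * (1 - dual_iter \<beta> n 0)) \<longlonglongrightarrow> of_real \<beta> * (1 - 0)"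
      by (intro tendsto_intros)
    then have "(\<lambda>n. of_real \<beta> * (1 - dual_iter \<beta> n 0)) \<longlonglongrightarrow> complex_of_real \<beta>" by simp
    then show ?thesis using Tconv[OF P] unfolding Tn by (rule LIMSEQ_unique[rotated])
  qed
  define e where "e = (1 / 2) \<odot> (P \<oplus> s)"
  have eA: "e \<in> carrier A" using PA sA by (simp add: e_def)
  have \<sigma>e: "\<sigma> e = (1 / 2) \<odot> (P \<ominus> s)" using PA sA by (simp add: e_def H \<sigma>P \<sigma>s minus_eq_smult)
  have half: "(1 / 2) \<odot> x \<oplus> (1 / 2) \<odot> x = x" if "x \<in> carrier A" for x
    using smult_add_left[OF that, of "1 / 2" "1 / 2"] that by simp
  have sum: "e \<oplus> \<sigma> e = P"
  proof -
    have "e \<oplus> \<sigma> e = ((1 / 2) \<odot> P \<oplus> (1 / 2) \<odot> P) \<oplus> ((1 / 2) \<odot> s \<ominus> (1 / 2) \<odot> s)"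
    proof -
      have "(1 / 2) \<odot> (\<ominus> s) = \<ominus> ((1 / 2) \<odot> s)" using sA by (simp add: uminus_eq_smult smult_smult)
      then show ?thesis unfolding \<sigma>e unfolding e_def using PA sA by (simp add: smult_add_right minus_eq a_ac)
    qed
    then show ?thesis using PA sA half by (simp add: minus_eq r_neg)
  qed
  have ee: "e \<otimes> e = e"
  proof -
    have "(P \<oplus> s) \<otimes> (P \<oplus> s) = (P \<oplus> s) \<oplus> (P \<oplus> s)"
      using PA sA by (simp add: l_distr r_distr PP Ps sP ss a_ac)
    then have "e \<otimes> e = (1 / 4) \<odot> ((P \<oplus> s) \<oplus> (P \<oplus> s))"
      unfolding e_def using PA sA by (simp add: smult_mult_left smult_mult_right smult_smult)
    also have "(P \<oplus> s) \<oplus> (P \<oplus> s) = 2 \<odot> (P \<oplus> s)" using smult_add_left[of "P \<oplus> s" 1 1] PA sA by simp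
    finally show ?thesis unfolding e_def using PA sA by (simp add: smult_smult)
  qed
  have e\<sigma>e: "e \<otimes> \<sigma> e = \<zero>"
  proof -
    have "(P \<oplus> s) \<otimes> (P \<ominus> s) = (P \<otimes> P \<ominus> P \<otimes> s) \<oplus> (s \<otimes> P \<ominus> s \<otimes> s)"
      using PA sA by (simp only: l_distr r_distr_minus minus_closed)
    also have "\<dots> = (P \<ominus> s) \<oplus> (s \<ominus> P)" unfolding PP Ps sP ss ..
    also have "\<dots> = \<zero>" using PA sA by (simp add: minus_eq a_assoc r_neg1 r_neg)
    finally show ?thesis unfolding \<sigma>e unfolding e_def
      using PA sA by (simp add: smult_mult_left smult_mult_right smult_smult)
  qed
  have estar: "e\<^sup>\<star> = e" using PA sA by (simp add: e_def invol_smult invol_add Pstar sstar)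
  have \<sigma>\<sigma>e: "\<sigma> (\<sigma> e) = e"
    unfolding \<sigma>e unfolding e_def using PA sA by (simp add: H \<sigma>P \<sigma>s minus_eq_smult smult_smult)
  have "projection_in A e" using eA estar ee by (simp add: projection_in_def)
  moreover have "\<tau> e = of_real \<theta>" using PA sA by (simp add: e_def T TP Ts \<beta>_def)
  moreover have "projection_in A P" using PA Pstar PP by (simp add: projection_in_def)
  moreover have "\<tau> P = of_real (2 * \<theta>)" using TP by (simp add: \<beta>_def)
  ultimately show ?thesis using e\<sigma>e \<sigma>\<sigma>e sum \<sigma>P by (intro exI[of _ e]) simp
qed

end

theorem theorem1p1:
  fixes \<theta> :: real and A :: "'a cstar" and U V :: 'a
    and \<sigma> :: "'a \<Rightarrow> 'a" and \<tau> :: "'a \<Rightarrow> complex"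
  assumes "0 < \<theta>" and "\<theta> < 0.2345"
    and "rotation_algebra \<theta> A U V"
    and "fourier_transform A U V \<sigma>"
    and "canonical_trace A U V \<tau>"
  shows "\<exists>e. projection_in A e \<and> \<tau> e = of_real \<theta> \<and>
             e \<otimes>\<^bsub>A\<^esub> \<sigma> e = \<zero>\<^bsub>A\<^esub> \<and> \<sigma> (\<sigma> e) = e \<and>
             projection_in A (e \<oplus>\<^bsub>A\<^esub> \<sigma> e) \<and>
             \<sigma> (e \<oplus>\<^bsub>A\<^esub> \<sigma> e) = e \<oplus>\<^bsub>A\<^esub> \<sigma> e \<and>
             \<tau> (e \<oplus>\<^bsub>A\<^esub> \<sigma> e) = of_real (2 * \<theta>)"
proof -
  interpret cstar_algebra A using assms(3) by (simp add: rotation_algebra_def)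
  interpret rotation_system A \<theta> U V
    by unfold_locales (use assms(3) in \<open>simp add: rotation_algebra_def\<close>)
  show ?thesis
  proof (rule fourier_projection_exists)
    show "star_hom A A \<sigma>" "\<sigma> U = V" "\<sigma> V = U\<^sup>\<star>\<^bsub>A\<^esub>"
      using assms(4) unitary_in_inv[OF U] by (auto simp: fourier_transform_def star_automorphism_def)
  qed (use assms in \<open>auto simp: canonical_trace_def\<close>)
qed

end
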